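(* Let $d\ge 2$, $C_1, C_2 > 0$ and $x, y \in \mathbb{R}^d$, and let $F_1, \ldots, F_d$ be the $2^{d-1}\times 2^{d-1}$ self-adjoint matrices $F_j=F_j^{[d]}$ defined recursively in the context. Let $\overline{\mathbb{B}}_{2,d}$ be the closed Euclidean unit ball of $\mathbb{R}^d$. Then the following are equivalent. (1) $\mathcal{W}^{\max}(x + C_1 \cdot \overline{\mathbb{B}}_{2,d}) \subseteq \mathcal{W}^{\min}(y + C_2 \cdot \overline{\mathbb{B}}_{2,d})$. (2) $\mathcal{W}^{\max}_{2^{d-1}}(x + C_1 \cdot \overline{\mathbb{B}}_{2,d}) \subseteq \mathcal{W}^{\min}_{2^{d-1}}(y + C_2 \cdot \overline{\mathbb{B}}_{2,d})$. (3) $x + C_1 \cdot (F_1, \ldots, F_d) \in \mathcal{W}^{\min}_{2^{d-1}}(y + C_2 \cdot \overline{\mathbb{B}}_{2,d})$. (4) $C_2 \geq \sqrt{\|y - x\|^2 + C_1^2 (d-1)^2} + C_1$. (5) There is a simplex $\Pi$ with $x + C_1 \cdot \overline{\mathbb{B}}_{2,d} \subseteq \Pi \subseteq y + C_2 \cdot \overline{\mathbb{B}}_{2,d}$.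
   Context: Define matrices $F_j^{[d]}$, $1\le j\le d$, recursively by $F_1^{[1]}=1$ and, for $d\ge 2$, $F_j^{[d]}=\begin{pmatrix}0&1\\1&0\end{pmatrix}\otimes F_j^{[d-1]}$ for $1\le j\le d-1$ and $F_d^{[d]}=\begin{pmatrix}1&0\\0&-1\end{pmatrix}\otimes I_{2^{d-2}}$. Here $x+C_1\cdot(F_1,\dots,F_d)=(x_1I+C_1F_1,\dots,x_dI+C_1F_d)$, and $\|\cdot\|$ is the Euclidean norm. A simplex is the convex hull of affinely independent points. $(M_n)^d_{sa}$ denotes $d$-tuples of self-adjoint complex $n\times n$ matrices. For a $d$-tuple $A$ of bounded operators on a Hilbert space, $\mathcal{W}_1(A)=\{(\varphi(A_1),\dots,\varphi(A_d)) : \varphi \text{ a state on the unital } C^*\text{-algebra generated by } A\}$. A tuple $N$ on $H_2$ is a dilation of a tuple $X$ on $H_1$ ($X\prec N$) if there is an isometry $V:H_1\to H_2$ with $X_i=V^*N_iV$ for all $i$. A normal tuple is a tuple of commuting normal bounded operators; $\sigma(N)$ is its joint spectrum. For a closed convex set $K\subseteq\mathbb{R}^d$: $\mathcal{W}^{\max}_n(K)=\{X\in(M_n)^d_{sa}:\mathcal{W}_1(X)\subseteq K\}$, $\mathcal{W}^{\min}_n(K)=\{X\in(M_n)^d_{sa}: \text{there is a normal tuple } N \text{ on some Hilbert space with } X\prec N,\ \sigma(N)\subseteq K\}$, $\mathcal{W}^{\max}(K)=\bigcup_n\mathcal{W}^{\max}_n(K)$, $\mathcal{W}^{\min}(K)=\bigcup_n\mathcal{W}^{\min}_n(K)$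 (containment is levelwise). *)

theory Defs
  imports
    "HOL-Analysis.Analysis"
    "HOL-Library.Function_Algebras"
    "HOL-Library.Infinite_Typeclass"
    "Jordan_Normal_Form.Schur_Decomposition"
begin

text \<open>
  Complex Hilbert spaces are realised as linear subspaces of a coordinate space
  \<open>'i \<Rightarrow> complex\<close> (pointwise operations from \<^theory>\<open>HOL-Library.Function_Algebras\<close>), with an
  arbitrary complete inner product. A Hamel basis embeds any complex vector space into such a
  coordinate space, so every Hilbert space is of this form for a suitable index type \<open>'i\<close>.
  Inner products are linear in the first argument.
\<close>

definition scaleC :: "complex \<Rightarrow> ('i \<Rightarrow> complex) \<Rightarrow> 'i \<Rightarrow> complex" where
  "scaleC c u = (\<lambda>i. c * u i)"

record 'i hspace =
  car :: "('i \<Rightarrow> complex) set"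
  ip :: "('i \<Rightarrow> complex) \<Rightarrow> ('i \<Rightarrow> complex) \<Rightarrow> complex"

definition hnorm :: "'i hspace \<Rightarrow> ('i \<Rightarrow> complex) \<Rightarrow> real" where
  "hnorm H u = sqrt (Re (ip H u u))"

definition inner_product_space :: "'i hspace \<Rightarrow> bool" where
  "inner_product_space H \<longleftrightarrow>
     0 \<in> car H \<and>
     (\<forall>u\<in>car H. \<forall>v\<in>car H. u + v \<in> car H) \<and>
     (\<forall>c. \<forall>u\<in>car H. scaleC c u \<in> car H) \<and>
     (\<forall>u\<in>car H. \<forall>v\<in>car H. \<forall>w\<in>car H. ip H (u + v) w = ip H u w + ip H v w) \<and>
     (\<forall>c. \<forall>u\<in>car H. \<forall>w\<in>car H. ip H (scaleC c u) w = c * ip H u w) \<and>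
     (\<forall>u\<in>car H. \<forall>v\<in>car H. ip H v u = cnj (ip H u v)) \<and>
     (\<forall>u\<in>car H. 0 \<le> Re (ip H u u)) \<and>
     (\<forall>u\<in>car H. ip H u u = 0 \<longrightarrow> u = 0)"

definition hilbert_space :: "'i hspace \<Rightarrow> bool" where
  "hilbert_space H \<longleftrightarrow>
     inner_product_space H \<and>
     (\<forall>X :: nat \<Rightarrow> 'i \<Rightarrow> complex.
        (\<forall>n. X n \<in> car H) \<and>
        (\<forall>e>0. \<exists>M. \<forall>m\<ge>M. \<forall>n\<ge>M. hnorm H (X m - X n) < e) \<longrightarrow>
        (\<exists>l\<in>car H. (\<lambda>n. hnorm H (X n - l)) \<longlonglongrightarrow> 0))"

type_synonym ('i, 'j) hmap = "('i \<Rightarrow> complex) \<Rightarrow> 'j \<Rightarrow> complex"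
type_synonym 'i hop = "('i, 'i) hmap"

text \<open>Operators vanish outside the carrier, so that equal operators are equal functions.\<close>

definition bounded_ops :: "'i hspace \<Rightarrow> 'j hspace \<Rightarrow> ('i, 'j) hmap set" where
  "bounded_ops H1 H2 = {T.
     (\<forall>u. u \<notin> car H1 \<longrightarrow> T u = 0) \<and>
     (\<forall>u\<in>car H1. T u \<in> car H2) \<and>
     (\<forall>u\<in>car H1. \<forall>v\<in>car H1. T (u + v) = T u + T v) \<and>
     (\<forall>c. \<forall>u\<in>car H1. T (scaleC c u) = scaleC c (T u)) \<and>
     (\<exists>b. \<forall>u\<in>car H1. hnorm H2 (T u) \<le> b * hnorm H1 u)}"

definition id_op :: "'i hspace \<Rightarrow> 'i hop" where
  "id_op H = (\<lambda>u. if u \<in> car H then u else 0)"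

definition scale_op :: "complex \<Rightarrow> ('i, 'j) hmap \<Rightarrow> ('i, 'j) hmap" where
  "scale_op c T = (\<lambda>u. scaleC c (T u))"

definition op_norm :: "'i hspace \<Rightarrow> 'i hop \<Rightarrow> real" where
  "op_norm H T = (SUP u\<in>{u \<in> car H. hnorm H u \<le> 1}. hnorm H (T u))"

definition is_adjoint ::
    "'i hspace \<Rightarrow> 'j hspace \<Rightarrow> ('i, 'j) hmap \<Rightarrow> ('j, 'i) hmap \<Rightarrow> bool" where
  "is_adjoint H1 H2 T S \<longleftrightarrow>
     S \<in> bounded_ops H2 H1 \<and>
     (\<forall>u\<in>car H1. \<forall>v\<in>car H2. ip H2 (T u) v = ip H1 u (S v))"

definition isometry_op :: "'i hspace \<Rightarrow> 'j hspace \<Rightarrow> ('i, 'j) hmap \<Rightarrow> bool" where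
  "isometry_op H1 H2 V \<longleftrightarrow>
     V \<in> bounded_ops H1 H2 \<and> (\<forall>u\<in>car H1. hnorm H2 (V u) = hnorm H1 u)"

definition cstar_subalgebra :: "'i hspace \<Rightarrow> 'i hop set \<Rightarrow> bool" where
  "cstar_subalgebra H B \<longleftrightarrow>
     B \<subseteq> bounded_ops H H \<and>
     id_op H \<in> B \<and>
     (\<forall>S\<in>B. \<forall>T\<in>B. S + T \<in> B) \<and>
     (\<forall>c. \<forall>T\<in>B. scale_op c T \<in> B) \<and>
     (\<forall>S\<in>B. \<forall>T\<in>B. S \<circ> T \<in> B) \<and>
     (\<forall>T\<in>B. \<forall>S. is_adjoint H H T S \<longrightarrow> S \<in> B) \<and>
     (\<forall>X :: nat \<Rightarrow> 'i hop. \<forall>T\<in>bounded_ops H H.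
        (\<forall>n. X n \<in> B) \<and> (\<lambda>n. op_norm H (X n - T)) \<longlonglongrightarrow> 0 \<longrightarrow> T \<in> B)"

definition cstar_gen :: "'i hspace \<Rightarrow> ('d \<Rightarrow> 'i hop) \<Rightarrow> 'i hop set" where
  "cstar_gen H A = \<Inter>{B. cstar_subalgebra H B \<and> range A \<subseteq> B}"

definition linear_functional_on :: "'i hop set \<Rightarrow> ('i hop \<Rightarrow> complex) \<Rightarrow> bool" where
  "linear_functional_on B \<phi> \<longleftrightarrow>
     (\<forall>S\<in>B. \<forall>T\<in>B. \<phi> (S + T) = \<phi> S + \<phi> T) \<and>
     (\<forall>c. \<forall>T\<in>B. \<phi> (scale_op c T) = c * \<phi> T)"

text \<open>In the positivity condition, \<open>\<le>\<close> on \<^typ>\<open>complex\<close> is the order of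
  \<^theory>\<open>HOL-Library.Complex_Order\<close>: the value is real and nonnegative.\<close>

definition state_on :: "'i hspace \<Rightarrow> 'i hop set \<Rightarrow> ('i hop \<Rightarrow> complex) \<Rightarrow> bool" where
  "state_on H B \<phi> \<longleftrightarrow>
     linear_functional_on B \<phi> \<and>
     (\<forall>T\<in>B. \<forall>S. is_adjoint H H T S \<longrightarrow> 0 \<le> \<phi> (S \<circ> T)) \<and>
     \<phi> (id_op H) = 1"

definition character_on :: "'i hspace \<Rightarrow> 'i hop set \<Rightarrow> ('i hop \<Rightarrow> complex) \<Rightarrow> bool" where
  "character_on H B h \<longleftrightarrow>
     linear_functional_on B h \<and>
     (\<forall>S\<in>B. \<forall>T\<in>B. h (S \<circ> T) = h S * h T) \<and>
     h (id_op H) = 1"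

definition W1 :: "'i hspace \<Rightarrow> ('d::finite \<Rightarrow> 'i hop) \<Rightarrow> (complex^'d) set" where
  "W1 H A = {(\<chi> j. \<phi> (A j)) | \<phi>. state_on H (cstar_gen H A) \<phi>}"

definition normal_op :: "'i hspace \<Rightarrow> 'i hop \<Rightarrow> bool" where
  "normal_op H T \<longleftrightarrow>
     T \<in> bounded_ops H H \<and> (\<exists>S. is_adjoint H H T S \<and> S \<circ> T = T \<circ> S)"

definition normal_tuple :: "'i hspace \<Rightarrow> ('d \<Rightarrow> 'i hop) \<Rightarrow> bool" where
  "normal_tuple H N \<longleftrightarrow> (\<forall>j. normal_op H (N j)) \<and> (\<forall>j k. N j \<circ> N k = N k \<circ> N j)"

text \<open>The joint spectrum of a normal tuple: the image of the Gelfand spectrum of the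
  (commutative) unital C*-algebra it generates.\<close>

definition joint_spectrum :: "'i hspace \<Rightarrow> ('d::finite \<Rightarrow> 'i hop) \<Rightarrow> (complex^'d) set" where
  "joint_spectrum H N = {(\<chi> j. h (N j)) | h. character_on H (cstar_gen H N) h}"

definition dilates ::
    "'i hspace \<Rightarrow> ('d \<Rightarrow> 'i hop) \<Rightarrow> 'j hspace \<Rightarrow> ('d \<Rightarrow> 'j hop) \<Rightarrow> bool" where
  "dilates H1 X H2 N \<longleftrightarrow>
     (\<exists>V W. isometry_op H1 H2 V \<and> is_adjoint H1 H2 V W \<and> (\<forall>j. X j = W \<circ> N j \<circ> V))"

definition cspace :: "nat \<Rightarrow> nat hspace" where
  "cspace n = \<lparr>car = {u. \<forall>i\<ge>n. u i = 0}, ip = (\<lambda>u v. \<Sum>i<n. u i * cnj (v i))\<rparr>"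

definition mat_op :: "complex mat \<Rightarrow> nat hop" where
  "mat_op A = (\<lambda>u. if u \<in> car (cspace (dim_col A))
     then (\<lambda>i. if i < dim_row A then (\<Sum>j<dim_col A. A $$ (i, j) * u j) else 0)
     else 0)"

definition sa_tuples :: "nat \<Rightarrow> ('d \<Rightarrow> complex mat) set" where
  "sa_tuples n = {X. \<forall>j. X j \<in> carrier_mat n n \<and> mat_adjoint (X j) = X j}"

definition complexify :: "(real^'d) set \<Rightarrow> (complex^'d::finite) set" where
  "complexify K = (\<lambda>k. \<chi> j. complex_of_real (vec_nth k j)) ` K"

definition Wmax_level :: "nat \<Rightarrow> (real^'d) set \<Rightarrow> ('d::finite \<Rightarrow> complex mat) set" where
  "Wmax_level n K =
     {X \<in> sa_tuples n. W1 (cspace n) (\<lambda>j. mat_op (X j)) \<subseteq> complexify K}"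

text \<open>HOL cannot quantify existentially over types, so the index type \<open>'i\<close> in which the dilating
  Hilbert spaces live is a parameter; it may be any infinite type, and for
  suitable \<open>'i\<close> every Hilbert space occurs up to isomorphism.\<close>

definition Wmin_level ::
    "'i::infinite itself \<Rightarrow> nat \<Rightarrow> (real^'d) set \<Rightarrow> ('d::finite \<Rightarrow> complex mat) set" where
  "Wmin_level TYPE('i) n K =
     {X \<in> sa_tuples n. \<exists>(H :: 'i hspace) N. hilbert_space H \<and> normal_tuple H N \<and>
        dilates (cspace n) (\<lambda>j. mat_op (X j)) H N \<and> joint_spectrum H N \<subseteq> complexify K}"

text \<open>Matrices carry their dimensions, so the levels are disjoint and inclusion between the
  following unions is levelwise inclusion.\<close>

definition Wmax :: "(real^'d) set \<Rightarrow> ('d::finite \<Rightarrow> complex mat) set" where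
  "Wmax K = (\<Union>n\<in>{1..}. Wmax_level n K)"

definition Wmin ::
    "'i::infinite itself \<Rightarrow> (real^'d) set \<Rightarrow> ('d::finite \<Rightarrow> complex mat) set" where
  "Wmin TYPE('i) K = (\<Union>n\<in>{1..}. Wmin_level TYPE('i) n K)"

definition kron :: "complex mat \<Rightarrow> complex mat \<Rightarrow> complex mat" where
  "kron A B = mat (dim_row A * dim_row B) (dim_col A * dim_col B)
     (\<lambda>(i, j). A $$ (i div dim_row B, j div dim_col B) * B $$ (i mod dim_row B, j mod dim_col B))"

text \<open>\<open>Fmat d j\<close> is meaningful for \<open>1 \<le> j \<le> d\<close> only.\<close>

fun Fmat :: "nat \<Rightarrow> nat \<Rightarrow> complex mat" where
  "Fmat 0 j = 1\<^sub>m 1"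
| "Fmat (Suc 0) j = 1\<^sub>m 1"
| "Fmat (Suc (Suc m)) j =
     (if j \<le> Suc m then kron (mat_of_rows_list 2 [[0, 1], [1, 0]]) (Fmat (Suc m) j)
      else kron (mat_of_rows_list 2 [[1, 0], [0, -1]]) (1\<^sub>m (2 ^ m)))"

definition shifted_tuple ::
    "nat \<Rightarrow> real^'d \<Rightarrow> real \<Rightarrow> ('d \<Rightarrow> complex mat) \<Rightarrow> ('d::finite \<Rightarrow> complex mat)" where
  "shifted_tuple n x C A =
     (\<lambda>j. complex_of_real (vec_nth x j) \<cdot>\<^sub>m 1\<^sub>m n + complex_of_real C \<cdot>\<^sub>m A j)"

definition shifted_ball :: "real^'d \<Rightarrow> real \<Rightarrow> (real^'d::finite) set" where
  "shifted_ball x C = (\<lambda>v. x + C *\<^sub>R v) ` cball 0 1"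

end

theory Submission
  imports Defs
begin

text \<open>For (3) to (4), a normal dilation \<open>N\<close> with joint spectrum in the ball of radius \<open>C2\<close> about \<open>y\<close>
  satisfies \<open>(\<Sum>j. (N j - y j)\<^sup>2) \<le> C2\<^sup>2\<close>. As the matrices \<open>F j\<close> are symmetric, anticommute and square
  to \<open>1\<close>, the left-hand side is the square of \<open>\<Sum>j. F j \<otimes> (N j - y j)\<close>, so every tuple \<open>X\<close> dilated by \<open>N\<close>
  has \<open>(\<Sum>j. F j \<otimes> (X j - y j)) \<le> C2\<close>. For \<open>X = x + C1 F\<close> this operator acts on matrices by
  \<open>M \<mapsto> v M + C1 (\<Sum>j. F j M F j)\<close> with \<open>v = (\<Sum>j. (x j - y j) F j)\<close>. It preserves the span of \<open>1\<close> and
  \<open>v\<close>, and its larger eigenvalue there is the right-hand side of (4).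

  The operator inequality avoids the spectral theorem: commuting self-adjoint operators have
  joint approximate eigenvectors, and the limits of the vector states along them are characters of the
  generated algebra, hence give points of the joint spectrum.

  For (4) to (5), one takes a regular base tangent to the inner ball and an apex on the outer sphere.
  For (5) to (1), the barycentric coordinates of the simplex are affine functions which are nonnegative
  on the ball. Evaluated at \<open>X\<close> they are positive semidefinite matrices \<open>P k\<close> with sum \<open>1\<close> and
  \<open>X = (\<Sum>k. c k P k)\<close> for the vertices \<open>c k\<close>. Factoring the \<open>P k\<close> yields an isometry which
  dilates \<open>X\<close> to diagonal operators with joint eigenvalues \<open>c k\<close>.\<close>

section \<open>Operators on inner product spaces\<close>

text \<open>Approximate eigenvectors do not form a subspace, so the next operator cannot be
  restricted to the eigenspace of the previous ones. A seminorm \<open>g\<close> takes the place of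
  the subspace: a vector lies almost in it if \<open>g u\<close> is small compared with its norm,
  and invariance under \<open>T\<close> becomes \<open>g (T u) \<le> c * g u\<close>. Adding the
  defect of an operator to \<open>g\<close> cuts out a smaller approximate subspace, and the
  operators commuting with it still leave that one invariant. No subsequence or generalised limit is
  chosen for the characters: the operators having an asymptotic eigenvalue along a fixed sequence of
  unit vectors already form a C*-algebra. Between (2) and (3) stands the fact that
  \<open>x + C1 F\<close> lies in the maximal set. A real combination of the \<open>F j\<close> with
  coefficient vector \<open>a\<close> squares to the scalar \<open>(norm a)\<^sup>2\<close>, so
  positivity of a state on squares confines its values to the ball. The constant in (4) comes from
  \<open>(\<Sum>j. F j * v * F j) = (2 - d) v\<close>: on the basis \<open>1\<close>,
  \<open>v\<close> the map has trace \<open>2 C1\<close> and determinant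
  \<open>C1\<^sup>2 d (2 - d) - (norm v)\<^sup>2\<close>.\<close>

lemma scaleC_one [simp]: "scaleC 1 u = u"
  by (simp add: scaleC_def)

lemma scaleC_zero [simp]: "scaleC 0 u = 0"
  by (simp add: scaleC_def zero_fun_def)

lemma scaleC_zero_right [simp]: "scaleC c 0 = 0"
  by (simp add: scaleC_def zero_fun_def)

lemma scaleC_scaleC [simp]: "scaleC c (scaleC d u) = scaleC (c * d) u"
  by (simp add: scaleC_def mult.assoc)

lemma scaleC_add: "scaleC c (u + v) = scaleC c u + scaleC c v"
  by (simp add: scaleC_def fun_eq_iff algebra_simps)

lemma scaleC_diff: "scaleC c (u - v) = scaleC c u - scaleC c v"
  by (simp add: scaleC_def fun_eq_iff algebra_simps)

lemma scaleC_add_left: "scaleC (c + d) u = scaleC c u + scaleC d u"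
  by (simp add: scaleC_def fun_eq_iff algebra_simps)

lemma scaleC_diff_left: "scaleC (c - d) u = scaleC c u - scaleC d u"
  by (simp add: scaleC_def fun_eq_iff algebra_simps)

lemma sum_apply: "(\<Sum>a\<in>A. f a) i = (\<Sum>a\<in>A. f a i)"
  by (induction A rule: infinite_finite_induct) simp_all

lemma diff_scaleC: "u - v = u + scaleC (- 1) v"
  by (simp add: scaleC_def fun_eq_iff)

locale ips =
  fixes H :: "'i hspace"
  assumes inner_product_space: "inner_product_space H"
begin

lemma car_zero [simp]: "0 \<in> car H"
  and car_add [simp]: "u \<in> car H \<Longrightarrow> v \<in> car H \<Longrightarrow> u + v \<in> car H"
  and car_scaleC [simp]: "u \<in> car H \<Longrightarrow> scaleC c u \<in> car H"
  and ip_add_left: "u \<in> car H \<Longrightarrow> v \<in> car H \<Longrightarrow> w \<in> car H \<Longrightarrow> ip H (u + v) w = ip H u w + ip H v w"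
  and ip_scaleC_left: "u \<in> car H \<Longrightarrow> w \<in> car H \<Longrightarrow> ip H (scaleC c u) w = c * ip H u w"
  and ip_cnj: "u \<in> car H \<Longrightarrow> v \<in> car H \<Longrightarrow> ip H v u = cnj (ip H u v)"
  and ip_pos: "u \<in> car H \<Longrightarrow> 0 \<le> Re (ip H u u)"
  and ip_eq_zero: "u \<in> car H \<Longrightarrow> ip H u u = 0 \<Longrightarrow> u = 0"
  using inner_product_space unfolding inner_product_space_def by - (elim conjE, blast)+

lemma car_diff [simp]: "u \<in> car H \<Longrightarrow> v \<in> car H \<Longrightarrow> u - v \<in> car H"
  by (simp add: diff_scaleC)

lemma car_sum [simp]: "(\<And>a. a \<in> A \<Longrightarrow> f a \<in> car H) \<Longrightarrow> (\<Sum>a\<in>A. f a) \<in> car H"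
  by (induction A rule: infinite_finite_induct) simp_all

lemma ip_diff_left: "u \<in> car H \<Longrightarrow> v \<in> car H \<Longrightarrow> w \<in> car H \<Longrightarrow> ip H (u - v) w = ip H u w - ip H v w"
  by (simp add: diff_scaleC ip_add_left ip_scaleC_left)

lemma ip_add_right: "u \<in> car H \<Longrightarrow> v \<in> car H \<Longrightarrow> w \<in> car H \<Longrightarrow> ip H w (u + v) = ip H w u + ip H w v"
  by (metis car_add complex_cnj_add ip_add_left ip_cnj)

lemma ip_scaleC_right: "u \<in> car H \<Longrightarrow> w \<in> car H \<Longrightarrow> ip H w (scaleC c u) = cnj c * ip H w u"
  by (metis car_scaleC complex_cnj_mult ip_scaleC_left ip_cnj)

lemma ip_diff_right: "u \<in> car H \<Longrightarrow> v \<in> car H \<Longrightarrow> w \<in> car H \<Longrightarrow> ip H w (u - v) = ip H w u - ip H w v"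
  by (simp add: diff_scaleC ip_add_right ip_scaleC_right)

lemma ip_zero_left [simp]: "w \<in> car H \<Longrightarrow> ip H 0 w = 0"
  using ip_scaleC_left[of 0 w 0] by simp

lemma ip_zero_right [simp]: "w \<in> car H \<Longrightarrow> ip H w 0 = 0"
  using ip_scaleC_right[of 0 w 0] by simp

lemma ip_sum_left:
  "(\<And>a. a \<in> A \<Longrightarrow> f a \<in> car H) \<Longrightarrow> w \<in> car H \<Longrightarrow> ip H (\<Sum>a\<in>A. f a) w = (\<Sum>a\<in>A. ip H (f a) w)"
  by (induction A rule: infinite_finite_induct) (simp_all add: ip_add_left)

lemma ip_sum_right:
  "(\<And>a. a \<in> A \<Longrightarrow> f a \<in> car H) \<Longrightarrow> w \<in> car H \<Longrightarrow> ip H w (\<Sum>a\<in>A. f a) = (\<Sum>a\<in>A. ip H w (f a))"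
  by (induction A rule: infinite_finite_induct) (simp_all add: ip_add_right)

lemma hnorm_sq: "u \<in> car H \<Longrightarrow> (hnorm H u)\<^sup>2 = Re (ip H u u)"
  by (simp add: hnorm_def ip_pos)

lemma ip_self: "u \<in> car H \<Longrightarrow> ip H u u = complex_of_real ((hnorm H u)\<^sup>2)"
  using ip_cnj[of u u] by (simp add: complex_eq_iff hnorm_sq)

lemma hnorm_nonneg [simp]: "0 \<le> hnorm H u" if "u \<in> car H"
  using that by (simp add: hnorm_def ip_pos)

lemma hnorm_zero [simp]: "hnorm H 0 = 0"
  by (simp add: hnorm_def)

lemma hnorm_eq_zero: "u \<in> car H \<Longrightarrow> hnorm H u = 0 \<longleftrightarrow> u = 0"
  using ip_self[of u] ip_eq_zero[of u] by auto

lemma hnorm_scaleC: "u \<in> car H \<Longrightarrow> hnorm H (scaleC c u) = cmod c * hnorm H u"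
proof -
  assume u: "u \<in> car H"
  have "ip H (scaleC c u) (scaleC c u) = complex_of_real ((cmod c * hnorm H u)\<^sup>2)"
    using u complex_norm_square[of c]
    by (simp add: ip_scaleC_left ip_scaleC_right ip_self[OF u] power_mult_distrib)
  then show ?thesis using u by (simp add: hnorm_def[of H "scaleC c u"])
qed

lemma cauchy_schwarz:
  assumes u: "u \<in> car H" and v: "v \<in> car H"
  shows "cmod (ip H u v) \<le> hnorm H u * hnorm H v"
proof (cases "v = 0")
  case False
  define a where "a = (hnorm H v)\<^sup>2"
  define c where "c = ip H u v"
  have a: "a > 0" using False v hnorm_eq_zero[of v] by (simp add: a_def)
  \<comment> \<open>The component of \<open>u\<close> orthogonal to \<open>v\<close>, multiplied by
    \<open>(hnorm H v)\<^sup>2\<close> so that nothing has to be divided.\<close>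
  let ?w = "scaleC (of_real a) u - scaleC c v"
  have "ip H ?w ?w = of_real a * of_real a * ip H u u - of_real a * cnj c * ip H u v
      - c * of_real a * ip H v u + c * cnj c * ip H v v"
    using u v by (simp add: ip_diff_left ip_diff_right ip_scaleC_left ip_scaleC_right algebra_simps)
  also have "\<dots> = of_real (a * (a * (hnorm H u)\<^sup>2 - (cmod c)\<^sup>2))"
    using u v ip_cnj[of u v]
    by (simp add: ip_self[OF u] ip_self[OF v] flip: a_def c_def)
       (use complex_norm_square[of c] in \<open>simp add: algebra_simps power2_eq_square\<close>)
  finally have "0 \<le> a * (a * (hnorm H u)\<^sup>2 - (cmod c)\<^sup>2)"
    using ip_pos[of ?w] u v by simp
  then have "(cmod c)\<^sup>2 \<le> (hnorm H u * hnorm H v)\<^sup>2"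
    using a by (simp add: zero_le_mult_iff a_def power_mult_distrib mult_ac)
  then show ?thesis
    unfolding c_def using u v by (meson hnorm_nonneg mult_nonneg_nonneg power2_le_imp_le)
qed (use u in simp)

lemma hnorm_triangle:
  assumes u: "u \<in> car H" and v: "v \<in> car H"
  shows "hnorm H (u + v) \<le> hnorm H u + hnorm H v"
proof -
  have "(hnorm H (u + v))\<^sup>2 = (hnorm H u)\<^sup>2 + (hnorm H v)\<^sup>2 + 2 * Re (ip H u v)"
    using u v ip_cnj[of u v] by (simp add: hnorm_sq ip_add_left ip_add_right)
  also have "Re (ip H u v) \<le> hnorm H u * hnorm H v"
    using cauchy_schwarz[OF u v] complex_Re_le_cmod[of "ip H u v"] by linarith
  finally have "(hnorm H (u + v))\<^sup>2 \<le> (hnorm H u + hnorm H v)\<^sup>2"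
    by (simp add: power2_sum)
  then show ?thesis using u v by (meson add_nonneg_nonneg hnorm_nonneg power2_le_imp_le)
qed

lemma hnorm_triangle_diff:
  "u \<in> car H \<Longrightarrow> v \<in> car H \<Longrightarrow> hnorm H (u - v) \<le> hnorm H u + hnorm H v"
  using hnorm_triangle[of u "scaleC (-1) v"] by (simp add: diff_scaleC hnorm_scaleC)

text \<open>Testing with \<open>v = u\<close> suffices. This turns the weak estimate in
  \<open>near_eig\<close> into a norm estimate for the adjoint.\<close>

lemma hnorm_le_if_ip_le:
  assumes "u \<in> car H" "0 \<le> b" "\<And>v. v \<in> car H \<Longrightarrow> cmod (ip H v u) \<le> b * hnorm H v"
  shows "hnorm H u \<le> b"
proof (cases "hnorm H u = 0")
  case False
  then have "hnorm H u > 0" using assms(1) hnorm_nonneg[of u] by linarith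
  moreover have "hnorm H u * hnorm H u \<le> b * hnorm H u"
    using assms(3)[OF assms(1)] assms(1)
    by (simp add: ip_self power2_eq_square norm_mult)
  ultimately show ?thesis by simp
qed (use assms in simp)

lemma ip_ext:
  assumes "u \<in> car H" "v \<in> car H" "\<And>w. w \<in> car H \<Longrightarrow> ip H u w = ip H v w"
  shows "u = v"
proof -
  have "ip H (u - v) (u - v) = 0" using assms by (simp add: ip_diff_left)
  then show ?thesis using ip_eq_zero[of "u - v"] assms by simp
qed

section \<open>Bounded operators on a fixed space and their adjoints\<close>

lemma op_car: "T \<in> bounded_ops H H \<Longrightarrow> u \<in> car H \<Longrightarrow> T u \<in> car H"
  and op_outside: "T \<in> bounded_ops H H \<Longrightarrow> u \<notin> car H \<Longrightarrow> T u = 0"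
  and op_add: "T \<in> bounded_ops H H \<Longrightarrow> u \<in> car H \<Longrightarrow> v \<in> car H \<Longrightarrow> T (u + v) = T u + T v"
  and op_scaleC: "T \<in> bounded_ops H H \<Longrightarrow> u \<in> car H \<Longrightarrow> T (scaleC c u) = scaleC c (T u)"
  unfolding bounded_ops_def by blast+

lemma op_diff: "T \<in> bounded_ops H H \<Longrightarrow> u \<in> car H \<Longrightarrow> v \<in> car H \<Longrightarrow> T (u - v) = T u - T v"
  unfolding diff_scaleC by (simp only: op_add op_scaleC car_scaleC)

lemma op_zero: "T \<in> bounded_ops H H \<Longrightarrow> T 0 = 0"
  using op_scaleC[of T 0 0] by (simp only: scaleC_zero car_zero simp_thms)

lemma op_bound:
  assumes "T \<in> bounded_ops H H"
  obtains b where "b \<ge> 0" "\<And>u. u \<in> car H \<Longrightarrow> hnorm H (T u) \<le> b * hnorm H u"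
proof -
  obtain b where b: "\<And>u. u \<in> car H \<Longrightarrow> hnorm H (T u) \<le> b * hnorm H u"
    using assms unfolding bounded_ops_def by blast
  have "hnorm H (T u) \<le> max b 0 * hnorm H u" if "u \<in> car H" for u
    using b[OF that] mult_right_mono[of b "max b 0" "hnorm H u"] that by simp
  then show thesis using that[of "max b 0"] by simp
qed

lemma op_eqI:
  assumes "T \<in> bounded_ops H H" "S \<in> bounded_ops H H" "\<And>u. u \<in> car H \<Longrightarrow> T u = S u"
  shows "T = S"
proof
  fix u show "T u = S u" using assms op_outside by metis
qed

lemma bopI:
  assumes "\<And>u. u \<notin> car H \<Longrightarrow> T u = 0" "\<And>u. u \<in> car H \<Longrightarrow> T u \<in> car H"
    "\<And>u v. u \<in> car H \<Longrightarrow> v \<in> car H \<Longrightarrow> T (u + v) = T u + T v"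
    "\<And>c u. u \<in> car H \<Longrightarrow> T (scaleC c u) = scaleC c (T u)"
    "\<And>u. u \<in> car H \<Longrightarrow> hnorm H (T u) \<le> b * hnorm H u"
  shows "T \<in> bounded_ops H H"
  using assms unfolding bounded_ops_def by blast

lemma bop_id [simp]: "id_op H \<in> bounded_ops H H"
  by (rule bopI[where b = 1]) (simp_all add: id_op_def)

lemma bop_add [simp]:
  assumes T: "T \<in> bounded_ops H H" and S: "S \<in> bounded_ops H H"
  shows "T + S \<in> bounded_ops H H"
proof -
  obtain a where a: "\<And>u. u \<in> car H \<Longrightarrow> hnorm H (T u) \<le> a * hnorm H u"
    using op_bound[OF T] by metis
  obtain b where b: "\<And>u. u \<in> car H \<Longrightarrow> hnorm H (S u) \<le> b * hnorm H u"
    using op_bound[OF S] by metis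
  have "hnorm H (T u + S u) \<le> (a + b) * hnorm H u" if u: "u \<in> car H" for u
    using hnorm_triangle[OF op_car[OF T u] op_car[OF S u]] a[OF u] b[OF u]
    by (simp add: distrib_right)
  then show ?thesis
    by (intro bopI[where b = "a + b"])
       (simp_all add: op_outside[OF T] op_outside[OF S] op_car[OF T] op_car[OF S] op_add[OF T]
         op_add[OF S] op_scaleC[OF T] op_scaleC[OF S] scaleC_add add_ac)
qed

lemma bop_scale [simp]:
  assumes T: "T \<in> bounded_ops H H"
  shows "scale_op c T \<in> bounded_ops H H"
proof -
  obtain a where a: "\<And>u. u \<in> car H \<Longrightarrow> hnorm H (T u) \<le> a * hnorm H u"
    using op_bound[OF T] by metis
  have "hnorm H (scaleC c (T u)) \<le> (cmod c * a) * hnorm H u" if u: "u \<in> car H" for u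
    using a[OF u] hnorm_scaleC[OF op_car[OF T u]] by (simp add: mult.assoc mult_left_mono)
  then show ?thesis
    unfolding scale_op_def
    by (intro bopI[where b = "cmod c * a"])
       (simp_all add: op_outside[OF T] op_car[OF T] op_add[OF T] op_scaleC[OF T] scaleC_add mult_ac)
qed

lemma bop_zero [simp]: "0 \<in> bounded_ops H H"
  by (rule bopI[where b = 0]) simp_all

lemma bop_sum [simp]:
  "(\<And>a. a \<in> A \<Longrightarrow> f a \<in> bounded_ops H H) \<Longrightarrow> (\<Sum>a\<in>A. f a) \<in> bounded_ops H H"
  by (induction A rule: infinite_finite_induct) simp_all

lemma bop_comp [simp]:
  assumes T: "T \<in> bounded_ops H H" and S: "S \<in> bounded_ops H H"
  shows "T \<circ> S \<in> bounded_ops H H"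
proof -
  obtain a where a0: "a \<ge> 0" and a: "\<And>u. u \<in> car H \<Longrightarrow> hnorm H (T u) \<le> a * hnorm H u"
    using op_bound[OF T] by metis
  obtain b where b: "\<And>u. u \<in> car H \<Longrightarrow> hnorm H (S u) \<le> b * hnorm H u"
    using op_bound[OF S] by metis
  have "hnorm H (T (S u)) \<le> (a * b) * hnorm H u" if u: "u \<in> car H" for u
    using a[OF op_car[OF S u]] mult_left_mono[OF b[OF u] a0] by (simp add: mult.assoc)
  then show ?thesis
    by (intro bopI[where b = "a * b"])
       (simp_all add: op_outside[OF S] op_zero[OF T] op_car[OF T] op_car[OF S] op_add[OF T]
         op_add[OF S] op_scaleC[OF T] op_scaleC[OF S])
qed

lemma adjoint_bop: "is_adjoint H H T S \<Longrightarrow> S \<in> bounded_ops H H"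
  by (simp add: is_adjoint_def)

lemma adjoint_ip: "is_adjoint H H T S \<Longrightarrow> u \<in> car H \<Longrightarrow> v \<in> car H \<Longrightarrow> ip H (T u) v = ip H u (S v)"
  by (simp add: is_adjoint_def)

lemma adjoint_ip2:
  assumes "is_adjoint H H T S" "T \<in> bounded_ops H H" "u \<in> car H" "v \<in> car H"
  shows "ip H (S u) v = ip H u (T v)"
  using assms by (metis adjoint_bop adjoint_ip ip_cnj op_car)

section \<open>Joint approximate eigenvectors\<close>

text \<open>Stands for a closed subspace known only approximately, namely the vectors on which
  \<open>g\<close> is small relative to the norm. With this reading \<open>approx_null\<close> says
  that the subspace is not zero.\<close>

definition seminorm_on :: "(('i \<Rightarrow> complex) \<Rightarrow> real) \<Rightarrow> bool" where
  "seminorm_on g \<longleftrightarrow> (\<forall>u\<in>car H. 0 \<le> g u) \<and> (\<forall>c. \<forall>u\<in>car H. g (scaleC c u) = cmod c * g u) \<and>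
     (\<forall>u\<in>car H. \<forall>v\<in>car H. g (u + v) \<le> g u + g v)"

definition approx_null :: "(('i \<Rightarrow> complex) \<Rightarrow> real) \<Rightarrow> bool" where
  "approx_null g \<longleftrightarrow> (\<forall>e>0. \<exists>u\<in>car H. hnorm H u = 1 \<and> g u < e)"

definition defect :: "'i hop \<Rightarrow> complex \<Rightarrow> ('i \<Rightarrow> complex) \<Rightarrow> real" where
  "defect T c u = hnorm H (T u - scaleC c u)"

lemma seminorm_onD:
  assumes "seminorm_on g" "u \<in> car H"
  shows "0 \<le> g u" "g (scaleC c u) = cmod c * g u" "v \<in> car H \<Longrightarrow> g (u + v) \<le> g u + g v"
  using assms by (auto simp: seminorm_on_def)

lemma seminorm_on_zero [simp]: "seminorm_on (\<lambda>u. 0)"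
  by (simp add: seminorm_on_def)

lemma seminorm_on_add:
  assumes "seminorm_on f" "seminorm_on g"
  shows "seminorm_on (\<lambda>u. f u + g u)"
  unfolding seminorm_on_def
proof (intro conjI ballI allI)
  fix u v c assume u: "u \<in> car H"
  note fu = seminorm_onD[OF assms(1) u] and gu = seminorm_onD[OF assms(2) u]
  show "0 \<le> f u + g u" "f (scaleC c u) + g (scaleC c u) = cmod c * (f u + g u)"
    using fu(1,2) gu(1,2) by (simp_all add: distrib_left)
  assume v: "v \<in> car H"
  show "f (u + v) + g (u + v) \<le> f u + g u + (f v + g v)"
    using fu(3)[OF v] gu(3)[OF v] by linarith
qed

lemma seminorm_on_defect:
  assumes T: "T \<in> bounded_ops H H"
  shows "seminorm_on (defect T c)"
  unfolding seminorm_on_def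
proof (intro conjI ballI allI)
  fix u v d assume u: "u \<in> car H"
  note [simp] = op_car[OF T]
  show "0 \<le> defect T c u" using u by (simp add: defect_def)
  have "T (scaleC d u) - scaleC c (scaleC d u) = scaleC d (T u - scaleC c u)"
    using u by (simp add: op_scaleC[OF T] scaleC_diff mult.commute)
  then show "defect T c (scaleC d u) = cmod d * defect T c u"
    using u by (simp add: defect_def hnorm_scaleC)
  assume v: "v \<in> car H"
  have "T (u + v) - scaleC c (u + v) = (T u - scaleC c u) + (T v - scaleC c v)"
    using u v by (simp add: op_add[OF T] scaleC_add)
  then show "defect T c (u + v) \<le> defect T c u + defect T c v"
    using u v by (simp only: defect_def) (simp add: hnorm_triangle)
qed

text \<open>The strict inequality forces \<open>w\<close> to be nonzero, so the witness need not be
  normalised.\<close>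

lemma approx_nullI:
  assumes g: "seminorm_on g" and *: "\<And>e. e > 0 \<Longrightarrow> \<exists>w\<in>car H. g w < e * hnorm H w"
  shows "approx_null g"
  unfolding approx_null_def
proof (intro allI impI)
  fix e :: real assume e: "e > 0"
  obtain w where w: "w \<in> car H" "g w < e * hnorm H w" using *[OF e] by blast
  have n: "hnorm H w > 0"
    using le_less_trans[OF seminorm_onD(1)[OF g w(1)] w(2)] e by (rule zero_less_mult_pos)
  define k where "k = complex_of_real (1 / hnorm H w)"
  have "cmod k = 1 / hnorm H w" using n by (simp add: norm_divide k_def)
  then have "hnorm H (scaleC k w) = 1" "g (scaleC k w) = g w / hnorm H w"
    using n w by (simp_all add: hnorm_scaleC seminorm_onD(2)[OF g])
  moreover have "g w / hnorm H w < e" using n w(2) by (simp add: divide_less_eq)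
  ultimately have "hnorm H (scaleC k w) = 1" "g (scaleC k w) < e" by simp_all
  then show "\<exists>u\<in>car H. hnorm H u = 1 \<and> g u < e"
    by (intro bexI[of _ "scaleC k w"] conjI car_scaleC w(1))
qed

lemma hnorm_diff_sq:
  assumes u: "u \<in> car H" and v: "v \<in> car H"
  shows "(hnorm H (u - scaleC (of_real r) v))\<^sup>2
    = (hnorm H u)\<^sup>2 - 2 * r * Re (ip H u v) + r\<^sup>2 * (hnorm H v)\<^sup>2"
proof -
  have "Re (ip H v u) = Re (ip H u v)" using ip_cnj[OF u v] by simp
  then show ?thesis
    using u v by (simp add: hnorm_sq ip_diff_left ip_diff_right ip_scaleC_left ip_scaleC_right)
      (simp add: algebra_simps power2_eq_square)
qed

text \<open>The left-hand side bounds \<open>\<parallel>T (T u) - m\<^sup>2 u\<parallel>\<^sup>2\<close> for a unit vector \<open>u\<close> with \<open>m - d \<le> \<parallel>T u\<parallel>\<close> and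
  \<open>\<parallel>T (T u)\<parallel> \<le> (m + d)\<^sup>2\<close>, \<open>T\<close> self-adjoint.\<close>

lemma quartic_bound:
  fixes m d :: real
  assumes "0 < d" "d \<le> m / 2"
  shows "(m + d) ^ 4 - 2 * m\<^sup>2 * (m - d)\<^sup>2 + m ^ 4 \<le> 19 * m ^ 3 * d"
proof -
  have m: "m > 0" using assms by simp
  have "(m + d) ^ 4 - 2 * m\<^sup>2 * (m - d)\<^sup>2 + m ^ 4
      = 8 * m ^ 3 * d + 4 * m\<^sup>2 * d * d + 4 * m * d * d * d + d * d * d * d"
    by (simp add: power2_eq_square power3_eq_cube power4_eq_xxxx algebra_simps)
  also have "\<dots> \<le> 8 * m ^ 3 * d + 4 * m\<^sup>2 * d * m + 4 * m * d * m * m + d * m * m * m"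
    using assms m by (intro add_mono mult_mono) auto
  also have "\<dots> = 17 * m ^ 3 * d" by (simp add: power2_eq_square power3_eq_cube)
  also have "\<dots> \<le> 19 * m ^ 3 * d" using assms m by simp
  finally show ?thesis .
qed

text \<open>\<open>\<bar>t\<bar>\<close> is the limit for \<open>e \<rightarrow> 0\<close> of the supremum of \<open>\<parallel>T u\<parallel>\<close> over the unit vectors with
  \<open>g u < e\<close>. The sign comes from \<open>T\<^sup>2 - t\<^sup>2 = (T + t) (T - t)\<close>.\<close>

lemma approx_null_selfadjoint:
  fixes T :: "'i hop"
  assumes T: "T \<in> bounded_ops H H"
    and sa: "\<And>u v. u \<in> car H \<Longrightarrow> v \<in> car H \<Longrightarrow> ip H (T u) v = ip H u (T v)"
    and g: "seminorm_on g" and c: "c \<ge> 0" "\<And>u. u \<in> car H \<Longrightarrow> g (T u) \<le> c * g u"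
    and r: "\<And>e. e > 0 \<Longrightarrow> \<exists>u\<in>car H. hnorm H u = 1 \<and> g u < e \<and> r \<le> hnorm H (T u)" "r \<ge> 0"
  obtains t :: real where "r \<le> \<bar>t\<bar>" "approx_null (\<lambda>u. g u + defect T (complex_of_real t) u)"
proof -
  note [simp] = op_car[OF T]
  \<comment> \<open>The bounds for \<open>T\<close> on some cone around the approximate subspace;
    the infimum \<open>m\<close> is the norm of \<open>T\<close> on that subspace. The homogeneous
    form allows the bound to be applied to \<open>T u\<close> as well.\<close>
  define A where "A = {s. \<exists>e>0. \<forall>w\<in>car H. g w < e * hnorm H w \<longrightarrow> hnorm H (T w) \<le> s * hnorm H w}"
  obtain b where b: "\<And>u. u \<in> car H \<Longrightarrow> hnorm H (T u) \<le> b * hnorm H u"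
    using op_bound[OF T] by metis
  have bA: "b \<in> A"
  proof -
    have 1: "\<forall>w\<in>car H. g w < 1 * hnorm H w \<longrightarrow> hnorm H (T w) \<le> b * hnorm H w"
      using b by (intro ballI impI)
    show ?thesis unfolding A_def mem_Collect_eq
      by (rule exI[of _ "1 :: real"], rule conjI[OF _ 1], simp)
  qed
  have rA: "r \<le> s" if s: "s \<in> A" for s
  proof -
    obtain e where "e > 0 \<and> (\<forall>w\<in>car H. g w < e * hnorm H w \<longrightarrow> hnorm H (T w) \<le> s * hnorm H w)"
      using s unfolding A_def mem_Collect_eq by (rule exE)
    then have e: "e > 0" "\<And>w. w \<in> car H \<Longrightarrow> g w < e * hnorm H w \<Longrightarrow> hnorm H (T w) \<le> s * hnorm H w"
      by simp_all
    obtain u where u: "u \<in> car H" "hnorm H u = 1" "g u < e" "r \<le> hnorm H (T u)"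
      using r(1)[OF e(1)] by blast
    then show ?thesis using e(2)[OF u(1)] by simp
  qed
  define m where "m = Inf A"
  have bdd: "bdd_below A" using rA by (auto simp: bdd_below_def)
  have rm: "r \<le> m" unfolding m_def using bA rA by (intro cInf_greatest) auto
  have up: "\<exists>e>0. \<forall>w\<in>car H. g w < e * hnorm H w \<longrightarrow> hnorm H (T w) \<le> (m + d) * hnorm H w"
    if d: "d > 0" for d
  proof -
    obtain s where s: "s \<in> A" "s < m + d"
      using cInf_lessD[of A "m + d"] bA d unfolding m_def by fastforce
    obtain e where "e > 0 \<and> (\<forall>w\<in>car H. g w < e * hnorm H w \<longrightarrow> hnorm H (T w) \<le> s * hnorm H w)"
      using s(1) unfolding A_def mem_Collect_eq by (rule exE)
    then have e: "e > 0" "\<And>w. w \<in> car H \<Longrightarrow> g w < e * hnorm H w \<Longrightarrow> hnorm H (T w) \<le> s * hnorm H w"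
      by simp_all
    have "s * hnorm H w \<le> (m + d) * hnorm H w" if "w \<in> car H" for w
      using s that by (intro mult_right_mono) auto
    then have "\<forall>w\<in>car H. g w < e * hnorm H w \<longrightarrow> hnorm H (T w) \<le> (m + d) * hnorm H w"
      using e(2) by (intro ballI impI) (rule order_trans)
    with e(1) show ?thesis by (intro exI[of _ e] conjI)
  qed
  have low: "\<exists>w\<in>car H. hnorm H w = 1 \<and> g w < e \<and> m - d < hnorm H (T w)" if d: "d > 0" and e: "e > 0" for d e
  proof -
    have "m - d \<notin> A" using cInf_lower[OF _ bdd, of "m - d"] d by (auto simp: m_def)
    then have "\<not> (\<forall>w\<in>car H. g w < e * hnorm H w \<longrightarrow> hnorm H (T w) \<le> (m - d) * hnorm H w)"
      unfolding A_def mem_Collect_eq by (rule contrapos_nn) (intro exI[of _ e] conjI e)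
    then obtain w where w: "w \<in> car H" "g w < e * hnorm H w" "(m - d) * hnorm H w < hnorm H (T w)"
      unfolding not_le[symmetric] by blast
    have n: "hnorm H w > 0"
      using le_less_trans[OF seminorm_onD(1)[OF g w(1)] w(2)] e by (rule zero_less_mult_pos)
    define k where "k = complex_of_real (1 / hnorm H w)"
    have k: "cmod k = 1 / hnorm H w" using n by (simp add: norm_divide k_def)
    have "hnorm H (scaleC k w) = 1" "g (scaleC k w) = g w / hnorm H w"
      "hnorm H (T (scaleC k w)) = hnorm H (T w) / hnorm H w"
      using n w(1) k by (simp_all add: hnorm_scaleC seminorm_onD(2)[OF g] op_scaleC[OF T])
    moreover have "g w / hnorm H w < e" "m - d < hnorm H (T w) / hnorm H w"
      using n w(2,3) by (simp_all add: divide_less_eq less_divide_eq)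
    ultimately have "hnorm H (scaleC k w) = 1" "g (scaleC k w) < e"
      "m - d < hnorm H (T (scaleC k w))" by simp_all
    then show ?thesis by (intro bexI[of _ "scaleC k w"] conjI car_scaleC w(1))
  qed
  show thesis
  proof (cases "m = 0")
    \<comment> \<open>Here \<open>T\<close> itself is small on the approximate subspace, so the
      eigenvalue is \<open>0\<close>. The other case divides by \<open>m\<close>.\<close>
    case True
    have "approx_null (\<lambda>u. g u + defect T (complex_of_real 0) u)"
    proof (rule approx_nullI)
      fix e :: real assume e: "e > 0"
      obtain e' where e': "e' > 0"
        "\<And>w. w \<in> car H \<Longrightarrow> g w < e' * hnorm H w \<Longrightarrow> hnorm H (T w) \<le> e / 2 * hnorm H w"
        using up[OF half_gt_zero[OF e]] unfolding True add_0 by (elim exE conjE) simp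
      have "min e' (e / 2) > 0" using e e'(1) by simp
      from r(1)[OF this] obtain u where u: "u \<in> car H" "hnorm H u = 1" "g u < min e' (e / 2)"
        by blast
      then have "g u + defect T (complex_of_real 0) u < e * hnorm H u"
        using e'(2)[OF u(1)] by (simp add: defect_def)
      then show "\<exists>w\<in>car H. g w + defect T (complex_of_real 0) w < e * hnorm H w"
        by (rule bexI[OF _ u(1)])
    qed (intro seminorm_on_add g seminorm_on_defect T)
    then show thesis using that[of 0] rm r(2) True by simp
  next
    case False
    then have m: "m > 0" using rm r(2) by simp
    \<comment> \<open>A vector that almost attains \<open>m\<close> is an approximate eigenvector of
      the square: when the norm is expanded, the cross term is \<open>hnorm H (T u)\<close> squared
      because \<open>T\<close> is self-adjoint.\<close>
    have sq: "\<exists>u\<in>car H. hnorm H u = 1 \<and> g u < e \<and> hnorm H (T (T u) - scaleC (of_real (m\<^sup>2)) u) < e"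
      if e: "e > 0" for e
    proof -
      \<comment> \<open>The bound \<open>m / 2\<close> keeps \<open>T u\<close> away from zero. The
        factor \<open>20\<close> exceeds the \<open>19\<close> of \<open>quartic_bound\<close> and
        so makes the final estimate strict.\<close>
      define d where "d = min (m / 2) (e\<^sup>2 / (20 * m ^ 3))"
      have d: "0 < d" "d \<le> m / 2" using m e by (auto simp: d_def)
      have "19 * m ^ 3 * d \<le> 19 * m ^ 3 * (e\<^sup>2 / (20 * m ^ 3))"
        using m by (intro mult_left_mono) (auto simp: d_def)
      also have "\<dots> < e\<^sup>2" using m e by (simp add: field_simps)
      finally have de: "19 * m ^ 3 * d < e\<^sup>2" .
      obtain e1 where e1: "e1 > 0"
        "\<And>w. w \<in> car H \<Longrightarrow> g w < e1 * hnorm H w \<Longrightarrow> hnorm H (T w) \<le> (m + d) * hnorm H w"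
        using up[OF d(1)] by (elim exE conjE) simp
      \<comment> \<open>The last bound puts \<open>T u\<close> into the cone where \<open>T\<close>
        is bounded by \<open>m + d\<close>, since \<open>g (T u) \<le> c * g u\<close> while
        \<open>T u\<close> has norm at least \<open>m / 2\<close>. Using \<open>c + 1\<close> avoids
        a division by zero.\<close>
      define e2 where "e2 = min e (min e1 (e1 * (m / 2) / (c + 1)))"
      have "e2 > 0" using e e1(1) m c(1) by (simp add: e2_def)
      from low[OF d(1) this]
      obtain u where u: "u \<in> car H" "hnorm H u = 1" "g u < e2" "m - d < hnorm H (T u)"
        by blast
      let ?p = "hnorm H (T u)" and ?q = "hnorm H (T (T u))"
      have p: "m / 2 \<le> ?p" "?p \<le> m + d"
        using u d e1(2)[OF u(1)] by (auto simp: e2_def)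
      have "g (T u) \<le> c * g u" by (rule c(2)[OF u(1)])
      also have "\<dots> \<le> (c + 1) * g u" using seminorm_onD(1)[OF g u(1)] by (simp add: distrib_right)
      also have "\<dots> < (c + 1) * (e1 * (m / 2) / (c + 1))"
        using u(3) c(1) by (intro mult_strict_left_mono) (auto simp: e2_def)
      also have "\<dots> = e1 * (m / 2)"
        using c(1) nonzero_mult_div_cancel_left[of "c + 1" "e1 * (m / 2)"]
        by (simp only: times_divide_eq_right)
      also have "\<dots> \<le> e1 * ?p" using p e1(1) by simp
      finally have "?q \<le> (m + d) * ?p" using e1(2)[of "T u"] u(1) by simp
      also have "\<dots> \<le> (m + d) * (m + d)" using p m d by (intro mult_left_mono) auto
      finally have q: "?q\<^sup>2 \<le> ((m + d)\<^sup>2)\<^sup>2"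
        using u(1) by (intro power_mono) (auto simp: power2_eq_square)
      have pp: "(m - d)\<^sup>2 \<le> ?p\<^sup>2" using u d m by (intro power_mono) auto
      have "ip H (T (T u)) u = of_real (?p\<^sup>2)" using sa[of "T u" u] u(1) by (simp add: ip_self)
      then have "Re (ip H (T (T u)) u) = ?p\<^sup>2" by (simp only: Re_complex_of_real)
      then have "(hnorm H (T (T u) - scaleC (of_real (m\<^sup>2)) u))\<^sup>2 = ?q\<^sup>2 - 2 * m\<^sup>2 * ?p\<^sup>2 + m ^ 4"
        using hnorm_diff_sq[of "T (T u)" u "m\<^sup>2"] u(1,2) by (simp del: of_real_power)
      also have "\<dots> \<le> ((m + d)\<^sup>2)\<^sup>2 - 2 * m\<^sup>2 * (m - d)\<^sup>2 + m ^ 4"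
        using q mult_left_mono[OF pp, of "2 * m\<^sup>2"] by simp
      also have "\<dots> \<le> 19 * m ^ 3 * d" using quartic_bound[OF d] by simp
      also note de
      finally have "hnorm H (T (T u) - scaleC (of_real (m\<^sup>2)) u) < e"
        by (rule power2_less_imp_less) (use e in simp)
      then show ?thesis using u by (auto simp: e2_def)
    qed
    \<comment> \<open>If \<open>- m\<close> is not an approximate eigenvalue, the norm of
      \<open>T u + m u\<close> stays above some \<open>e0\<close>. For the vectors from
      \<open>sq\<close> this vector then serves for the eigenvalue \<open>m\<close>, as
      \<open>T - m\<close> sends it to the small vector
      \<open>T (T u) - m\<^sup>2 u\<close>.\<close>
    show thesis
    proof (cases "\<forall>e>0. \<exists>u\<in>car H. hnorm H u = 1 \<and> g u < e \<and> hnorm H (T u + scaleC (of_real m) u) < e")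
      case True
      have "approx_null (\<lambda>u. g u + defect T (complex_of_real (- m)) u)"
      proof (rule approx_nullI)
        fix e :: real assume e: "e > 0"
        from True[rule_format, OF half_gt_zero[OF e]]
        obtain u where u: "u \<in> car H" "hnorm H u = 1" "g u < e / 2"
          "hnorm H (T u + scaleC (of_real m) u) < e / 2" by blast
        have "T u - scaleC (of_real (- m)) u = T u + scaleC (of_real m) u"
          by (simp add: scaleC_def fun_eq_iff)
        then have "defect T (complex_of_real (- m)) u < e / 2"
          using u(4) by (simp only: defect_def)
        then have "g u + defect T (complex_of_real (- m)) u < e * hnorm H u"
          using u(2,3) by simp
        then show "\<exists>w\<in>car H. g w + defect T (complex_of_real (- m)) w < e * hnorm H w"
          by (rule bexI[OF _ u(1)])
      qed (intro seminorm_on_add g seminorm_on_defect T)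
      then show thesis using that[of "- m"] rm by simp
    next
      case False
      then have "\<exists>e0. e0 > 0 \<and> \<not> (\<exists>u\<in>car H. hnorm H u = 1 \<and> g u < e0 \<and>
          hnorm H (T u + scaleC (of_real m) u) < e0)"
        by (simp only: not_all not_imp)
      then obtain e0 where e0: "e0 > 0" and n: "\<not> (\<exists>u\<in>car H. hnorm H u = 1 \<and> g u < e0 \<and>
          hnorm H (T u + scaleC (of_real m) u) < e0)" by (elim exE conjE)
      have e0': "e0 \<le> hnorm H (T u + scaleC (of_real m) u)"
        if u: "u \<in> car H" "hnorm H u = 1" "g u < e0" for u
      proof (rule ccontr)
        assume "\<not> e0 \<le> hnorm H (T u + scaleC (of_real m) u)"
        then have "hnorm H (T u + scaleC (of_real m) u) < e0" by simp
        with u have "\<exists>u\<in>car H. hnorm H u = 1 \<and> g u < e0 \<and> hnorm H (T u + scaleC (of_real m) u) < e0"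
          by (intro bexI[of _ u] conjI)
        with n show False by (rule notE)
      qed
      have "approx_null (\<lambda>u. g u + defect T (complex_of_real m) u)"
      proof (rule approx_nullI)
        fix e :: real assume e: "e > 0"
        \<comment> \<open>The summand \<open>c + m\<close> pays for the growth of \<open>g\<close>
          under \<open>T + m\<close> and the summand \<open>1\<close> for the residual of
          \<open>T - m\<close>. The factor \<open>e0\<close> appears because \<open>?w\<close> may
          be that short.\<close>
        define e1 where "e1 = min e0 (e * e0 / (c + m + 1))"
        have e1: "e1 > 0" using e0 e c m by (simp add: e1_def)
        obtain u where u: "u \<in> car H" "hnorm H u = 1" "g u < e1"
          "hnorm H (T (T u) - scaleC (of_real (m\<^sup>2)) u) < e1"
          using sq[OF e1] by blast
        let ?w = "T u + scaleC (of_real m) u"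
        have w: "e0 \<le> hnorm H ?w" using e0'[of u] u by (simp add: e1_def)
        have "g ?w \<le> g (T u) + m * g u"
          using seminorm_onD(3)[OF g, of "T u" "scaleC (of_real m) u"]
            seminorm_onD(2)[OF g u(1), of "of_real m"] u(1) m by simp
        also have "\<dots> \<le> (c + m) * g u" using c(2)[OF u(1)] by (simp add: distrib_right)
        also have "\<dots> \<le> (c + m) * e1" using u(3) c m by (intro mult_left_mono) auto
        finally have gw: "g ?w \<le> (c + m) * e1" .
        have "T ?w - scaleC (of_real m) ?w = T (T u) - scaleC (of_real (m\<^sup>2)) u"
          using u(1) by (simp add: op_add[OF T] op_scaleC[OF T] scaleC_add power2_eq_square
              del: add_diff_eq diff_add_eq)
        then have "defect T (of_real m) ?w < e1" using u(4) by (simp only: defect_def)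
        with gw have "g ?w + defect T (of_real m) ?w < (c + m) * e1 + e1" by (rule add_le_less_mono)
        also have "\<dots> = (c + m + 1) * e1" by (simp add: distrib_right)
        also have "\<dots> \<le> (c + m + 1) * (e * e0 / (c + m + 1))"
          using c m by (intro mult_left_mono) (auto simp: e1_def)
        also have "\<dots> = e * e0" using c m by simp
        also have "\<dots> \<le> e * hnorm H ?w" using w e by simp
        finally show "\<exists>w\<in>car H. g w + defect T (complex_of_real m) w < e * hnorm H w"
          by (rule bexI[where x = ?w]) (use u(1) in simp)
      qed (intro seminorm_on_add g seminorm_on_defect T)
      then show thesis using that[of m] rm by simp
    qed
  qed
qed

section \<open>Invariance under commuting operators, normal operators\<close>

definition stable_under :: "'i hop \<Rightarrow> (('i \<Rightarrow> complex) \<Rightarrow> real) \<Rightarrow> bool" where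
  "stable_under T g \<longleftrightarrow> (\<exists>c\<ge>0. \<forall>u\<in>car H. g (T u) \<le> c * g u)"

lemma stable_underD:
  "stable_under T g \<Longrightarrow> \<exists>c. c \<ge> 0 \<and> (\<forall>u\<in>car H. g (T u) \<le> c * g u)"
  by (simp add: stable_under_def)

lemma stable_underI:
  assumes "c \<ge> 0" "\<And>u. u \<in> car H \<Longrightarrow> g (T u) \<le> c * g u"
  shows "stable_under T g"
  unfolding stable_under_def using assms by (intro exI[of _ c] conjI ballI)

lemma stable_under_zero [simp]: "stable_under T (\<lambda>u. 0)"
  by (rule stable_underI[of 0]) simp_all

lemma stable_under_add:
  assumes f: "seminorm_on f" "stable_under T f" and g: "seminorm_on g" "stable_under T g"
  shows "stable_under T (\<lambda>u. f u + g u)"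
proof -
  from stable_underD[OF f(2)]
  obtain a where "a \<ge> 0 \<and> (\<forall>u\<in>car H. f (T u) \<le> a * f u)" by (elim exE)
  then have a: "a \<ge> 0" "\<And>u. u \<in> car H \<Longrightarrow> f (T u) \<le> a * f u" by simp_all
  from stable_underD[OF g(2)]
  obtain b where "b \<ge> 0 \<and> (\<forall>u\<in>car H. g (T u) \<le> b * g u)" by (elim exE)
  then have b: "b \<ge> 0" "\<And>u. u \<in> car H \<Longrightarrow> g (T u) \<le> b * g u" by simp_all
  have "f (T u) + g (T u) \<le> (a + b) * (f u + g u)" if u: "u \<in> car H" for u
  proof -
    have "0 \<le> a * g u" "0 \<le> b * f u"
      using a(1) b(1) seminorm_onD(1)[OF f(1) u] seminorm_onD(1)[OF g(1) u] by simp_all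
    then show ?thesis using a(2)[OF u] b(2)[OF u] by (simp add: algebra_simps)
  qed
  then show ?thesis using a(1) b(1) by (intro stable_underI[of "a + b"]) simp_all
qed

lemma approx_null_mono:
  assumes "approx_null f" "\<And>u. u \<in> car H \<Longrightarrow> g u \<le> f u"
  shows "approx_null g"
  unfolding approx_null_def
proof (intro allI impI)
  fix e :: real assume e: "e > 0"
  obtain u where u: "u \<in> car H" "hnorm H u = 1" "f u < e"
    using assms(1)[unfolded approx_null_def, rule_format, OF e] by (elim bexE conjE)
  then show "\<exists>u\<in>car H. hnorm H u = 1 \<and> g u < e"
    using le_less_trans[OF assms(2)[OF u(1)]] by (intro bexI[of _ u] conjI)
qed

lemma op_commuteD: "S \<circ> T = T \<circ> S \<Longrightarrow> S (T u) = T (S u)"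
  by (metis comp_apply)

text \<open>By commutation \<open>T - c\<close> applied to \<open>S u\<close> equals
  \<open>S\<close> applied to \<open>T u - c u\<close>, so a bound for \<open>S\<close> is the
  required constant.\<close>

lemma stable_under_defect:
  assumes T: "T \<in> bounded_ops H H" and S: "S \<in> bounded_ops H H" and TS: "S \<circ> T = T \<circ> S"
  shows "stable_under S (defect T c)"
proof -
  obtain b where b: "b \<ge> 0" "\<And>u. u \<in> car H \<Longrightarrow> hnorm H (S u) \<le> b * hnorm H u"
    using op_bound[OF S] by metis
  have "defect T c (S u) \<le> b * defect T c u" if u: "u \<in> car H" for u
  proof -
    have "T (S u) - scaleC c (S u) = S (T u - scaleC c u)"
      using u op_car[OF T u] by (simp add: op_diff[OF S] op_scaleC[OF S] op_commuteD[OF TS])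
    then show ?thesis using b(2)[of "T u - scaleC c u"] u op_car[OF T u] by (simp add: defect_def)
  qed
  then show ?thesis using b(1) by (intro stable_underI[of b])
qed

text \<open>With \<open>T\<close> also \<open>T - c\<close> is normal, and a normal operator and its
  adjoint have the same norm at every vector.\<close>

lemma defect_adjoint:
  assumes T: "T \<in> bounded_ops H H" and S: "is_adjoint H H T S" and TS: "S \<circ> T = T \<circ> S"
    and u: "u \<in> car H"
  shows "defect S (cnj c) u = defect T c u"
proof -
  note Sb = adjoint_bop[OF S]
  have m: "T u \<in> car H" "S u \<in> car H" using u op_car[OF T] op_car[OF Sb] by simp_all
  have "ip H (T u) (T u) = ip H (S u) (S u)"
  proof -
    have "ip H (T u) (T u) = ip H u (S (T u))" using adjoint_ip[OF S u m(1)] .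
    also have "\<dots> = ip H u (T (S u))" by (simp add: op_commuteD[OF TS])
    also have "\<dots> = ip H (S u) (S u)" using adjoint_ip2[OF S T u m(2)] by simp
    finally show ?thesis .
  qed
  moreover have "ip H (T u) u = ip H u (S u)" "ip H (S u) u = ip H u (T u)"
    using adjoint_ip[OF S u u] adjoint_ip2[OF S T u u] by simp_all
  ultimately have "ip H (T u - scaleC c u) (T u - scaleC c u)
      = ip H (S u - scaleC (cnj c) u) (S u - scaleC (cnj c) u)"
    using u m by (simp add: ip_diff_left ip_diff_right ip_scaleC_left ip_scaleC_right)
      (simp add: algebra_simps)
  then show ?thesis by (simp add: defect_def hnorm_def)
qed

lemma adjoint_commute:
  assumes T: "T \<in> bounded_ops H H" and S: "is_adjoint H H T S"
    and T': "T' \<in> bounded_ops H H" and S': "is_adjoint H H T' S'" and TT: "T \<circ> T' = T' \<circ> T"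
  shows "S \<circ> S' = S' \<circ> S"
proof (rule op_eqI)
  note b = adjoint_bop[OF S] adjoint_bop[OF S']
  show "S \<circ> S' \<in> bounded_ops H H" "S' \<circ> S \<in> bounded_ops H H" using b by simp_all
  fix u assume u: "u \<in> car H"
  note m = op_car[OF b(1)] op_car[OF b(2)] op_car[OF T] op_car[OF T']
  show "(S \<circ> S') u = (S' \<circ> S) u"
  proof (rule ip_ext)
    show "(S \<circ> S') u \<in> car H" "(S' \<circ> S) u \<in> car H" using u m by simp_all
    fix w assume w: "w \<in> car H"
    have "ip H (S (S' u)) w = ip H u (T' (T w))"
      using u w m by (simp add: adjoint_ip2[OF S T] adjoint_ip2[OF S' T'])
    also have "\<dots> = ip H u (T (T' w))" by (simp add: op_commuteD[OF TT])
    also have "\<dots> = ip H (S' (S u)) w"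
      using u w m by (simp add: adjoint_ip2[OF S T] adjoint_ip2[OF S' T'])
    finally show "ip H ((S \<circ> S') u) w = ip H ((S' \<circ> S) u) w" by simp
  qed
qed

text \<open>Eigenspaces of a normal operator are invariant under the adjoints of the operators
  commuting with it. This replaces Fuglede's theorem.\<close>

lemma stable_under_defect_adjoint:
  assumes T: "T \<in> bounded_ops H H" and S: "is_adjoint H H T S" and TS: "S \<circ> T = T \<circ> S"
    and T': "T' \<in> bounded_ops H H" and S': "is_adjoint H H T' S'" and TT: "T \<circ> T' = T' \<circ> T"
  shows "stable_under S' (defect T c)"
proof -
  note b = adjoint_bop[OF S] adjoint_bop[OF S']
  have "stable_under S' (defect S (cnj c))"
    by (rule stable_under_defect[OF b]) (rule adjoint_commute[OF T S T' S' TT, symmetric])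
  from stable_underD[OF this]
  obtain a where "a \<ge> 0 \<and> (\<forall>u\<in>car H. defect S (cnj c) (S' u) \<le> a * defect S (cnj c) u)" by (elim exE)
  then have a: "a \<ge> 0" "\<And>u. u \<in> car H \<Longrightarrow> defect S (cnj c) (S' u) \<le> a * defect S (cnj c) u" by simp_all
  have "defect T c (S' u) \<le> a * defect T c u" if u: "u \<in> car H" for u
    using a(2)[OF u] defect_adjoint[OF T S TS u] defect_adjoint[OF T S TS op_car[OF b(2) u]]
    by simp
  then show ?thesis by (rule stable_underI[OF a(1)])
qed

definition re_op :: "'i hop \<Rightarrow> 'i hop \<Rightarrow> 'i hop" where
  "re_op T S = scale_op (1 / 2) (T + S)"

definition im_op :: "'i hop \<Rightarrow> 'i hop \<Rightarrow> 'i hop" where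
  "im_op T S = scale_op (- \<i> / 2) (T + scale_op (- 1) S)"

lemma re_op_apply: "re_op T S u = scaleC (1 / 2) (T u) + scaleC (1 / 2) (S u)"
  by (simp add: re_op_def scale_op_def scaleC_add)

lemma im_op_apply: "im_op T S u = scaleC (- \<i> / 2) (T u) + scaleC (\<i> / 2) (S u)"
  by (simp add: im_op_def scale_op_def scaleC_add)

lemma re_op_bop: "T \<in> bounded_ops H H \<Longrightarrow> S \<in> bounded_ops H H \<Longrightarrow> re_op T S \<in> bounded_ops H H"
  and im_op_bop: "T \<in> bounded_ops H H \<Longrightarrow> S \<in> bounded_ops H H \<Longrightarrow> im_op T S \<in> bounded_ops H H"
  by (simp_all add: re_op_def im_op_def)

lemma re_op_selfadjoint:
  assumes T: "T \<in> bounded_ops H H" and S: "is_adjoint H H T S" and u: "u \<in> car H" and v: "v \<in> car H"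
  shows "ip H (re_op T S u) v = ip H u (re_op T S v)"
  using op_car[OF T u] op_car[OF T v] op_car[OF adjoint_bop[OF S] u] op_car[OF adjoint_bop[OF S] v]
    adjoint_ip[OF S u v] adjoint_ip2[OF S T u v] u v
  by (simp add: re_op_apply ip_add_left ip_add_right ip_scaleC_left ip_scaleC_right)

lemma im_op_selfadjoint:
  assumes T: "T \<in> bounded_ops H H" and S: "is_adjoint H H T S" and u: "u \<in> car H" and v: "v \<in> car H"
  shows "ip H (im_op T S u) v = ip H u (im_op T S v)"
  using op_car[OF T u] op_car[OF T v] op_car[OF adjoint_bop[OF S] u] op_car[OF adjoint_bop[OF S] v]
    adjoint_ip[OF S u v] adjoint_ip2[OF S T u v] u v
  by (simp add: im_op_apply ip_add_left ip_add_right ip_scaleC_left ip_scaleC_right)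

lemma re_im_op_commute:
  assumes T: "T \<in> bounded_ops H H" and S: "S \<in> bounded_ops H H" and TS: "S \<circ> T = T \<circ> S"
  shows "re_op T S \<circ> im_op T S = im_op T S \<circ> re_op T S"
proof (rule op_eqI)
  fix u assume u: "u \<in> car H"
  have m: "T u \<in> car H" "S u \<in> car H" using op_car[OF T u] op_car[OF S u] by simp_all
  show "(re_op T S \<circ> im_op T S) u = (im_op T S \<circ> re_op T S) u"
    using m by (simp add: re_op_apply im_op_apply op_add[OF T] op_add[OF S] op_scaleC[OF T]
        op_scaleC[OF S] scaleC_add op_commuteD[OF TS] add_ac)
qed (use T S in \<open>simp_all add: re_op_bop im_op_bop\<close>)

lemma stable_under_re_im:
  assumes T: "T \<in> bounded_ops H H" and S: "S \<in> bounded_ops H H" and g: "seminorm_on g"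
    and st: "stable_under T g" "stable_under S g"
  shows "stable_under (re_op T S) g" "stable_under (im_op T S) g"
proof -
  from stable_underD[OF st(1)]
  obtain a where "a \<ge> 0 \<and> (\<forall>u\<in>car H. g (T u) \<le> a * g u)" by (elim exE)
  then have a: "a \<ge> 0" "\<And>u. u \<in> car H \<Longrightarrow> g (T u) \<le> a * g u" by simp_all
  from stable_underD[OF st(2)]
  obtain b where "b \<ge> 0 \<and> (\<forall>u\<in>car H. g (S u) \<le> b * g u)" by (elim exE)
  then have b: "b \<ge> 0" "\<And>u. u \<in> car H \<Longrightarrow> g (S u) \<le> b * g u" by simp_all
  have *: "g (scaleC c (T u) + scaleC d (S u)) \<le> ((a + b) / 2) * g u"
    if u: "u \<in> car H" and cd: "cmod c = 1 / 2" "cmod d = 1 / 2" for u c d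
  proof -
    note m = op_car[OF T u] op_car[OF S u]
    have "g (scaleC c (T u) + scaleC d (S u)) \<le> g (T u) / 2 + g (S u) / 2"
      using seminorm_onD(3)[OF g, of "scaleC c (T u)" "scaleC d (S u)"] m cd
        seminorm_onD(2)[OF g m(1), of c] seminorm_onD(2)[OF g m(2), of d] by simp
    also have "\<dots> \<le> ((a + b) / 2) * g u"
      using a(2)[OF u] b(2)[OF u] by (simp add: algebra_simps)
    finally show ?thesis .
  qed
  have n: "cmod (1 / 2) = 1 / 2" "cmod (- \<i> / 2) = 1 / 2" "cmod (\<i> / 2) = 1 / 2"
    by (simp_all add: norm_divide)
  show "stable_under (re_op T S) g" "stable_under (im_op T S) g"
    using a(1) b(1) *[OF _ n(1) n(1)] *[OF _ n(2) n(3)]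
    by (auto intro!: stable_underI[of "(a + b) / 2"] simp: re_op_apply im_op_apply
        simp del: scaleC_scaleC)
qed

text \<open>The imaginary part is treated before the real part because the lower bound
  \<open>r\<close> concerns it. The real part commutes with it and hence leaves the enlarged
  seminorm stable. A positive \<open>r\<close> yields a non-real approximate eigenvalue.\<close>

lemma approx_null_normal:
  assumes T: "T \<in> bounded_ops H H" and S: "is_adjoint H H T S" and TS: "S \<circ> T = T \<circ> S"
    and g: "seminorm_on g" "stable_under T g" "stable_under S g"
    and r: "\<And>e. e > 0 \<Longrightarrow> \<exists>u\<in>car H. hnorm H u = 1 \<and> g u < e \<and> r \<le> hnorm H (im_op T S u)" "r \<ge> 0"
  obtains z where "r \<le> \<bar>Im z\<bar>" "approx_null (\<lambda>u. g u + defect T z u)"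
proof -
  note Sb = adjoint_bop[OF S]
  note st = stable_under_re_im[OF T Sb g]
  note Rb = re_op_bop[OF T Sb] and Jb = im_op_bop[OF T Sb]
  from stable_underD[OF st(2)]
  obtain c where "c \<ge> 0 \<and> (\<forall>u\<in>car H. g (im_op T S u) \<le> c * g u)" by (elim exE)
  then have c: "c \<ge> 0" "\<And>u. u \<in> car H \<Longrightarrow> g (im_op T S u) \<le> c * g u" by simp_all
  obtain t where t: "r \<le> \<bar>t\<bar>" "approx_null (\<lambda>u. g u + defect (im_op T S) (of_real t) u)"
    using approx_null_selfadjoint[OF Jb im_op_selfadjoint[OF T S] g(1) c r] .
  let ?g = "\<lambda>u. g u + defect (im_op T S) (of_real t) u"
  have g': "seminorm_on ?g" by (intro seminorm_on_add g seminorm_on_defect Jb)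
  have "stable_under (re_op T S) ?g"
    by (intro stable_under_add g st seminorm_on_defect Jb stable_under_defect Rb
        re_im_op_commute T Sb TS)
  from stable_underD[OF this]
  obtain d where "d \<ge> 0 \<and> (\<forall>u\<in>car H. ?g (re_op T S u) \<le> d * ?g u)" by (elim exE)
  then have d: "d \<ge> 0" "\<And>u. u \<in> car H \<Longrightarrow> ?g (re_op T S u) \<le> d * ?g u" by simp_all
  have r': "\<exists>u\<in>car H. hnorm H u = 1 \<and> ?g u < e \<and> 0 \<le> hnorm H (re_op T S u)" if e: "e > 0" for e
  proof -
    obtain u where u: "u \<in> car H" "hnorm H u = 1" "?g u < e"
      using t(2)[unfolded approx_null_def, rule_format, OF e] by (elim bexE conjE)
    then show ?thesis using hnorm_nonneg[OF op_car[OF Rb u(1)]] by (intro bexI[of _ u] conjI)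
  qed
  obtain s where s: "0 \<le> \<bar>s\<bar>" "approx_null (\<lambda>u. ?g u + defect (re_op T S) (of_real s) u)"
    using approx_null_selfadjoint[OF Rb re_op_selfadjoint[OF T S] g' d r' order_refl] .
  \<comment> \<open>\<open>T - (s + \<i> t)\<close> is the real part minus \<open>s\<close> plus
    \<open>\<i>\<close> times the imaginary part minus \<open>t\<close>, so the two defects add
    up.\<close>
  have "approx_null (\<lambda>u. g u + defect T (Complex s t) u)"
  proof (rule approx_null_mono[OF s(2)])
    fix u assume u: "u \<in> car H"
    let ?a = "re_op T S u - scaleC (of_real s) u" and ?b = "im_op T S u - scaleC (of_real t) u"
    have "?a i + \<i> * ?b i = (T u - scaleC (Complex s t) u) i" for i
      by (simp add: re_op_apply im_op_apply scaleC_def Complex_eq field_simps)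
    then have "T u - scaleC (Complex s t) u = ?a + scaleC \<i> ?b"
      by (simp add: fun_eq_iff scaleC_def)
    moreover have "hnorm H (?a + scaleC \<i> ?b) \<le> hnorm H ?a + hnorm H ?b"
      using hnorm_triangle[of ?a "scaleC \<i> ?b"] hnorm_scaleC[of ?b \<i>] u op_car[OF Rb u] op_car[OF Jb u]
      by simp
    ultimately show "g u + defect T (Complex s t) u
        \<le> ?g u + defect (re_op T S) (of_real s) u" by (simp add: defect_def)
  qed
  then show thesis using that[of "Complex s t"] t(1) by simp
qed

lemma seminorm_on_sum:
  assumes "finite F" "\<And>j. j \<in> F \<Longrightarrow> seminorm_on (f j)"
  shows "seminorm_on (\<lambda>u. \<Sum>j\<in>F. f j u)"
  using assms by (induction F rule: finite_induct) (simp_all add: seminorm_on_add)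

lemma stable_under_sum:
  assumes "finite F" "\<And>j. j \<in> F \<Longrightarrow> seminorm_on (f j)" "\<And>j. j \<in> F \<Longrightarrow> stable_under T (f j)"
  shows "stable_under T (\<lambda>u. \<Sum>j\<in>F. f j u)"
  using assms
  by (induction F rule: finite_induct) (simp_all add: stable_under_add seminorm_on_sum)

text \<open>The defects collected so far are stable under the next operator and under its adjoint,
  so \<open>approx_null_normal\<close> applies to the accumulated seminorm. It is used with
  \<open>r = 0\<close>, which asks nothing of the eigenvalue.\<close>

lemma approx_null_joint:
  fixes N S :: "'d \<Rightarrow> 'i hop"
  assumes N: "\<And>j. N j \<in> bounded_ops H H" "\<And>j. is_adjoint H H (N j) (S j)"
      "\<And>j. S j \<circ> N j = N j \<circ> S j" "\<And>j k. N j \<circ> N k = N k \<circ> N j"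
    and g: "seminorm_on g" "\<And>j. stable_under (N j) g" "\<And>j. stable_under (S j) g"
      "approx_null g"
    and "finite F"
  shows "\<exists>z. approx_null (\<lambda>u. g u + (\<Sum>j\<in>F. defect (N j) (z j) u))"
  using \<open>finite F\<close>
proof (induction F rule: finite_induct)
  case empty
  then show ?case using g(4) by simp
next
  case (insert k F)
  then obtain z where z: "approx_null (\<lambda>u. g u + (\<Sum>j\<in>F. defect (N j) (z j) u))" by (elim exE)
  let ?g = "\<lambda>u. g u + (\<Sum>j\<in>F. defect (N j) (z j) u)"
  have se: "seminorm_on ?g"
    by (intro seminorm_on_add g(1) seminorm_on_sum insert(1) seminorm_on_defect N(1))
  have stN: "stable_under (N k) ?g"
    by (intro stable_under_add g(1,2) seminorm_on_sum stable_under_sum insert(1)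
        seminorm_on_defect stable_under_defect N(1,4))
  have stS: "stable_under (S k) ?g"
    by (intro stable_under_add g(1,3) seminorm_on_sum stable_under_sum insert(1)
        seminorm_on_defect N(1) stable_under_defect_adjoint[OF N(1) N(2) N(3) N(1) N(2) N(4)])
  have r: "\<exists>u\<in>car H. hnorm H u = 1 \<and> ?g u < e \<and> 0 \<le> hnorm H (im_op (N k) (S k) u)"
    if e: "e > 0" for e
  proof -
    obtain u where u: "u \<in> car H" "hnorm H u = 1" "?g u < e"
      using z[unfolded approx_null_def, rule_format, OF e] by (elim bexE conjE)
    then show ?thesis
      using hnorm_nonneg[OF op_car[OF im_op_bop[OF N(1) adjoint_bop[OF N(2)]] u(1)]]
      by (intro bexI[of _ u] conjI)
  qed
  obtain y where y: "0 \<le> \<bar>Im y\<bar>" "approx_null (\<lambda>u. ?g u + defect (N k) y u)"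
    using approx_null_normal[OF N(1) N(2) N(3) se stN stS r order_refl] .
  have "?g u + defect (N k) y u = g u + (\<Sum>j\<in>insert k F. defect (N j) ((z(k := y)) j) u)" for u
    using insert(1,2) by (simp add: add_ac) (rule sum.cong, auto)
  then have "approx_null (\<lambda>u. g u + (\<Sum>j\<in>insert k F. defect (N j) ((z(k := y)) j) u))"
    using approx_null_mono[OF y(2)] by (simp only: order_refl)
  then show ?case by (rule exI[of _ "z(k := y)"])
qed

text \<open>The second condition says, without requiring the adjoint of \<open>T\<close> to exist, that \<open>u\<close> is an
  approximate eigenvector of it for \<open>cnj c\<close>.\<close>

definition near_eig :: "'i hop \<Rightarrow> complex \<Rightarrow> real \<Rightarrow> ('i \<Rightarrow> complex) \<Rightarrow> bool" where
  "near_eig T c e u \<longleftrightarrow> defect T c u \<le> e \<and>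
     (\<forall>v\<in>car H. cmod (ip H (T v) u - c * ip H v u) \<le> e * hnorm H v)"

lemma near_eigI:
  assumes "defect T c u \<le> e" "\<And>v. v \<in> car H \<Longrightarrow> cmod (ip H (T v) u - c * ip H v u) \<le> e * hnorm H v"
  shows "near_eig T c e u"
  using assms by (simp add: near_eig_def)

lemma near_eigD:
  assumes "near_eig T c e u"
  shows "defect T c u \<le> e" "v \<in> car H \<Longrightarrow> cmod (ip H (T v) u - c * ip H v u) \<le> e * hnorm H v"
  using assms by (simp_all add: near_eig_def)

lemma near_eig_mono:
  assumes "near_eig T c a u" "a \<le> b"
  shows "near_eig T c b u"
proof (rule near_eigI)
  show "defect T c u \<le> b" using near_eigD(1)[OF assms(1)] assms(2) by simp
  fix v assume v: "v \<in> car H"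
  show "cmod (ip H (T v) u - c * ip H v u) \<le> b * hnorm H v"
    using near_eigD(2)[OF assms(1) v] mult_right_mono[OF assms(2) hnorm_nonneg[OF v]] by linarith
qed

lemma near_eig_id:
  assumes "u \<in> car H" "0 \<le> e"
  shows "near_eig (id_op H) 1 e u"
  using assms by (intro near_eigI) (simp_all add: defect_def id_op_def)

lemma near_eig_add:
  assumes S: "S \<in> bounded_ops H H" and T: "T \<in> bounded_ops H H" and u: "u \<in> car H"
    and n: "near_eig S c a u" "near_eig T d b u"
  shows "near_eig (S + T) (c + d) (a + b) u"
proof (rule near_eigI)
  note m = op_car[OF S] op_car[OF T]
  have eq: "(S + T) u - scaleC (c + d) u = (S u - scaleC c u) + (T u - scaleC d u)"
    by (simp add: scaleC_add_left)
  have "defect (S + T) (c + d) u \<le> defect S c u + defect T d u"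
    unfolding defect_def eq using m[OF u] u by (intro hnorm_triangle) simp_all
  then show "defect (S + T) (c + d) u \<le> a + b"
    using near_eigD(1)[OF n(1)] near_eigD(1)[OF n(2)] by linarith
  fix v assume v: "v \<in> car H"
  have "ip H ((S + T) v) u - (c + d) * ip H v u
      = (ip H (S v) u - c * ip H v u) + (ip H (T v) u - d * ip H v u)"
    using m[OF v] u by (simp add: ip_add_left algebra_simps)
  then show "cmod (ip H ((S + T) v) u - (c + d) * ip H v u) \<le> (a + b) * hnorm H v"
    using near_eigD(2)[OF n(1) v] near_eigD(2)[OF n(2) v]
      norm_triangle_ineq[of "ip H (S v) u - c * ip H v u" "ip H (T v) u - d * ip H v u"]
    by (simp only: distrib_right)
qed

lemma near_eig_scale:
  assumes T: "T \<in> bounded_ops H H" and u: "u \<in> car H" and n: "near_eig T c a u"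
  shows "near_eig (scale_op k T) (k * c) (cmod k * a) u"
proof (rule near_eigI)
  note m = op_car[OF T]
  have "scale_op k T u - scaleC (k * c) u = scaleC k (T u - scaleC c u)"
    by (simp add: scale_op_def scaleC_diff)
  then show "defect (scale_op k T) (k * c) u \<le> cmod k * a"
    using near_eigD(1)[OF n] m[OF u] u by (simp add: defect_def hnorm_scaleC mult_left_mono)
  fix v assume v: "v \<in> car H"
  have "ip H (scale_op k T v) u - (k * c) * ip H v u = k * (ip H (T v) u - c * ip H v u)"
    using m[OF v] u by (simp add: ip_scaleC_left scale_op_def algebra_simps)
  then show "cmod (ip H (scale_op k T v) u - (k * c) * ip H v u) \<le> (cmod k * a) * hnorm H v"
    using mult_left_mono[OF near_eigD(2)[OF n v], of "cmod k"] by (simp only: norm_mult mult.assoc norm_ge_zero)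
qed

text \<open>Splitting \<open>S (T u) - c d u\<close> as \<open>S (T u - d u) + d (S u - c u)\<close>
  costs \<open>s * b + cmod d * a\<close>; the dual condition costs
  \<open>a * t + cmod c * b\<close>. The stated constant is the sum and so dominates both.\<close>

lemma near_eig_comp:
  assumes S: "S \<in> bounded_ops H H" and T: "T \<in> bounded_ops H H" and u: "u \<in> car H"
    and n: "near_eig S c a u" "near_eig T d b u" and ab: "0 \<le> a" "0 \<le> b"
    and s: "0 \<le> s" "\<And>v. v \<in> car H \<Longrightarrow> hnorm H (S v) \<le> s * hnorm H v"
    and t: "0 \<le> t" "\<And>v. v \<in> car H \<Longrightarrow> hnorm H (T v) \<le> t * hnorm H v"
  shows "near_eig (S \<circ> T) (c * d) (a * (cmod d + t) + b * (cmod c + s)) u"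
proof (rule near_eigI)
  note m = op_car[OF S] op_car[OF T]
  have "(S \<circ> T) u - scaleC (c * d) u = S (T u - scaleC d u) + scaleC d (S u - scaleC c u)"
    using m(2)[OF u] u by (simp add: op_diff[OF S] op_scaleC[OF S] scaleC_diff mult.commute)
  then have "defect (S \<circ> T) (c * d) u \<le> hnorm H (S (T u - scaleC d u)) + cmod d * hnorm H (S u - scaleC c u)"
    using hnorm_triangle[of "S (T u - scaleC d u)" "scaleC d (S u - scaleC c u)"] m[OF u] u
      hnorm_scaleC[of "S u - scaleC c u" d] m(1)[of "T u - scaleC d u"]
    by (simp add: defect_def)
  also have "\<dots> \<le> s * b + cmod d * a"
    using s(2)[of "T u - scaleC d u"] mult_left_mono[OF near_eigD(1)[OF n(2)] s(1)]
      mult_left_mono[OF near_eigD(1)[OF n(1)], of "cmod d"] m[OF u] u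
    by (simp add: defect_def)
  also have "\<dots> \<le> a * (cmod d + t) + b * (cmod c + s)"
    using ab s(1) t(1) by (simp add: algebra_simps)
  finally show "defect (S \<circ> T) (c * d) u \<le> a * (cmod d + t) + b * (cmod c + s)" .
  fix v assume v: "v \<in> car H"
  have "ip H ((S \<circ> T) v) u - c * d * ip H v u
      = (ip H (S (T v)) u - c * ip H (T v) u) + c * (ip H (T v) u - d * ip H v u)"
    by (simp add: algebra_simps)
  then have "cmod (ip H ((S \<circ> T) v) u - c * d * ip H v u)
      \<le> cmod (ip H (S (T v)) u - c * ip H (T v) u) + cmod c * cmod (ip H (T v) u - d * ip H v u)"
    by (metis norm_mult norm_triangle_ineq)
  also have "\<dots> \<le> a * (t * hnorm H v) + cmod c * (b * hnorm H v)"
    using near_eigD(2)[OF n(1) m(2)[OF v]] near_eigD(2)[OF n(2) v] mult_left_mono[OF t(2)[OF v] ab(1)]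
    by (intro add_mono mult_left_mono) simp_all
  also have "\<dots> \<le> (a * (cmod d + t) + b * (cmod c + s)) * hnorm H v"
    using ab s(1) hnorm_nonneg[OF v] by (simp add: algebra_simps)
  finally show "cmod (ip H ((S \<circ> T) v) u - c * d * ip H v u)
      \<le> (a * (cmod d + t) + b * (cmod c + s)) * hnorm H v" .
qed

text \<open>Passing to the adjoint exchanges the two halves of \<open>near_eig\<close>.\<close>

lemma near_eig_adjoint:
  assumes T: "T \<in> bounded_ops H H" and S: "is_adjoint H H T S" and u: "u \<in> car H"
    and n: "near_eig T c a u" and a: "0 \<le> a"
  shows "near_eig S (cnj c) a u"
proof (rule near_eigI)
  note m = op_car[OF adjoint_bop[OF S]] op_car[OF T]
  show "defect S (cnj c) u \<le> a"
    unfolding defect_def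
  proof (rule hnorm_le_if_ip_le)
    fix v assume v: "v \<in> car H"
    show "cmod (ip H v (S u - scaleC (cnj c) u)) \<le> a * hnorm H v"
      using near_eigD(2)[OF n v] u v m(1)[OF u]
      by (simp add: ip_diff_right ip_scaleC_right adjoint_ip[OF S v u])
  qed (use u a m(1)[OF u] in simp_all)
  fix v assume v: "v \<in> car H"
  have "ip H (S v) u - cnj c * ip H v u = ip H v (T u - scaleC c u)"
    using u v m(2)[OF u] by (simp add: ip_diff_right ip_scaleC_right adjoint_ip2[OF S T v u])
  then have "cmod (ip H (S v) u - cnj c * ip H v u) \<le> hnorm H v * defect T c u"
    using cauchy_schwarz[of v "T u - scaleC c u"] u v m(2)[OF u] by (simp add: defect_def)
  also have "\<dots> \<le> a * hnorm H v"
    using mult_left_mono[OF near_eigD(1)[OF n] hnorm_nonneg[OF v]] by (simp add: mult.commute)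
  finally show "cmod (ip H (S v) u - cnj c * ip H v u) \<le> a * hnorm H v" .
qed

text \<open>For normal operators the dual half of \<open>near_eig\<close> is free, because the
  adjoint has the same defect.\<close>

lemma near_eig_normal:
  assumes T: "T \<in> bounded_ops H H" and S: "is_adjoint H H T S" and TS: "S \<circ> T = T \<circ> S"
    and u: "u \<in> car H"
  shows "near_eig T c (defect T c u) u"
proof (rule near_eigI)
  note m = op_car[OF adjoint_bop[OF S]] op_car[OF T]
  fix v assume v: "v \<in> car H"
  have "ip H (T v) u - c * ip H v u = ip H v (S u - scaleC (cnj c) u)"
    using u v m(1)[OF u] by (simp add: ip_diff_right ip_scaleC_right adjoint_ip[OF S v u])
  then have "cmod (ip H (T v) u - c * ip H v u) \<le> hnorm H v * defect S (cnj c) u"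
    using cauchy_schwarz[of v "S u - scaleC (cnj c) u"] u v m(1)[OF u] by (simp add: defect_def)
  then show "cmod (ip H (T v) u - c * ip H v u) \<le> defect T c u * hnorm H v"
    by (simp add: defect_adjoint[OF T S TS u] mult.commute)
qed simp

text \<open>Operator and eigenvalue are perturbed at once, as needed for closure under norm
  limits.\<close>

lemma near_eig_perturb:
  assumes X: "X \<in> bounded_ops H H" and T: "T \<in> bounded_ops H H" and u: "u \<in> car H" "hnorm H u = 1"
    and n: "near_eig X c a u"
    and e: "\<And>v. v \<in> car H \<Longrightarrow> hnorm H (X v - T v) \<le> e * hnorm H v"
  shows "near_eig T d (a + e + cmod (c - d)) u"
proof (rule near_eigI)
  note m = op_car[OF X] op_car[OF T]
  have eq: "T u - scaleC d u = (X u - scaleC c u) - (X u - T u) + scaleC (c - d) u"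
    by (simp add: scaleC_diff_left)
  have "defect T d u \<le> hnorm H ((X u - scaleC c u) - (X u - T u)) + hnorm H (scaleC (c - d) u)"
    unfolding defect_def eq using m[OF u(1)] u(1) by (intro hnorm_triangle) simp_all
  moreover have "hnorm H ((X u - scaleC c u) - (X u - T u)) \<le> defect X c u + hnorm H (X u - T u)"
    unfolding defect_def using m[OF u(1)] u(1) by (intro hnorm_triangle_diff) simp_all
  moreover have "hnorm H (scaleC (c - d) u) = cmod (c - d)" using u by (simp add: hnorm_scaleC)
  moreover have "hnorm H (X u - T u) \<le> e" using e[OF u(1)] u(2) by simp
  ultimately show "defect T d u \<le> a + e + cmod (c - d)"
    using near_eigD(1)[OF n] by linarith
  fix v assume v: "v \<in> car H"
  have "ip H (T v) u - d * ip H v u = (ip H (X v) u - c * ip H v u) - ip H (X v - T v) u + (c - d) * ip H v u"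
    using m[OF v] u by (simp add: ip_diff_left algebra_simps)
  then have "cmod (ip H (T v) u - d * ip H v u) \<le> cmod (ip H (X v) u - c * ip H v u)
      + cmod (ip H (X v - T v) u) + cmod (c - d) * cmod (ip H v u)"
    using norm_triangle_ineq[of "(ip H (X v) u - c * ip H v u) - ip H (X v - T v) u" "(c - d) * ip H v u"]
      norm_triangle_ineq4[of "ip H (X v) u - c * ip H v u" "ip H (X v - T v) u"]
    by (simp only: norm_mult)
  also have "\<dots> \<le> a * hnorm H v + e * hnorm H v + cmod (c - d) * hnorm H v"
    using near_eigD(2)[OF n v] cauchy_schwarz[of "X v - T v" u] cauchy_schwarz[of v u] e[OF v] m[OF v] u v
    by (intro add_mono mult_left_mono) simp_all
  finally show "cmod (ip H (T v) u - d * ip H v u) \<le> (a + e + cmod (c - d)) * hnorm H v"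
    by (simp add: distrib_right)
qed

lemma near_eig_unique:
  assumes T: "T \<in> bounded_ops H H" and u: "u \<in> car H" "hnorm H u = 1"
    and n: "near_eig T c a u" "near_eig T d b u"
  shows "cmod (c - d) \<le> a + b"
proof -
  have eq: "scaleC (c - d) u = (T u - scaleC d u) - (T u - scaleC c u)"
    by (simp add: scaleC_diff_left)
  have "hnorm H (scaleC (c - d) u) \<le> defect T d u + defect T c u"
    unfolding defect_def eq using op_car[OF T u(1)] u(1) by (intro hnorm_triangle_diff) simp_all
  then show ?thesis
    using u near_eigD(1)[OF n(1)] near_eigD(1)[OF n(2)] by (simp add: hnorm_scaleC)
qed

lemma bop_diff:
  assumes "S \<in> bounded_ops H H" "T \<in> bounded_ops H H"
  shows "S - T \<in> bounded_ops H H"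
proof -
  have eq: "S - T = S + scale_op (- 1) T"
    by (rule ext) (simp add: scale_op_def diff_scaleC[symmetric])
  show ?thesis unfolding eq using assms by (intro bop_add bop_scale)
qed

lemma op_norm_bound:
  assumes T: "T \<in> bounded_ops H H" and v: "v \<in> car H"
  shows "hnorm H (T v) \<le> op_norm H T * hnorm H v"
proof (cases "hnorm H v = 0")
  case True
  then have "v = 0" using v hnorm_eq_zero by simp
  then show ?thesis using op_zero[OF T] by simp
next
  case False
  then have n: "hnorm H v > 0" using hnorm_nonneg[OF v] by linarith
  obtain b where b: "0 \<le> b" "\<And>u. u \<in> car H \<Longrightarrow> hnorm H (T u) \<le> b * hnorm H u"
    using op_bound[OF T] by metis
  define k where "k = complex_of_real (1 / hnorm H v)"
  have k: "cmod k = 1 / hnorm H v" using n by (simp add: norm_divide k_def)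
  have "bdd_above ((\<lambda>u. hnorm H (T u)) ` {u \<in> car H. hnorm H u \<le> 1})"
  proof (rule bdd_aboveI2)
    fix u assume u: "u \<in> {u \<in> car H. hnorm H u \<le> 1}"
    then have "b * hnorm H u \<le> b" using mult_left_mono[of "hnorm H u" 1 b] b(1) by simp
    then show "hnorm H (T u) \<le> b" using b(2)[of u] u by simp
  qed
  moreover have "scaleC k v \<in> {u \<in> car H. hnorm H u \<le> 1}" using v k n by (simp add: hnorm_scaleC)
  ultimately have "hnorm H (T (scaleC k v)) \<le> op_norm H T"
    unfolding op_norm_def by (rule cSUP_upper2[OF _ _ order_refl])
  then have "hnorm H (T v) / hnorm H v \<le> op_norm H T"
    using v k by (simp add: op_scaleC[OF T] hnorm_scaleC op_car[OF T])
  then show ?thesis using n by (simp add: divide_le_eq)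
qed

section \<open>Characters from asymptotic eigenvectors\<close>

text \<open>Along unit vectors this is stronger than convergence of the vector states to
  \<open>c\<close>; the stronger form is the one that makes the limit multiplicative.\<close>

definition eig_along :: "(nat \<Rightarrow> 'i \<Rightarrow> complex) \<Rightarrow> 'i hop \<Rightarrow> complex \<Rightarrow> bool" where
  "eig_along U T c \<longleftrightarrow> (\<forall>e>0. \<forall>\<^sub>F n in sequentially. near_eig T c e (U n))"

context
  fixes U :: "nat \<Rightarrow> 'i \<Rightarrow> complex"
  assumes U: "\<And>n. U n \<in> car H" "\<And>n. hnorm H (U n) = 1"
begin

lemma eig_along_unique:
  assumes T: "T \<in> bounded_ops H H" and "eig_along U T c" "eig_along U T d"
  shows "c = d"
proof -
  have "cmod (c - d) \<le> 0 + e" if e: "e > 0" for e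
  proof -
    have "\<forall>\<^sub>F n in sequentially. near_eig T c (e / 2) (U n) \<and> near_eig T d (e / 2) (U n)"
      using assms(2,3)[unfolded eig_along_def, rule_format, OF half_gt_zero[OF e]]
      by (rule eventually_conj)
    from eventually_happens'[OF sequentially_bot this]
    obtain n where "near_eig T c (e / 2) (U n)" "near_eig T d (e / 2) (U n)" by (elim exE conjE)
    from near_eig_unique[OF T U this] show ?thesis by simp
  qed
  then have "cmod (c - d) \<le> 0" by (rule field_le_epsilon)
  then show ?thesis by simp
qed

lemma eig_along_id: "eig_along U (id_op H) 1"
  unfolding eig_along_def using near_eig_id[OF U(1)] by (simp add: less_imp_le)

lemma eig_along_add:
  assumes "S \<in> bounded_ops H H" "T \<in> bounded_ops H H" "eig_along U S c" "eig_along U T d"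
  shows "eig_along U (S + T) (c + d)"
  unfolding eig_along_def
proof (intro allI impI)
  fix e :: real assume e: "e > 0"
  have "\<forall>\<^sub>F n in sequentially. near_eig S c (e / 2) (U n) \<and> near_eig T d (e / 2) (U n)"
    using assms(3,4)[unfolded eig_along_def, rule_format, OF half_gt_zero[OF e]]
    by (rule eventually_conj)
  then show "\<forall>\<^sub>F n in sequentially. near_eig (S + T) (c + d) e (U n)"
    by (rule eventually_mono) (use near_eig_add[OF assms(1,2) U(1), of c "e / 2" _ d "e / 2"] in simp)
qed

lemma eig_along_scale:
  assumes "T \<in> bounded_ops H H" "eig_along U T c"
  shows "eig_along U (scale_op k T) (k * c)"
  unfolding eig_along_def
proof (intro allI impI)
  fix e :: real assume e: "e > 0"
  define e' where "e' = e / (cmod k + 1)"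
  have e': "e' > 0" "cmod k * e' \<le> e"
  proof -
    have k: "0 < cmod k + 1" by (simp add: add_nonneg_pos)
    then show "e' > 0" using e by (simp add: e'_def)
    have "cmod k * e' \<le> (cmod k + 1) * e'" using \<open>e' > 0\<close> by (simp add: distrib_right)
    then show "cmod k * e' \<le> e" using k by (simp add: e'_def)
  qed
  have "\<forall>\<^sub>F n in sequentially. near_eig T c e' (U n)"
    using assms(2)[unfolded eig_along_def, rule_format, OF e'(1)] .
  then show "\<forall>\<^sub>F n in sequentially. near_eig (scale_op k T) (k * c) e (U n)"
    by (rule eventually_mono) (rule near_eig_mono[OF near_eig_scale[OF assms(1) U(1)] e'(2)])
qed

lemma eig_along_comp:
  assumes S: "S \<in> bounded_ops H H" and T: "T \<in> bounded_ops H H"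
    and "eig_along U S c" "eig_along U T d"
  shows "eig_along U (S \<circ> T) (c * d)"
  unfolding eig_along_def
proof (intro allI impI)
  fix e :: real assume e: "e > 0"
  obtain s where s: "0 \<le> s" "\<And>u. u \<in> car H \<Longrightarrow> hnorm H (S u) \<le> s * hnorm H u"
    using op_bound[OF S] by metis
  obtain t where t: "0 \<le> t" "\<And>u. u \<in> car H \<Longrightarrow> hnorm H (T u) \<le> t * hnorm H u"
    using op_bound[OF T] by metis
  define k where "k = cmod d + t + (cmod c + s) + 1"
  have k: "k > 0" using s(1) t(1) by (simp add: k_def add_nonneg_pos)
  define e' where "e' = e / k"
  have e': "e' > 0" using e k by (simp add: e'_def)
  have "e' * (cmod d + t) + e' * (cmod c + s) \<le> e' * k" using e' by (simp add: k_def algebra_simps)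
  also have "\<dots> = e" using k by (simp add: e'_def)
  finally have le: "e' * (cmod d + t) + e' * (cmod c + s) \<le> e" .
  have "\<forall>\<^sub>F n in sequentially. near_eig S c e' (U n) \<and> near_eig T d e' (U n)"
    using assms(3,4)[unfolded eig_along_def, rule_format, OF e'] by (rule eventually_conj)
  then show "\<forall>\<^sub>F n in sequentially. near_eig (S \<circ> T) (c * d) e (U n)"
  proof (rule eventually_mono, elim conjE)
    fix n assume "near_eig S c e' (U n)" "near_eig T d e' (U n)"
    from near_eig_comp[OF S T U(1) this less_imp_le[OF e'] less_imp_le[OF e'] s t]
    show "near_eig (S \<circ> T) (c * d) e (U n)" using le by (rule near_eig_mono)
  qed
qed

lemma eig_along_adjoint:
  assumes "T \<in> bounded_ops H H" "is_adjoint H H T S" "eig_along U T c"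
  shows "eig_along U S (cnj c)"
  unfolding eig_along_def
proof (intro allI impI)
  fix e :: real assume e: "e > 0"
  have "\<forall>\<^sub>F n in sequentially. near_eig T c e (U n)"
    using assms(3)[unfolded eig_along_def, rule_format, OF e] .
  then show "\<forall>\<^sub>F n in sequentially. near_eig S (cnj c) e (U n)"
    by (rule eventually_mono) (rule near_eig_adjoint[OF assms(1,2) U(1) _ less_imp_le[OF e]])
qed

text \<open>Evaluated at one common unit vector \<open>U k\<close>, the eigenvalues of
  \<open>X m\<close> and \<open>X n\<close> differ by at most the sum of the distances of the two
  operators from \<open>T\<close>. Hence they form a Cauchy sequence, and its limit is the
  eigenvalue of \<open>T\<close>.\<close>

lemma eig_along_limit:
  fixes X :: "nat \<Rightarrow> 'i hop"
  assumes T: "T \<in> bounded_ops H H" and X: "\<And>n. X n \<in> bounded_ops H H" "\<And>n. eig_along U (X n) (c n)"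
    and lim: "(\<lambda>n. op_norm H (X n - T)) \<longlonglongrightarrow> 0"
  shows "\<exists>d. eig_along U T d"
proof -
  define \<eta> where "\<eta> n = op_norm H (X n - T)" for n
  have \<eta>: "hnorm H (X n v - T v) \<le> \<eta> n * hnorm H v" if v: "v \<in> car H" for n v
    using op_norm_bound[OF bop_diff[OF X(1) T] v, of n] by (simp add: \<eta>_def)
  have small: "\<exists>M. \<forall>n\<ge>M. \<eta> n < e" if e: "e > 0" for e
    using order_tendstoD(2)[OF lim e] by (simp add: \<eta>_def eventually_sequentially)
  have le: "cmod (c m - c n) \<le> \<eta> m + \<eta> n" for m n
  proof -
    have "cmod (c m - c n) \<le> \<eta> m + \<eta> n + e" if e: "e > 0" for e
    proof -
      have "\<forall>\<^sub>F k in sequentially. near_eig (X m) (c m) (e / 2) (U k) \<and> near_eig (X n) (c n) (e / 2) (U k)"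
        using X(2)[unfolded eig_along_def, rule_format, OF half_gt_zero[OF e]]
        by (intro eventually_conj)
      from eventually_happens'[OF sequentially_bot this]
      obtain k where k: "near_eig (X m) (c m) (e / 2) (U k)" "near_eig (X n) (c n) (e / 2) (U k)"
        by (elim exE conjE)
      have "near_eig T (c m) (e / 2 + \<eta> m + cmod (c m - c m)) (U k)"
        by (rule near_eig_perturb[OF X(1) T U k(1) \<eta>])
      moreover have "near_eig T (c n) (e / 2 + \<eta> n + cmod (c n - c n)) (U k)"
        by (rule near_eig_perturb[OF X(1) T U k(2) \<eta>])
      ultimately have "cmod (c m - c n) \<le> (e / 2 + \<eta> m + cmod (c m - c m)) + (e / 2 + \<eta> n + cmod (c n - c n))"
        by (rule near_eig_unique[OF T U])
      then show ?thesis by simp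
    qed
    then show ?thesis by (rule field_le_epsilon)
  qed
  have "Cauchy c"
  proof (rule CauchyI)
    fix e :: real assume e: "e > 0"
    obtain M where M: "\<forall>n\<ge>M. \<eta> n < e / 2" using small[OF half_gt_zero[OF e]] by (elim exE)
    have "norm (c m - c n) < e" if mn: "m \<ge> M" "n \<ge> M" for m n
      using le[of m n] M[rule_format, OF mn(1)] M[rule_format, OF mn(2)] by linarith
    then show "\<exists>M. \<forall>m\<ge>M. \<forall>n\<ge>M. norm (c m - c n) < e" by (intro exI[of _ M] allI impI)
  qed
  from Cauchy_convergent[OF this] obtain d where d: "c \<longlonglongrightarrow> d"
    unfolding convergent_def by (elim exE)
  have "eig_along U T d"
    unfolding eig_along_def
  proof (intro allI impI)
    fix e :: real assume e: "e > 0"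
    have e3: "e / 3 > 0" using e by simp
    obtain M where M: "\<forall>n\<ge>M. \<eta> n < e / 3" using small[OF e3] by (elim exE)
    obtain M' where M': "\<forall>n\<ge>M'. norm (c n - d) < e / 3" using LIMSEQ_D[OF d e3] by (elim exE)
    define m where "m = max M M'"
    have m: "\<eta> m < e / 3" "cmod (c m - d) < e / 3"
      using M[rule_format, of m] M'[rule_format, of m] by (simp_all add: m_def)
    have "\<forall>\<^sub>F n in sequentially. near_eig (X m) (c m) (e / 3) (U n)"
      using X(2)[unfolded eig_along_def, rule_format, OF e3] .
    then show "\<forall>\<^sub>F n in sequentially. near_eig T d e (U n)"
    proof (rule eventually_mono)
      fix n assume n: "near_eig (X m) (c m) (e / 3) (U n)"
      have "near_eig T d (e / 3 + \<eta> m + cmod (c m - d)) (U n)"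
        by (rule near_eig_perturb[OF X(1) T U n \<eta>])
      then show "near_eig T d e (U n)" by (rule near_eig_mono) (use m in linarith)
    qed
  qed
  then show ?thesis by (rule exI)
qed

text \<open>An asymptotic eigenvalue of each generator is therefore enough to give one to every
  element of the algebra they generate.\<close>

lemma cstar_subalgebra_eig_along:
  "cstar_subalgebra H {T \<in> bounded_ops H H. \<exists>c. eig_along U T c}"
  unfolding cstar_subalgebra_def
proof (intro conjI ballI allI impI)
  let ?B = "{T \<in> bounded_ops H H. \<exists>c. eig_along U T c}"
  have memI: "T \<in> ?B" if "T \<in> bounded_ops H H" "eig_along U T c" for T c
    using that by (intro CollectI conjI exI)
  show "?B \<subseteq> bounded_ops H H" by (rule subsetI) simp
  show "id_op H \<in> ?B" by (rule memI[OF bop_id eig_along_id])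
  {
    fix S T assume "S \<in> ?B" "T \<in> ?B"
    then have b: "S \<in> bounded_ops H H" "T \<in> bounded_ops H H"
      and "\<exists>c. eig_along U S c" "\<exists>c. eig_along U T c" by simp_all
    then obtain c d where c: "eig_along U S c" "eig_along U T d" by (elim exE)
    show "S + T \<in> ?B" by (rule memI[OF bop_add[OF b] eig_along_add[OF b c]])
    show "S \<circ> T \<in> ?B" by (rule memI[OF bop_comp[OF b] eig_along_comp[OF b c]])
  }
  {
    fix k T assume "T \<in> ?B"
    then have b: "T \<in> bounded_ops H H" and "\<exists>c. eig_along U T c" by simp_all
    then obtain c where c: "eig_along U T c" by (elim exE)
    show "scale_op k T \<in> ?B" by (rule memI[OF bop_scale[OF b] eig_along_scale[OF b c]])
  }
  {
    fix T S assume "T \<in> ?B" and S: "is_adjoint H H T S"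
    then have b: "T \<in> bounded_ops H H" and "\<exists>c. eig_along U T c" by simp_all
    then obtain c where c: "eig_along U T c" by (elim exE)
    show "S \<in> ?B" by (rule memI[OF adjoint_bop[OF S] eig_along_adjoint[OF b S c]])
  }
  {
    fix X :: "nat \<Rightarrow> 'i hop" and T
    assume T: "T \<in> bounded_ops H H"
      and *: "(\<forall>n. X n \<in> ?B) \<and> (\<lambda>n. op_norm H (X n - T)) \<longlonglongrightarrow> 0"
    have X: "X n \<in> bounded_ops H H" for n using * by simp
    have "\<forall>n. \<exists>c. eig_along U (X n) c" using * by simp
    then obtain c where c: "\<forall>n. eig_along U (X n) (c n)" by (rule choice[THEN exE])
    have "\<exists>d. eig_along U T d"
      by (rule eig_along_limit[OF T X c[rule_format] conjunct2[OF *]])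
    then show "T \<in> ?B" using T by (intro CollectI conjI)
  }
qed

lemma cstar_gen_eig_along:
  assumes N: "\<And>j. N j \<in> bounded_ops H H" "\<And>j. eig_along U (N j) (z j)"
    and T: "T \<in> cstar_gen H N"
  shows "T \<in> bounded_ops H H" "\<exists>c. eig_along U T c"
proof -
  have "range N \<subseteq> {T \<in> bounded_ops H H. \<exists>c. eig_along U T c}"
    using N by (intro image_subsetI CollectI conjI exI)
  with cstar_subalgebra_eig_along
  have "{T \<in> bounded_ops H H. \<exists>c. eig_along U T c} \<in> {B. cstar_subalgebra H B \<and> range N \<subseteq> B}"
    by (intro CollectI conjI)
  from InterD[OF T[unfolded cstar_gen_def] this]
  have "T \<in> {T \<in> bounded_ops H H. \<exists>c. eig_along U T c}" .
  then show "T \<in> bounded_ops H H" "\<exists>c. eig_along U T c" by simp_all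
qed

lemma joint_spectrum_eig_along:
  fixes N :: "'d::finite \<Rightarrow> 'i hop"
  assumes N: "\<And>j. N j \<in> bounded_ops H H" "\<And>j. eig_along U (N j) (z j)"
  shows "(\<chi> j. z j) \<in> joint_spectrum H N"
proof -
  \<comment> \<open>By \<open>eig_along_unique\<close> the choice is forced on bounded operators, so
    every rule for \<open>eig_along\<close> becomes an equation for \<open>h\<close>.\<close>
  define h where "h T = (SOME c. eig_along U T c)" for T
  note gen = cstar_gen_eig_along[OF N]
  have h: "h T = c" if "T \<in> bounded_ops H H" "eig_along U T c" for T c
    unfolding h_def
    by (rule some_equality[where P = "eig_along U T", OF that(2)])
       (rule eig_along_unique[OF that(1) _ that(2)])
  have hg: "eig_along U T (h T)" if "T \<in> cstar_gen H N" for T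
    unfolding h_def using gen(2)[OF that] by (rule someI_ex)
  have "character_on H (cstar_gen H N) h"
    unfolding character_on_def linear_functional_on_def
  proof (intro conjI ballI allI)
    fix S T assume "S \<in> cstar_gen H N" "T \<in> cstar_gen H N"
    note b = gen(1)[OF this(1)] gen(1)[OF this(2)] hg[OF this(1)] hg[OF this(2)]
    show "h (S + T) = h S + h T" by (rule h[OF bop_add[OF b(1,2)] eig_along_add[OF b]])
    show "h (S \<circ> T) = h S * h T" by (rule h[OF bop_comp[OF b(1,2)] eig_along_comp[OF b]])
  next
    fix k T assume "T \<in> cstar_gen H N"
    note b = gen(1)[OF this] hg[OF this]
    show "h (scale_op k T) = k * h T" by (rule h[OF bop_scale[OF b(1)] eig_along_scale[OF b]])
  next
    show "h (id_op H) = 1" by (rule h[OF bop_id eig_along_id])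
  qed
  moreover have "(\<chi> j. z j) = (\<chi> j. h (N j))" by (simp add: h[OF N])
  ultimately show ?thesis unfolding joint_spectrum_def by (intro CollectI exI[of _ h] conjI)
qed

end

lemma approx_null_joint_spectrum:
  fixes N S :: "'d::finite \<Rightarrow> 'i hop"
  assumes N: "\<And>j. N j \<in> bounded_ops H H" "\<And>j. is_adjoint H H (N j) (S j)"
      "\<And>j. S j \<circ> N j = N j \<circ> S j"
    and z: "approx_null (\<lambda>u. \<Sum>j\<in>UNIV. defect (N j) (z j) u)"
  shows "(\<chi> j. z j) \<in> joint_spectrum H N"
proof -
  let ?g = "\<lambda>u. \<Sum>j\<in>UNIV. defect (N j) (z j) u"
  have "\<exists>u. u \<in> car H \<and> hnorm H u = 1 \<and> ?g u < 1 / real (Suc n)" for n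
    using z[unfolded approx_null_def, rule_format, of "1 / real (Suc n)"] by (simp add: Bex_def)
  then have "\<forall>n. \<exists>u. u \<in> car H \<and> hnorm H u = 1 \<and> ?g u < 1 / real (Suc n)" by (rule allI)
  then obtain U where "\<forall>n. U n \<in> car H \<and> hnorm H (U n) = 1 \<and> ?g (U n) < 1 / real (Suc n)"
    by (rule choice[THEN exE])
  then have U: "\<And>n. U n \<in> car H" "\<And>n. hnorm H (U n) = 1" "\<And>n. ?g (U n) < 1 / real (Suc n)" by simp_all
  have "eig_along U (N j) (z j)" for j
    unfolding eig_along_def
  proof (intro allI impI)
    fix e :: real assume e: "e > 0"
    have "\<forall>\<^sub>F n in sequentially. 1 / real (Suc n) < e"
      using order_tendstoD(2)[OF LIMSEQ_inverse_real_of_nat e] by (simp add: inverse_eq_divide)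
    then show "\<forall>\<^sub>F n in sequentially. near_eig (N j) (z j) e (U n)"
    proof (rule eventually_mono)
      fix n assume n: "1 / real (Suc n) < e"
      have "defect (N j) (z j) (U n) \<le> ?g (U n)"
        using seminorm_onD(1)[OF seminorm_on_defect[OF N(1)] U(1)] by (intro member_le_sum) simp_all
      then have "defect (N j) (z j) (U n) \<le> e" using U(3)[of n] n by linarith
      then show "near_eig (N j) (z j) e (U n)"
        by (rule near_eig_mono[OF near_eig_normal[OF N(1) N(2) N(3) U(1)]])
    qed
  qed
  then show ?thesis by (rule joint_spectrum_eig_along[OF U(1,2) N(1)])
qed

end

section \<open>Normal tuples whose joint spectrum lies in a real ball\<close>

lemma complexify_shifted_ballD:
  assumes "(\<chi> j. z j) \<in> complexify (shifted_ball y C)" "0 \<le> C"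
  shows "\<exists>k. (\<forall>j. z j = complex_of_real (vec_nth k j)) \<and> norm (k - y) \<le> C"
proof -
  obtain v where v: "v \<in> cball 0 1" "(\<chi> j. z j) = (\<chi> j. complex_of_real (vec_nth (y + C *\<^sub>R v) j))"
    using assms(1) unfolding complexify_def shifted_ball_def by (elim imageE) metis
  have "z j = complex_of_real (vec_nth (y + C *\<^sub>R v) j)" for j
    using arg_cong[OF v(2), of "\<lambda>w. vec_nth w j"] by simp
  moreover have "norm (y + C *\<^sub>R v - y) \<le> C"
    using v(1) assms(2) mult_left_mono[of "norm v" 1 C] by simp
  ultimately show ?thesis by (intro exI[of _ "y + C *\<^sub>R v"] conjI allI)
qed

context ips
begin

lemma hnorm_sum:
  assumes "\<And>a. a \<in> F \<Longrightarrow> f a \<in> car H"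
  shows "hnorm H (\<Sum>a\<in>F. f a) \<le> (\<Sum>a\<in>F. hnorm H (f a))"
  using assms
proof (induction F rule: infinite_finite_induct)
  case (insert a F)
  have "hnorm H (f a + (\<Sum>a\<in>F. f a)) \<le> hnorm H (f a) + hnorm H (\<Sum>a\<in>F. f a)"
    using insert(4) by (intro hnorm_triangle car_sum) simp_all
  moreover have "hnorm H (\<Sum>a\<in>F. f a) \<le> (\<Sum>a\<in>F. hnorm H (f a))"
    using insert(4) by (intro insert(3)) simp
  ultimately show ?case by (simp only: sum.insert[OF insert(1,2)])
qed simp_all

lemma op_bound_ex:
  assumes "T \<in> bounded_ops H H"
  shows "\<exists>b. 0 \<le> b \<and> (\<forall>u\<in>car H. hnorm H (T u) \<le> b * hnorm H u)"
proof (rule op_bound[OF assms])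
  fix b assume "0 \<le> b" "\<And>u. u \<in> car H \<Longrightarrow> hnorm H (T u) \<le> b * hnorm H u"
  then show ?thesis by (intro exI[of _ b] conjI ballI)
qed

lemma approx_nullD:
  "approx_null g \<Longrightarrow> e > 0 \<Longrightarrow> \<exists>u. u \<in> car H \<and> hnorm H u = 1 \<and> g u < e"
  by (simp add: approx_null_def Bex_def)

lemma ex_unit_multiple:
  assumes w: "w \<in> car H" "w \<noteq> 0"
  shows "\<exists>k. hnorm H (scaleC k w) = 1 \<and> cmod k = 1 / hnorm H w \<and> hnorm H w > 0"
proof -
  have n: "hnorm H w > 0" using w hnorm_eq_zero[OF w(1)] hnorm_nonneg[OF w(1)] by linarith
  define k where "k = complex_of_real (1 / hnorm H w)"
  have k: "cmod k = 1 / hnorm H w" using n by (simp add: norm_divide k_def)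
  then show ?thesis using n hnorm_scaleC[OF w(1), of k] by (intro exI[of _ k]) simp
qed

lemma defect_scalars_close:
  assumes T: "T \<in> bounded_ops H H" and u: "u \<in> car H" "hnorm H u = 1"
  shows "cmod (c - d) \<le> defect T c u + defect T d u"
proof -
  have eq: "scaleC (c - d) u = (T u - scaleC d u) - (T u - scaleC c u)"
    by (simp add: scaleC_diff_left)
  have "hnorm H (scaleC (c - d) u) \<le> defect T d u + defect T c u"
    unfolding defect_def eq using op_car[OF T u(1)] u(1) by (intro hnorm_triangle_diff) simp_all
  then show ?thesis using u by (simp add: hnorm_scaleC)
qed

context
  fixes N S :: "'d::finite \<Rightarrow> 'i hop" and y :: "real^'d" and C :: real
  assumes N: "\<And>j. N j \<in> bounded_ops H H" "\<And>j. is_adjoint H H (N j) (S j)"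
      "\<And>j. S j \<circ> N j = N j \<circ> S j" "\<And>j k. N j \<circ> N k = N k \<circ> N j"
    and C: "0 \<le> C"
    and spec: "joint_spectrum H N \<subseteq> complexify (shifted_ball y C)"
begin

text \<open>Keeping \<open>g\<close> is the point: vectors with a prescribed property, such as being
  approximate eigenvectors of one more operator, are matched with a point of the ball.\<close>

lemma approx_null_joint_real:
  assumes g: "seminorm_on g" "\<And>j. stable_under (N j) g" "\<And>j. stable_under (S j) g" "approx_null g"
  shows "\<exists>k. norm (k - y) \<le> C \<and>
    approx_null (\<lambda>u. g u + (\<Sum>j\<in>UNIV. defect (N j) (complex_of_real (vec_nth k j)) u))"
proof -
  from approx_null_joint[where N = N and S = S and g = g, OF N g finite[of UNIV]]
  obtain z where z: "approx_null (\<lambda>u. g u + (\<Sum>j\<in>UNIV. defect (N j) (z j) u))" by (elim exE)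
  have "approx_null (\<lambda>u. \<Sum>j\<in>UNIV. defect (N j) (z j) u)"
    by (rule approx_null_mono[OF z]) (simp add: seminorm_onD(1)[OF g(1)])
  from approx_null_joint_spectrum[where N = N and S = S, OF N(1-3) this]
  have "(\<chi> j. z j) \<in> complexify (shifted_ball y C)" using spec by (rule subsetD[rotated])
  from complexify_shifted_ballD[OF this C]
  obtain k where k: "\<forall>j. z j = complex_of_real (vec_nth k j)" "norm (k - y) \<le> C" by (elim exE conjE)
  have "z = (\<lambda>j. complex_of_real (vec_nth k j))" using k(1) by (intro ext) simp
  then show ?thesis using z k(2) by (intro exI[of _ k] conjI) simp_all
qed

text \<open>If the imaginary part of \<open>N i\<close> were nonzero, \<open>N i\<close> would have
  a non-real approximate eigenvalue \<open>z\<close>. Joint approximate eigenvectors refining it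
  belong to a real point of the spectrum, whose coordinate \<open>i\<close> has to equal
  \<open>z\<close>.\<close>

lemma real_spectrum_selfadjoint:
  shows "is_adjoint H H (N i) (N i)"
proof -
  have J0: "im_op (N i) (S i) u = 0" if u: "u \<in> car H" for u
  proof (rule ccontr)
    let ?J = "im_op (N i) (S i)"
    assume J: "?J u \<noteq> 0"
    note Jb = im_op_bop[OF N(1) adjoint_bop[OF N(2)], of i i]
    have "u \<noteq> 0"
    proof
      assume "u = 0"
      then show False using J op_zero[OF Jb] by simp
    qed
    from ex_unit_multiple[OF u this] obtain k where k: "hnorm H (scaleC k u) = 1"
      "cmod k = 1 / hnorm H u" "hnorm H u > 0" by (elim exE conjE)
    define r where "r = hnorm H (?J (scaleC k u))"
    have "r = cmod k * hnorm H (?J u)"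
      by (simp add: r_def op_scaleC[OF Jb u] hnorm_scaleC op_car[OF Jb u])
    moreover have "hnorm H (?J u) > 0"
      using J hnorm_eq_zero[OF op_car[OF Jb u]] hnorm_nonneg[OF op_car[OF Jb u]] by linarith
    ultimately have r: "r > 0" using k(2,3) by simp
    have ex: "\<exists>v\<in>car H. hnorm H v = 1 \<and> 0 < e \<and> r \<le> hnorm H (?J v)" if "e > 0" for e :: real
      using k(1) u that by (intro bexI[of _ "scaleC k u"] conjI) (simp_all add: r_def)
    obtain z where z: "r \<le> \<bar>Im z\<bar>" "approx_null (\<lambda>u. 0 + defect (N i) z u)"
      using approx_null_normal[OF N(1) N(2) N(3) seminorm_on_zero stable_under_zero stable_under_zero
          ex less_imp_le[OF r]] .
    from z(2) have z2: "approx_null (defect (N i) z)" by simp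
    have "\<exists>k. norm (k - y) \<le> C \<and> approx_null (\<lambda>u. defect (N i) z u +
        (\<Sum>j\<in>UNIV. defect (N j) (complex_of_real (vec_nth k j)) u))"
      by (intro approx_null_joint_real seminorm_on_defect N(1) z2 stable_under_defect N(4)
          stable_under_defect_adjoint[OF N(1) N(2) N(3) N(1) N(2) N(4)])
    then obtain k where k: "approx_null (\<lambda>u. defect (N i) z u +
        (\<Sum>j\<in>UNIV. defect (N j) (complex_of_real (vec_nth k j)) u))" by (elim exE conjE)
    have "cmod (z - complex_of_real (vec_nth k i)) \<le> 0 + e" if e: "e > 0" for e
    proof -
      from approx_nullD[OF k e]
      obtain u where u: "u \<in> car H" "hnorm H u = 1" "defect (N i) z u +
        (\<Sum>j\<in>UNIV. defect (N j) (complex_of_real (vec_nth k j)) u) < e" by (elim exE conjE)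
      have "defect (N i) (complex_of_real (vec_nth k i)) u
          \<le> (\<Sum>j\<in>UNIV. defect (N j) (complex_of_real (vec_nth k j)) u)"
        using seminorm_onD(1)[OF seminorm_on_defect[OF N(1)] u(1)] by (intro member_le_sum) simp_all
      then show ?thesis
        using u(3) defect_scalars_close[OF N(1) u(1,2), of z "complex_of_real (vec_nth k i)" i] by linarith
    qed
    then have "cmod (z - complex_of_real (vec_nth k i)) \<le> 0" by (rule field_le_epsilon)
    then have "Im z = 0" by simp
    then show False using z(1) r by simp
  qed
  have "N i u = S i u" if u: "u \<in> car H" for u
  proof
    fix a
    have "im_op (N i) (S i) u a = 0" using J0[OF u] by simp
    then show "N i u a = S i u a" by (simp add: im_op_apply scaleC_def)
  qed
  then have "N i = S i" by (rule op_eqI[OF N(1) adjoint_bop[OF N(2)]])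
  then show ?thesis using N(2)[of i] by simp
qed

text \<open>A violating vector gives the operator \<open>P = (\<Sum>j. (N j - y j)\<^sup>2)\<close>
  an approximate eigenvalue of modulus above \<open>C\<^sup>2\<close>. On joint approximate
  eigenvectors of \<open>P\<close> and the \<open>N j\<close> this eigenvalue must be
  \<open>(norm (k - y))\<^sup>2\<close> for a point \<open>k\<close> of the ball.\<close>

lemma sum_hnorm_sq_le:
  assumes w: "w \<in> car H"
  shows "(\<Sum>j\<in>UNIV. (hnorm H (N j w - scaleC (complex_of_real (vec_nth y j)) w))\<^sup>2) \<le> C\<^sup>2 * (hnorm H w)\<^sup>2"
proof (rule ccontr)
  assume gt: "\<not> ?thesis"
  define A where "A j = N j + scale_op (- complex_of_real (vec_nth y j)) (id_op H)" for j
  have Ab: "A j \<in> bounded_ops H H" for j unfolding A_def using N(1) by simp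
  have A: "A j u = N j u - scaleC (complex_of_real (vec_nth y j)) u" if "u \<in> car H" for j u
    using that by (simp add: A_def scale_op_def id_op_def fun_eq_iff scaleC_def)
  note m = op_car[OF N(1)] op_car[OF Ab]
  have Asa: "ip H (A j u) v = ip H u (A j v)" if "u \<in> car H" "v \<in> car H" for j u v
    using that m adjoint_ip[OF real_spectrum_selfadjoint that]
    by (simp add: A ip_diff_left ip_diff_right ip_scaleC_left ip_scaleC_right)
  define P where "P = (\<Sum>j\<in>UNIV. A j \<circ> A j)"
  have Pb: "P \<in> bounded_ops H H" unfolding P_def using Ab by (intro bop_sum bop_comp)
  have P: "P u = (\<Sum>j\<in>UNIV. A j (A j u))" for u
    by (simp add: P_def sum_apply)
  have Psa: "ip H (P u) v = ip H u (P v)" if "u \<in> car H" "v \<in> car H" for u v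
    using that m by (simp add: P ip_sum_left ip_sum_right Asa)
  have w0: "w \<noteq> 0"
  proof
    assume "w = 0"
    then show False using gt by (simp add: op_zero[OF N(1)])
  qed
  from ex_unit_multiple[OF w w0] obtain l where l: "hnorm H (scaleC l w) = 1"
    "cmod l = 1 / hnorm H w" "hnorm H w > 0" by (elim exE conjE)
  define w' where "w' = scaleC l w"
  have w': "w' \<in> car H" "hnorm H w' = 1" using w l(1) by (simp_all add: w'_def)
  \<comment> \<open>This is the quadratic form of \<open>P\<close> at the unit vector
    \<open>w'\<close>, hence a lower bound for the norm of \<open>P w'\<close>.\<close>
  define s where "s = (\<Sum>j\<in>UNIV. (hnorm H (A j w'))\<^sup>2)"
  have "s = (cmod l)\<^sup>2 * (\<Sum>j\<in>UNIV. (hnorm H (N j w - scaleC (complex_of_real (vec_nth y j)) w))\<^sup>2)"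
  proof -
    have "hnorm H (A j w') = cmod l * hnorm H (A j w)" for j
      using w m by (simp add: w'_def op_scaleC[OF Ab w] hnorm_scaleC)
    then show ?thesis by (simp add: s_def A[OF w] power_mult_distrib sum_distrib_left)
  qed
  moreover have "(cmod l)\<^sup>2 * (C\<^sup>2 * (hnorm H w)\<^sup>2) = C\<^sup>2" using l(2,3) by (simp add: power_divide)
  moreover have "(cmod l)\<^sup>2 * (C\<^sup>2 * (hnorm H w)\<^sup>2)
    < (cmod l)\<^sup>2 * (\<Sum>j\<in>UNIV. (hnorm H (N j w - scaleC (complex_of_real (vec_nth y j)) w))\<^sup>2)"
    using gt l(2,3) by (intro mult_strict_left_mono) simp_all
  ultimately have s: "C\<^sup>2 < s" by (simp only:)
  have "ip H (P w') w' = complex_of_real s"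
    using w' m by (simp add: P ip_sum_left Asa ip_self s_def)
  then have "s \<le> cmod (ip H (P w') w')" by simp
  also have "\<dots> \<le> hnorm H (P w')" using cauchy_schwarz[OF op_car[OF Pb w'(1)] w'(1)] w'(2) by simp
  finally have sP: "s \<le> hnorm H (P w')" .
  have s0: "0 \<le> s" using s zero_le_power2[of C] by linarith
  have ex: "\<exists>v\<in>car H. hnorm H v = 1 \<and> 0 < e \<and> s \<le> hnorm H (P v)" if "e > 0" for e :: real
    using w' sP that by (intro bexI[of _ w'] conjI)
  have "0 \<le> 0 * (0::real)" by simp
  obtain t where t: "s \<le> \<bar>t\<bar>" "approx_null (\<lambda>u. 0 + defect P (complex_of_real t) u)"
    using approx_null_selfadjoint[OF Pb Psa seminorm_on_zero order_refl \<open>0 \<le> 0 * 0\<close> ex s0] .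
  from t(2) have t2: "approx_null (defect P (complex_of_real t))" by simp
  have NA: "N k (A j u) = A j (N k u)" if "u \<in> car H" for j k u
    using that m by (simp add: A op_diff[OF N(1)] op_scaleC[OF N(1)] op_commuteD[OF N(4)])
  have NP: "N k \<circ> P = P \<circ> N k" for k
  proof (rule op_eqI)
    fix u assume u: "u \<in> car H"
    have "N k (\<Sum>j\<in>F. A j (A j u)) = (\<Sum>j\<in>F. A j (A j (N k u)))" for F
      using u m by (induction F rule: infinite_finite_induct)
        (simp_all add: op_zero[OF N(1)] op_add[OF N(1)] NA)
    then show "(N k \<circ> P) u = (P \<circ> N k) u" by (simp add: P)
  qed (use Pb N(1) in simp_all)
  have NS: "S k = N k" for k
  proof (rule op_eqI[OF adjoint_bop[OF N(2)] N(1)])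
    fix u assume u: "u \<in> car H"
    show "S k u = N k u"
      using u op_car[OF adjoint_bop[OF N(2)] u] m
      by (intro ip_ext) (simp_all add: adjoint_ip2[OF N(2) N(1)] adjoint_ip[OF real_spectrum_selfadjoint])
  qed
  have "\<exists>k. norm (k - y) \<le> C \<and> approx_null (\<lambda>u. defect P (complex_of_real t) u +
      (\<Sum>j\<in>UNIV. defect (N j) (complex_of_real (vec_nth k j)) u))"
  proof (rule approx_null_joint_real[OF seminorm_on_defect[OF Pb] _ _ t2])
    fix j
    show "stable_under (N j) (defect P (complex_of_real t))"
      by (rule stable_under_defect[OF Pb N(1) NP])
    then show "stable_under (S j) (defect P (complex_of_real t))" unfolding NS .
  qed
  then obtain k where k: "norm (k - y) \<le> C" "approx_null (\<lambda>u. defect P (complex_of_real t) u +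
        (\<Sum>j\<in>UNIV. defect (N j) (complex_of_real (vec_nth k j)) u))" by (elim exE conjE)
  define \<mu> where "\<mu> j = vec_nth (k - y) j" for j
  define \<sigma> where "\<sigma> = (\<Sum>j\<in>UNIV. (\<mu> j)\<^sup>2)"
  have \<sigma>: "\<sigma> \<le> C\<^sup>2" "0 \<le> \<sigma>"
    using power_mono[OF k(1) norm_ge_zero, of 2]
    by (simp_all add: \<sigma>_def \<mu>_def norm_vec_def L2_set_def sum_nonneg)
  have "\<exists>b. 0 \<le> b \<and> (\<forall>u\<in>car H. hnorm H (A j u) \<le> b * hnorm H u)" for j
    by (rule op_bound_ex[OF Ab])
  then have "\<forall>j. \<exists>b. 0 \<le> b \<and> (\<forall>u\<in>car H. hnorm H (A j u) \<le> b * hnorm H u)" by (rule allI)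
  then obtain b where "\<forall>j. 0 \<le> b j \<and> (\<forall>u\<in>car H. hnorm H (A j u) \<le> b j * hnorm H u)"
    by (rule choice[THEN exE])
  then have b: "\<And>j. 0 \<le> b j" "\<And>j u. u \<in> car H \<Longrightarrow> hnorm H (A j u) \<le> b j * hnorm H u"
    by simp_all
  \<comment> \<open>Each term \<open>A j\<close> squared minus \<open>\<mu> j\<close> squared
    factors as \<open>(A j + \<mu> j) (A j - \<mu> j)\<close>; the first factor costs
    \<open>b j + \<bar>\<mu> j\<bar>\<close>.\<close>
  define B where "B = (\<Sum>j\<in>UNIV. b j + \<bar>\<mu> j\<bar>)"
  have B: "0 \<le> B" unfolding B_def using b(1) by (intro sum_nonneg) simp
  have "\<bar>t - \<sigma>\<bar> \<le> 0 + e" if e: "e > 0" for e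
  proof -
    define e' where "e' = e / (B + 1)"
    have e': "e' > 0" using e B by (simp add: e'_def)
    from approx_nullD[OF k(2) e']
    obtain u where u: "u \<in> car H" "hnorm H u = 1" "defect P (complex_of_real t) u +
        (\<Sum>j\<in>UNIV. defect (N j) (complex_of_real (vec_nth k j)) u) < e'" by (elim exE conjE)
    have nn: "0 \<le> defect (N j) (complex_of_real (vec_nth k j)) u" for j
      by (rule seminorm_onD(1)[OF seminorm_on_defect[OF N(1)] u(1)])
    have dP0: "0 \<le> defect P (complex_of_real t) u"
      by (rule seminorm_onD(1)[OF seminorm_on_defect[OF Pb] u(1)])
    have dP: "defect P (complex_of_real t) u \<le> e'"
      using u(3) sum_nonneg[of UNIV "\<lambda>j. defect (N j) (complex_of_real (vec_nth k j)) u"] nn by simp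
    have dN: "defect (N j) (complex_of_real (vec_nth k j)) u \<le> e'" for j
      using u(3) member_le_sum[of j UNIV "\<lambda>j. defect (N j) (complex_of_real (vec_nth k j)) u"] nn dP0
      by simp
    have dA: "hnorm H (A j (A j u) - scaleC (complex_of_real ((\<mu> j)\<^sup>2)) u) \<le> (b j + \<bar>\<mu> j\<bar>) * e'" for j
    proof -
      let ?x = "A j u - scaleC (complex_of_real (\<mu> j)) u"
      have x: "?x = N j u - scaleC (complex_of_real (vec_nth k j)) u"
        using u(1) by (simp add: A \<mu>_def fun_eq_iff scaleC_def algebra_simps)
      have xc: "?x \<in> car H" using u(1) m by simp
      have xn: "hnorm H ?x \<le> e'" unfolding x using dN[of j] by (simp only: defect_def)
      have eq: "A j (A j u) - scaleC (complex_of_real ((\<mu> j)\<^sup>2)) u = A j ?x + scaleC (complex_of_real (\<mu> j)) ?x"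
        using u(1) m by (simp add: op_diff[OF Ab] op_scaleC[OF Ab] scaleC_diff power2_eq_square)
      have "hnorm H (A j ?x + scaleC (complex_of_real (\<mu> j)) ?x)
          \<le> hnorm H (A j ?x) + hnorm H (scaleC (complex_of_real (\<mu> j)) ?x)"
        by (intro hnorm_triangle m(2) car_scaleC xc)
      also have "\<dots> \<le> b j * hnorm H ?x + \<bar>\<mu> j\<bar> * hnorm H ?x"
        using b(2)[OF xc, of j] hnorm_scaleC[OF xc, of "complex_of_real (\<mu> j)"] by simp
      also have "\<dots> \<le> (b j + \<bar>\<mu> j\<bar>) * e'"
        unfolding distrib_right using b(1) xn by (intro add_mono mult_left_mono) simp_all
      finally show ?thesis unfolding eq .
    qed
    have "hnorm H (P u - scaleC (complex_of_real \<sigma>) u) \<le> B * e'"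
    proof -
      have eq: "P u - scaleC (complex_of_real \<sigma>) u
          = (\<Sum>j\<in>UNIV. A j (A j u) - scaleC (complex_of_real ((\<mu> j)\<^sup>2)) u)"
        by (simp add: fun_eq_iff P \<sigma>_def sum_apply scaleC_def sum_subtractf sum_distrib_right)
      have "hnorm H (\<Sum>j\<in>UNIV. A j (A j u) - scaleC (complex_of_real ((\<mu> j)\<^sup>2)) u)
          \<le> (\<Sum>j\<in>UNIV. hnorm H (A j (A j u) - scaleC (complex_of_real ((\<mu> j)\<^sup>2)) u))"
        using u(1) m by (intro hnorm_sum car_diff car_scaleC) simp_all
      also have "\<dots> \<le> B * e'" unfolding B_def sum_distrib_right by (intro sum_mono dA)
      finally show ?thesis unfolding eq .
    qed
    then have "\<bar>t - \<sigma>\<bar> \<le> e' + B * e'"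
      using defect_scalars_close[OF Pb u(1,2), of "complex_of_real t" "complex_of_real \<sigma>"] dP
      by (simp add: defect_def flip: of_real_diff)
    also have "\<dots> = e' * (B + 1)" by (simp add: algebra_simps)
    also have "\<dots> = e" using B by (simp add: e'_def)
    finally show ?thesis by simp
  qed
  then have "\<bar>t - \<sigma>\<bar> \<le> 0" by (rule field_le_epsilon)
  then show False using \<sigma> s t(1) by simp
qed

end

end

section \<open>Anticommuting matrices\<close>

text \<open>Index functions in place of matrices turn products into plain finite sums that can be
  interchanged with sums over \<open>'d\<close>. Since \<open>real\<close> is asked at all indices,
  matrices enter extended by zero. Symmetry, and not only self-adjointness, will let coefficients
  \<open>f j k l\<close> act as multiplication from the right.\<close>

locale clifford =
  fixes n :: nat and f :: "'d::finite \<Rightarrow> nat \<Rightarrow> nat \<Rightarrow> complex"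
  assumes real: "cnj (f j p k) = f j p k"
    and sym: "p < n \<Longrightarrow> k < n \<Longrightarrow> f j p k = f j k p"
    and anticommute: "p < n \<Longrightarrow> k < n \<Longrightarrow>
      (\<Sum>q<n. f i p q * f j q k) + (\<Sum>q<n. f j p q * f i q k) = (if i = j \<and> p = k then 2 else 0)"
begin

definition mm :: "(nat \<Rightarrow> nat \<Rightarrow> complex) \<Rightarrow> (nat \<Rightarrow> nat \<Rightarrow> complex) \<Rightarrow> nat \<Rightarrow> nat \<Rightarrow> complex" where
  "mm A B p k = (\<Sum>q<n. A p q * B q k)"

definition e :: "nat \<Rightarrow> nat \<Rightarrow> complex" where
  "e p k = (if p = k then 1 else 0)"

lemma mm_e_left:
  assumes "p < n"
  shows "mm e A p k = A p k"
proof -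
  have "mm e A p k = (\<Sum>q<n. if p = q then A q k else 0)"
    unfolding mm_def e_def by (intro sum.cong) simp_all
  then show ?thesis using assms by simp
qed

lemma mm_e_right:
  assumes "k < n"
  shows "mm A e p k = A p k"
proof -
  have "mm A e p k = (\<Sum>q<n. if q = k then A p q else 0)"
    unfolding mm_def e_def by (intro sum.cong) simp_all
  then show ?thesis using assms by simp
qed

lemma mm_assoc: "mm (mm A B) C p k = mm A (mm B C) p k"
  unfolding mm_def sum_distrib_left sum_distrib_right by (subst sum.swap) (simp add: mult.assoc)

lemma mm_cong_right: "(\<And>q. q < n \<Longrightarrow> B q k = B' q k) \<Longrightarrow> mm A B p k = mm A B' p k"
  by (simp add: mm_def)

lemma mm_cong_left: "(\<And>q. q < n \<Longrightarrow> A p q = A' p q) \<Longrightarrow> mm A B p k = mm A' B p k"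
  by (simp add: mm_def)

lemma mm_add_right: "mm A (\<lambda>p k. B p k + C p k) p k = mm A B p k + mm A C p k"
  by (simp add: mm_def algebra_simps sum.distrib)

lemma mm_diff_right: "mm A (\<lambda>p k. B p k - C p k) p k = mm A B p k - mm A C p k"
  by (simp add: mm_def algebra_simps sum_subtractf)

lemma mm_add_left: "mm (\<lambda>p k. B p k + C p k) A p k = mm B A p k + mm C A p k"
  by (simp add: mm_def algebra_simps sum.distrib)

lemma mm_scale_right: "mm A (\<lambda>p k. c * B p k) p k = c * mm A B p k"
  by (simp add: mm_def sum_distrib_left mult_ac)

lemma mm_scale_left: "mm (\<lambda>p k. c * B p k) A p k = c * mm B A p k"
  by (simp add: mm_def sum_distrib_left mult_ac)

lemma mm_sum_right: "mm A (\<lambda>p k. \<Sum>i\<in>I. B i p k) p k = (\<Sum>i\<in>I. mm A (B i) p k)"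
  unfolding mm_def sum_distrib_left by (rule sum.swap)

lemma mm_sum_left: "mm (\<lambda>p k. \<Sum>i\<in>I. B i p k) A p k = (\<Sum>i\<in>I. mm (B i) A p k)"
  unfolding mm_def sum_distrib_right by (rule sum.swap)

lemma mm_anticommute:
  "p < n \<Longrightarrow> k < n \<Longrightarrow> mm (f i) (f j) p k = (if i = j then 2 * e p k else 0) - mm (f j) (f i) p k"
  using anticommute[of p k i j] by (auto simp: mm_def e_def eq_diff_eq)

lemma mm_self: "p < n \<Longrightarrow> k < n \<Longrightarrow> mm (f j) (f j) p k = e p k"
  using mm_anticommute[of p k j j] by simp

lemma mm_conjugate:
  assumes "p < n" "k < n"
  shows "mm (f j) (mm (f i) (f j)) p k = (if i = j then 2 * f j p k else 0) - f i p k"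
proof -
  have "mm (f j) (mm (f i) (f j)) p k
      = mm (f j) (\<lambda>q l. (if i = j then 2 else 0) * e q l - mm (f j) (f i) q l) p k"
    by (rule mm_cong_right) (simp add: mm_anticommute[OF _ assms(2), of _ i j])
  also have "\<dots> = (if i = j then 2 else 0) * f j p k - mm (mm (f j) (f j)) (f i) p k"
    using assms by (simp add: mm_diff_right mm_scale_right mm_e_right mm_assoc)
  also have "mm (mm (f j) (f j)) (f i) p k = mm e (f i) p k"
    by (rule mm_cong_left) (rule mm_self[OF assms(1)])
  finally show ?thesis using assms by (simp add: mm_e_left)
qed

definition comb :: "real^'d \<Rightarrow> nat \<Rightarrow> nat \<Rightarrow> complex" where
  "comb v p k = (\<Sum>i\<in>UNIV. of_real (vec_nth v i) * f i p k)"

lemma norm_sq_vec: "(norm (v :: real^'d))\<^sup>2 = (\<Sum>i\<in>UNIV. (vec_nth v i)\<^sup>2)"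
  by (simp add: norm_vec_def L2_set_def sum_nonneg)

text \<open>Adding the double sum to its transpose pairs \<open>(i, j)\<close> with
  \<open>(j, i)\<close>, and anticommutation leaves only the diagonal.\<close>

lemma comb_square:
  assumes "p < n" "k < n"
  shows "mm (comb v) (comb v) p k = of_real ((norm v)\<^sup>2) * e p k"
proof -
  let ?s = "\<lambda>i j. of_real (vec_nth v i) * of_real (vec_nth v j) * mm (f i) (f j) p k"
  have T: "mm (comb v) (comb v) p k = (\<Sum>i\<in>UNIV. \<Sum>j\<in>UNIV. ?s i j)"
    unfolding comb_def mm_sum_left mm_sum_right mm_scale_left mm_scale_right
    by (simp add: sum_distrib_left mult.assoc mult.left_commute)
  have "2 * (\<Sum>i\<in>UNIV. \<Sum>j\<in>UNIV. ?s i j) = (\<Sum>i\<in>UNIV. \<Sum>j\<in>UNIV. ?s i j) + (\<Sum>j\<in>UNIV. \<Sum>i\<in>UNIV. ?s i j)"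
    using sum.swap[of ?s UNIV UNIV] by simp
  also have "\<dots> = (\<Sum>i\<in>UNIV. \<Sum>j\<in>UNIV. ?s i j + ?s j i)" by (simp add: sum.distrib)
  also have "\<dots> = (\<Sum>i\<in>UNIV. \<Sum>j\<in>UNIV. if i = j then 2 * of_real ((vec_nth v i)\<^sup>2) * e p k else 0)"
  proof (intro sum.cong refl)
    fix i j
    have "?s i j + ?s j i = of_real (vec_nth v i) * of_real (vec_nth v j) * (mm (f i) (f j) p k + mm (f j) (f i) p k)"
      by (simp add: algebra_simps)
    also have "mm (f i) (f j) p k + mm (f j) (f i) p k = (if i = j then 2 * e p k else 0)"
      using mm_anticommute[OF assms, of i j] by simp
    finally show "?s i j + ?s j i = (if i = j then 2 * of_real ((vec_nth v i)\<^sup>2) * e p k else 0)"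
      by (simp add: power2_eq_square)
  qed
  also have "\<dots> = 2 * of_real ((norm v)\<^sup>2) * e p k"
    by (simp add: norm_sq_vec sum_distrib_left sum_distrib_right)
  finally show ?thesis unfolding T by simp
qed

text \<open>Conjugation by \<open>f j\<close> fixes \<open>f j\<close> and negates each of the other
  generators, so every \<open>f i\<close> is counted \<open>1 - (d - 1)\<close> times.\<close>

lemma comb_conjugate:
  assumes "p < n" "k < n"
  shows "(\<Sum>j\<in>UNIV. mm (f j) (mm (comb v) (f j)) p k) = (2 - of_nat CARD('d)) * comb v p k"
proof -
  have "mm (f j) (mm (comb v) (f j)) p k = 2 * of_real (vec_nth v j) * f j p k - comb v p k" for j
  proof -
    have "mm (f j) (mm (comb v) (f j)) p k
        = mm (f j) (\<lambda>p k. \<Sum>i\<in>UNIV. of_real (vec_nth v i) * mm (f i) (f j) p k) p k"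
      by (rule mm_cong_right) (simp add: comb_def[abs_def] mm_sum_left mm_scale_left)
    also have "\<dots> = (\<Sum>i\<in>UNIV. of_real (vec_nth v i) * ((if i = j then 2 * f j p k else 0) - f i p k))"
      unfolding mm_sum_right mm_scale_right mm_conjugate[OF assms] ..
    also have "\<dots> = (\<Sum>i\<in>UNIV. if i = j then of_real (vec_nth v i) * (2 * f j p k) else 0) - comb v p k"
      unfolding comb_def sum_subtractf[symmetric] by (intro sum.cong refl) (simp add: algebra_simps)
    finally show ?thesis by simp
  qed
  then have "(\<Sum>j\<in>UNIV. mm (f j) (mm (comb v) (f j)) p k)
      = 2 * comb v p k - of_nat CARD('d) * comb v p k"
    by (simp add: sum_subtractf comb_def sum_distrib_left mult_ac)
  then show ?thesis by (simp add: algebra_simps)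
qed

text \<open>The map sends \<open>e\<close> to \<open>C d e + comb v\<close> and
  \<open>comb v\<close> to \<open>(norm v)\<^sup>2 e + C (2 - d) comb v\<close>, with eigenvalues
  \<open>C + s\<close> and \<open>C - s\<close>. With coefficient \<open>1\<close> at
  \<open>comb v\<close>, the equation for that coefficient determines the one at \<open>e\<close> as
  \<open>s + C (d - 1)\<close>.\<close>

lemma eigenvector:
  fixes v :: "real^'d" and C :: real
  defines "s \<equiv> sqrt ((norm v)\<^sup>2 + C\<^sup>2 * (real CARD('d) - 1)\<^sup>2)"
  defines "M \<equiv> \<lambda>p k. of_real (s + C * (real CARD('d) - 1)) * e p k + comb v p k"
  assumes pk: "p < n" "k < n"
  shows "(\<Sum>j\<in>UNIV. of_real (vec_nth v j) * mm M (f j) p k + of_real C * mm (f j) (mm M (f j)) p k)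
    = of_real (s + C) * M p k"
proof -
  define a where "a = s + C * (real CARD('d) - 1)"
  have M: "M = (\<lambda>p k. of_real a * e p k + comb v p k)" by (simp add: M_def a_def)
  have MF: "mm M (f j) q l = of_real a * f j q l + mm (comb v) (f j) q l" if "q < n" for j q l
    using that unfolding M mm_add_left mm_scale_left by (simp add: mm_e_left)
  have "(\<Sum>j\<in>UNIV. of_real (vec_nth v j) * mm M (f j) p k) = mm M (comb v) p k"
    by (simp add: comb_def[abs_def] mm_sum_right mm_scale_right)
  also have "\<dots> = of_real a * comb v p k + of_real ((norm v)\<^sup>2) * e p k"
    using pk by (simp add: M mm_add_left mm_scale_left mm_e_left comb_square)
  finally have 1: "(\<Sum>j\<in>UNIV. of_real (vec_nth v j) * mm M (f j) p k)
    = of_real a * comb v p k + of_real ((norm v)\<^sup>2) * e p k" .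
  have "mm (f j) (mm M (f j)) p k = of_real a * e p k + mm (f j) (mm (comb v) (f j)) p k" for j
  proof -
    have "mm (f j) (mm M (f j)) p k = mm (f j) (\<lambda>q l. of_real a * f j q l + mm (comb v) (f j) q l) p k"
      by (rule mm_cong_right) (rule MF)
    then show ?thesis using pk by (simp add: mm_add_right mm_scale_right mm_self)
  qed
  then have 2: "(\<Sum>j\<in>UNIV. mm (f j) (mm M (f j)) p k)
      = of_nat CARD('d) * of_real a * e p k + (2 - of_nat CARD('d)) * comb v p k"
    by (simp add: sum.distrib comb_conjugate[OF pk])
  have ss: "s\<^sup>2 = (norm v)\<^sup>2 + C\<^sup>2 * (real CARD('d) - 1)\<^sup>2" unfolding s_def by simp
  have q: "(norm v)\<^sup>2 + C * (real CARD('d) * a) = (s + C) * a" "a + C * (2 - real CARD('d)) = s + C"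
    using ss by (simp_all add: a_def algebra_simps power2_eq_square)
  have "(\<Sum>j\<in>UNIV. of_real (vec_nth v j) * mm M (f j) p k + of_real C * mm (f j) (mm M (f j)) p k)
      = of_real ((norm v)\<^sup>2 + C * (real CARD('d) * a)) * e p k
        + of_real (a + C * (2 - real CARD('d))) * comb v p k"
    by (simp add: sum.distrib 1 2 flip: sum_distrib_left) (simp add: algebra_simps)
  also have "\<dots> = of_real (s + C) * M p k" unfolding q M by (simp add: algebra_simps)
  finally show ?thesis .
qed

text \<open>A vanishing matrix would make \<open>comb v\<close> the scalar \<open>- a\<close>, but
  \<open>comb v\<close> squares to \<open>(norm v)\<^sup>2\<close>, which is less than
  \<open>a\<^sup>2\<close>.\<close>

lemma eigenvector_nonzero:
  fixes v :: "real^'d" and a :: real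
  assumes n: "n > 0" and a: "norm v < a"
  shows "0 < (\<Sum>k<n. \<Sum>p<n. (cmod (of_real a * e p k + comb v p k))\<^sup>2)"
proof (rule ccontr)
  let ?M = "\<lambda>p k. of_real a * e p k + comb v p k"
  assume "\<not> ?thesis"
  then have "(\<Sum>k<n. \<Sum>p<n. (cmod (?M p k))\<^sup>2) = 0"
    by (smt (verit) sum_nonneg zero_le_power2)
  then have 0: "?M p k = 0" if "p < n" "k < n" for p k
    using that by (simp add: sum_nonneg_eq_0_iff sum_nonneg)
  have c: "comb v p k = - of_real a * e p k" if "p < n" "k < n" for p k
    using 0[OF that] by (simp add: add_eq_0_iff)
  have "mm (comb v) (comb v) 0 0 = mm (\<lambda>p k. - of_real a * e p k) (\<lambda>p k. - of_real a * e p k) 0 0"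
    unfolding mm_def using n c by (intro sum.cong) simp_all
  also have "\<dots> = of_real (a\<^sup>2)"
    unfolding mm_scale_left mm_scale_right mm_e_left[OF n] by (simp add: e_def power2_eq_square)
  finally have "complex_of_real ((norm v)\<^sup>2) = of_real (a\<^sup>2)"
    using n by (simp add: comb_square) (simp add: e_def)
  then have "(norm v)\<^sup>2 = a\<^sup>2" by (simp only: of_real_eq_iff)
  moreover have "(norm v)\<^sup>2 < a\<^sup>2" using a by (intro power_strict_mono) simp_all
  ultimately show False by simp
qed

end

section \<open>Clifford sums of commuting self-adjoint operators\<close>

context ips
begin

text \<open>The family \<open>w\<close> is a vector of the \<open>n\<close>-fold sum of
  \<open>H\<close>, and \<open>D\<close> is its image under the sum of the
  \<open>f j \<otimes> A j\<close>. Anticommuting coefficients against commuting operators cancel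
  the mixed terms, so the squared norm of \<open>D\<close> is that of all the
  \<open>A j (w l)\<close> together.\<close>

lemma clifford_bound:
  fixes A :: "'d::finite \<Rightarrow> 'i hop" and f :: "'d \<Rightarrow> nat \<Rightarrow> nat \<Rightarrow> complex"
  assumes cl: "clifford n f" and A: "\<And>j. A j \<in> bounded_ops H H"
    and sa: "\<And>j u v. u \<in> car H \<Longrightarrow> v \<in> car H \<Longrightarrow> ip H (A j u) v = ip H u (A j v)"
    and comm: "\<And>i j u. u \<in> car H \<Longrightarrow> A i (A j u) = A j (A i u)"
    and C: "C > 0" "\<And>u. u \<in> car H \<Longrightarrow> (\<Sum>j\<in>UNIV. (hnorm H (A j u))\<^sup>2) \<le> C\<^sup>2 * (hnorm H u)\<^sup>2"
    and w: "\<And>k. w k \<in> car H"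
  shows "Re (\<Sum>k<n. \<Sum>j\<in>UNIV. \<Sum>l<n. f j k l * ip H (A j (w l)) (w k)) \<le> C * (\<Sum>k<n. (hnorm H (w k))\<^sup>2)"
proof -
  interpret clifford n f by (rule cl)
  note m = op_car[OF A w]
  define D where "D k = (\<Sum>j\<in>UNIV. \<Sum>l<n. scaleC (f j k l) (A j (w l)))" for k
  have D: "D k \<in> car H" for k unfolding D_def by (intro car_sum car_scaleC m)
  define G where "G i j l k = ip H (A j (A i (w l))) (w k)" for i j l k
  have Gsym: "G i j l k = G j i l k" for i j l k by (simp add: G_def comm[OF w])
  \<comment> \<open>The contribution of the pair \<open>(i, j)\<close> to the squared norm of
    \<open>D\<close>. For \<open>i \<noteq> j\<close> it is the negative of \<open>h j i\<close>,
    because \<open>G\<close> is symmetric and the matrix products change sign.\<close>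
  define h where "h i j = (\<Sum>l<n. \<Sum>k<n. mm (f j) (f i) k l * G i j l k)" for i j
  have ipD: "ip H (D k) u = (\<Sum>j\<in>UNIV. \<Sum>l<n. f j k l * ip H (A j (w l)) u)" if u: "u \<in> car H" for k u
    unfolding D_def using m u by (simp add: ip_sum_left ip_scaleC_left)
  have ipD2: "ip H u (D k) = (\<Sum>j\<in>UNIV. \<Sum>l<n. f j k l * ip H u (A j (w l)))" if u: "u \<in> car H" for k u
    unfolding D_def using m u by (simp add: ip_sum_right ip_scaleC_right real)
  have "(\<Sum>q<n. ip H (D q) (D q)) = (\<Sum>q<n. \<Sum>i\<in>UNIV. \<Sum>l<n. \<Sum>j\<in>UNIV. \<Sum>k<n. f i q l * (f j q k * ip H (A i (w l)) (A j (w k))))"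
    by (simp add: ipD[OF D] ipD2[OF m] sum_distrib_left)
  also have "\<dots> = (\<Sum>i\<in>UNIV. \<Sum>q<n. \<Sum>l<n. \<Sum>j\<in>UNIV. \<Sum>k<n. f i q l * (f j q k * ip H (A i (w l)) (A j (w k))))"
    by (rule sum.swap)
  also have "\<dots> = (\<Sum>i\<in>UNIV. \<Sum>l<n. \<Sum>q<n. \<Sum>j\<in>UNIV. \<Sum>k<n. f i q l * (f j q k * ip H (A i (w l)) (A j (w k))))"
    by (rule sum.cong[OF refl], rule sum.swap)
  also have "\<dots> = (\<Sum>i\<in>UNIV. \<Sum>l<n. \<Sum>j\<in>UNIV. \<Sum>q<n. \<Sum>k<n. f i q l * (f j q k * ip H (A i (w l)) (A j (w k))))"
    by (rule sum.cong[OF refl], rule sum.cong[OF refl], rule sum.swap)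
  also have "\<dots> = (\<Sum>i\<in>UNIV. \<Sum>l<n. \<Sum>j\<in>UNIV. \<Sum>k<n. \<Sum>q<n. f i q l * (f j q k * ip H (A i (w l)) (A j (w k))))"
    by (rule sum.cong[OF refl], rule sum.cong[OF refl], rule sum.cong[OF refl], rule sum.swap)
  also have "\<dots> = (\<Sum>i\<in>UNIV. \<Sum>l<n. \<Sum>j\<in>UNIV. \<Sum>k<n. mm (f j) (f i) k l * G i j l k)"
  proof (intro sum.cong refl)
    fix i j l k assume lk: "l \<in> {..<n}" "k \<in> {..<n}"
    have "f i q l * (f j q k * ip H (A i (w l)) (A j (w k))) = f j k q * f i q l * G i j l k" if "q < n" for q
      using sym[of q k j] lk that by (simp add: G_def sa[OF m w])
    then show "(\<Sum>q<n. f i q l * (f j q k * ip H (A i (w l)) (A j (w k)))) = mm (f j) (f i) k l * G i j l k"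
      unfolding mm_def sum_distrib_right by (intro sum.cong refl) simp
  qed
  also have "\<dots> = (\<Sum>i\<in>UNIV. \<Sum>j\<in>UNIV. h i j)"
    unfolding h_def by (rule sum.cong[OF refl], rule sum.swap)
  finally have T: "(\<Sum>q<n. ip H (D q) (D q)) = (\<Sum>i\<in>UNIV. \<Sum>j\<in>UNIV. h i j)" .
  have "2 * (\<Sum>i\<in>UNIV. \<Sum>j\<in>UNIV. h i j) = (\<Sum>i\<in>UNIV. \<Sum>j\<in>UNIV. h i j) + (\<Sum>j\<in>UNIV. \<Sum>i\<in>UNIV. h i j)"
    using sum.swap[of h UNIV UNIV] by simp
  also have "\<dots> = (\<Sum>i\<in>UNIV. \<Sum>j\<in>UNIV. h i j + h j i)" by (simp add: sum.distrib)
  also have "\<dots> = (\<Sum>i\<in>UNIV. \<Sum>j\<in>UNIV. if i = j then \<Sum>l<n. 2 * G i i l l else 0)"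
  proof (intro sum.cong refl)
    fix i j
    have "h i j + h j i = (\<Sum>l<n. \<Sum>k<n. (mm (f j) (f i) k l + mm (f i) (f j) k l) * G i j l k)"
      unfolding h_def sum.distrib[symmetric] distrib_right by (simp only: Gsym[of j i])
    also have "\<dots> = (\<Sum>l<n. \<Sum>k<n. if k = l then (if i = j then 2 * G i j l l else 0) else 0)"
      by (intro sum.cong refl) (auto simp: mm_anticommute[of _ _ j i] e_def)
    finally show "h i j + h j i = (if i = j then \<Sum>l<n. 2 * G i i l l else 0)" by simp
  qed
  also have "\<dots> = 2 * (\<Sum>i\<in>UNIV. \<Sum>l<n. G i i l l)" by (simp add: sum_distrib_left)
  finally have "(\<Sum>q<n. ip H (D q) (D q)) = (\<Sum>i\<in>UNIV. \<Sum>l<n. G i i l l)" unfolding T by simp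
  also have "\<dots> = (\<Sum>l<n. \<Sum>i\<in>UNIV. of_real ((hnorm H (A i (w l)))\<^sup>2))"
    by (subst sum.swap) (simp add: G_def sa[OF m w] ip_self[OF m])
  finally have "complex_of_real (\<Sum>q<n. (hnorm H (D q))\<^sup>2) = of_real (\<Sum>l<n. \<Sum>i\<in>UNIV. (hnorm H (A i (w l)))\<^sup>2)"
    by (simp add: ip_self[OF D])
  then have "(\<Sum>q<n. (hnorm H (D q))\<^sup>2) = (\<Sum>l<n. \<Sum>i\<in>UNIV. (hnorm H (A i (w l)))\<^sup>2)"
    by (simp only: of_real_eq_iff)
  also have "\<dots> \<le> (\<Sum>l<n. C\<^sup>2 * (hnorm H (w l))\<^sup>2)" by (intro sum_mono C(2) w)
  finally have DD: "(\<Sum>q<n. (hnorm H (D q))\<^sup>2) \<le> C\<^sup>2 * (\<Sum>l<n. (hnorm H (w l))\<^sup>2)"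
    by (simp add: sum_distrib_left)
  \<comment> \<open>The weights \<open>1 / C\<close> and \<open>C\<close> are balanced so that both
    halves sum to the same bound.\<close>
  have amgm: "Re (ip H (D k) (w k)) \<le> ((hnorm H (D k))\<^sup>2 / C + C * (hnorm H (w k))\<^sup>2) / 2" for k
  proof -
    have "Re (ip H (D k) (w k)) \<le> hnorm H (D k) * hnorm H (w k)"
      by (rule order_trans[OF complex_Re_le_cmod cauchy_schwarz[OF D w]])
    moreover have "0 \<le> (hnorm H (D k) - C * hnorm H (w k))\<^sup>2 / C" using C(1) by simp
    then have "2 * (hnorm H (D k) * hnorm H (w k)) \<le> (hnorm H (D k))\<^sup>2 / C + C * (hnorm H (w k))\<^sup>2"
      using C(1) by (simp add: power2_eq_square field_simps)
    ultimately show ?thesis by simp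
  qed
  have "Re (\<Sum>k<n. ip H (D k) (w k)) \<le> (\<Sum>k<n. ((hnorm H (D k))\<^sup>2 / C + C * (hnorm H (w k))\<^sup>2) / 2)"
    unfolding Re_sum by (intro sum_mono amgm)
  also have "\<dots> = ((\<Sum>k<n. (hnorm H (D k))\<^sup>2) / C + C * (\<Sum>k<n. (hnorm H (w k))\<^sup>2)) / 2"
    by (simp add: sum.distrib sum_divide_distrib sum_distrib_left add_divide_distrib)
  also have "\<dots> \<le> (C\<^sup>2 * (\<Sum>k<n. (hnorm H (w k))\<^sup>2) / C + C * (\<Sum>k<n. (hnorm H (w k))\<^sup>2)) / 2"
    using DD C(1) by (intro divide_right_mono add_right_mono) simp_all
  also have "\<dots> = C * (\<Sum>k<n. (hnorm H (w k))\<^sup>2)" using C(1) by (simp add: power2_eq_square)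
  finally show ?thesis by (simp add: ipD[OF w])
qed

end

section \<open>Block form and anticommutation of the matrices \<open>Fmat\<close>\<close>

lemma div_mod_two_blocks:
  fixes i n :: nat
  assumes "i < n + n"
  shows "i < n \<Longrightarrow> i div n = 0" "i < n \<Longrightarrow> i mod n = i"
    "\<not> i < n \<Longrightarrow> i div n = 1" "\<not> i < n \<Longrightarrow> i mod n = i - n"
  using assms by (simp_all add: div_if mod_if)

lemma kron_two_blocks:
  assumes A: "A \<in> carrier_mat n n"
  shows "kron (mat_of_rows_list 2 [[a, b], [c, d]]) A
    = four_block_mat (a \<cdot>\<^sub>m A) (b \<cdot>\<^sub>m A) (c \<cdot>\<^sub>m A) (d \<cdot>\<^sub>m A)" (is "?L = ?R")
proof (rule eq_matI)
  fix i j assume "i < dim_row ?R" "j < dim_col ?R"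
  then have ij: "i < n + n" "j < n + n" using A by simp_all
  note i = div_mod_two_blocks[OF ij(1)] and j = div_mod_two_blocks[OF ij(2)]
  have "?L $$ (i, j) = mat_of_rows_list 2 [[a, b], [c, d]] $$ (i div n, j div n) * A $$ (i mod n, j mod n)"
    using A ij by (simp add: kron_def mat_of_rows_list_def)
  moreover have "?R $$ (i, j) = (if i < n then if j < n then a * A $$ (i, j) else b * A $$ (i, j - n)
      else if j < n then c * A $$ (i - n, j) else d * A $$ (i - n, j - n))"
    using A ij by auto
  ultimately show "?L $$ (i, j) = ?R $$ (i, j)"
    by (cases "i < n"; cases "j < n") (simp_all only: i j if_True if_False not_False_eq_True, simp_all add: mat_of_rows_list_def)
qed (use A in \<open>simp_all add: kron_def mat_of_rows_list_def\<close>)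

lemma kron_offdiag:
  assumes "A \<in> carrier_mat n n"
  shows "kron (mat_of_rows_list 2 [[0, 1], [1, 0]]) A = four_block_mat (0\<^sub>m n n) A A (0\<^sub>m n n)"
proof -
  have "0 \<cdot>\<^sub>m A = 0\<^sub>m n n" "1 \<cdot>\<^sub>m A = A" using assms by (auto intro!: eq_matI)
  then show ?thesis using kron_two_blocks[OF assms, of 0 1 1 0] by simp
qed

lemma kron_diag:
  "kron (mat_of_rows_list 2 [[1, 0], [0, -1]]) (1\<^sub>m n)
    = four_block_mat (1\<^sub>m n) (0\<^sub>m n n) (0\<^sub>m n n) (- 1\<^sub>m n)"
proof -
  have "0 \<cdot>\<^sub>m 1\<^sub>m n = (0\<^sub>m n n :: complex mat)" "1 \<cdot>\<^sub>m 1\<^sub>m n = (1\<^sub>m n :: complex mat)"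
    "- 1 \<cdot>\<^sub>m 1\<^sub>m n = (- 1\<^sub>m n :: complex mat)" by (auto intro!: eq_matI)
  then show ?thesis using kron_two_blocks[of "1\<^sub>m n" n 1 0 0 "- 1"] by simp
qed

lemma Fmat_carrier: "Fmat (Suc m) j \<in> carrier_mat (2 ^ m) (2 ^ m)"
proof (induction m)
  case (Suc m)
  then show ?case
    by (auto simp: kron_offdiag[OF Suc] kron_diag mult_2)
qed simp

lemma Fmat_step:
  "j \<le> Suc m \<Longrightarrow> Fmat (Suc (Suc m)) j = four_block_mat (0\<^sub>m (2 ^ m) (2 ^ m)) (Fmat (Suc m) j)
    (Fmat (Suc m) j) (0\<^sub>m (2 ^ m) (2 ^ m))"
  "\<not> j \<le> Suc m \<Longrightarrow> Fmat (Suc (Suc m)) j = four_block_mat (1\<^sub>m (2 ^ m)) (0\<^sub>m (2 ^ m) (2 ^ m))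
    (0\<^sub>m (2 ^ m) (2 ^ m)) (- 1\<^sub>m (2 ^ m))"
  by (simp_all add: kron_offdiag[OF Fmat_carrier] kron_diag)

lemma Fmat_real: "p < 2 ^ m \<Longrightarrow> k < 2 ^ m \<Longrightarrow> cnj (Fmat (Suc m) j $$ (p, k)) = Fmat (Suc m) j $$ (p, k)"
proof (induction m arbitrary: p k)
  case (Suc m)
  then show ?case using Fmat_carrier[of m j]
    by (cases "j \<le> Suc m") (auto simp: Fmat_step simp del: Fmat.simps)
qed simp

lemma Fmat_symmetric: "p < 2 ^ m \<Longrightarrow> k < 2 ^ m \<Longrightarrow> Fmat (Suc m) j $$ (p, k) = Fmat (Suc m) j $$ (k, p)"
proof (induction m arbitrary: p k)
  case (Suc m)
  then show ?case using Fmat_carrier[of m j]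
    by (cases "j \<le> Suc m") (auto simp: Fmat_step simp del: Fmat.simps)
qed simp

text \<open>Off-diagonal matrices with equal blocks multiply to block-diagonal ones carrying the
  smaller products, which is the induction. The last generator is block diagonal with blocks
  \<open>1\<close> and \<open>- 1\<close>; it squares to \<open>1\<close> and anticommutes with
  every such off-diagonal matrix.\<close>

lemma Fmat_anticommute:
  "1 \<le> i \<Longrightarrow> i \<le> Suc m \<Longrightarrow> 1 \<le> j \<Longrightarrow> j \<le> Suc m \<Longrightarrow>
    Fmat (Suc m) i * Fmat (Suc m) j + Fmat (Suc m) j * Fmat (Suc m) i
      = (if i = j then 2 else 0) \<cdot>\<^sub>m 1\<^sub>m (2 ^ m)"
proof (induction m)
  case 0
  then have "i = 1" "j = 1" by simp_all
  then show ?case by (intro eq_matI) (auto simp: scalar_prod_def)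
next
  case (Suc m)
  let ?n = "2 ^ m :: nat"
  let ?O = "0\<^sub>m ?n ?n :: complex mat"
  have block: "four_block_mat (c \<cdot>\<^sub>m 1\<^sub>m ?n) ?O ?O (c \<cdot>\<^sub>m 1\<^sub>m ?n) = c \<cdot>\<^sub>m 1\<^sub>m (2 ^ Suc m)" for c
    by (rule eq_matI) auto
  have prod: "four_block_mat A B C D * four_block_mat A' B' C' D'
      = four_block_mat (A * A' + B * C') (A * B' + B * D') (C * A' + D * C') (C * B' + D * D')"
    if "A \<in> carrier_mat ?n ?n" "B \<in> carrier_mat ?n ?n" "C \<in> carrier_mat ?n ?n" "D \<in> carrier_mat ?n ?n"
      "A' \<in> carrier_mat ?n ?n" "B' \<in> carrier_mat ?n ?n" "C' \<in> carrier_mat ?n ?n" "D' \<in> carrier_mat ?n ?n"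
    for A B C D A' B' C' D' :: "complex mat"
    by (rule mult_four_block_mat[OF that])
  have add: "four_block_mat A B C D + four_block_mat A' B' C' D'
      = four_block_mat (A + A') (B + B') (C + C') (D + D')"
    if "A \<in> carrier_mat ?n ?n" "B \<in> carrier_mat ?n ?n" "C \<in> carrier_mat ?n ?n" "D \<in> carrier_mat ?n ?n"
      "A' \<in> carrier_mat ?n ?n" "B' \<in> carrier_mat ?n ?n" "C' \<in> carrier_mat ?n ?n" "D' \<in> carrier_mat ?n ?n"
    for A B C D A' B' C' D' :: "complex mat"
    by (rule add_four_block_mat[OF that])
  have F: "Fmat (Suc m) k \<in> carrier_mat ?n ?n" for k by (rule Fmat_carrier)
  note [simp del] = Fmat.simps
  have neg0: "- ?O = ?O" by (auto intro!: eq_matI)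
  consider "i \<le> Suc m" "j \<le> Suc m" | "i = Suc (Suc m)" "j \<le> Suc m" | "i \<le> Suc m" "j = Suc (Suc m)"
    | "i = Suc (Suc m)" "j = Suc (Suc m)" using Suc.prems by linarith
  then show ?case
  proof cases
    case 1
    have "Fmat (Suc (Suc m)) i * Fmat (Suc (Suc m)) j + Fmat (Suc (Suc m)) j * Fmat (Suc (Suc m)) i
        = four_block_mat (Fmat (Suc m) i * Fmat (Suc m) j + Fmat (Suc m) j * Fmat (Suc m) i) ?O ?O
          (Fmat (Suc m) i * Fmat (Suc m) j + Fmat (Suc m) j * Fmat (Suc m) i)"
      using 1 F[of i] F[of j] by (simp add: Fmat_step prod add)
    then show ?thesis using 1 Suc by (simp add: block)
  next
    case 2
    have "- Fmat (Suc m) j + Fmat (Suc m) j = ?O" "Fmat (Suc m) j + - Fmat (Suc m) j = ?O"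
      using F[of j] by (auto intro!: eq_matI)
    then have "Fmat (Suc (Suc m)) i * Fmat (Suc (Suc m)) j + Fmat (Suc (Suc m)) j * Fmat (Suc (Suc m)) i
        = four_block_mat ?O ?O ?O ?O"
      using 2 F[of j] by (simp add: Fmat_step prod add neg0)
    then show ?thesis using 2 by (simp add: block[of 0, symmetric])
       (rule eq_matI; simp)
  next
    case 3
    have "- Fmat (Suc m) i + Fmat (Suc m) i = ?O" "Fmat (Suc m) i + - Fmat (Suc m) i = ?O"
      using F[of i] by (auto intro!: eq_matI)
    then have "Fmat (Suc (Suc m)) i * Fmat (Suc (Suc m)) j + Fmat (Suc (Suc m)) j * Fmat (Suc (Suc m)) i
        = four_block_mat ?O ?O ?O ?O"
      using 3 F[of i] by (simp add: Fmat_step prod add neg0)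
    then show ?thesis using 3 by (simp add: block[of 0, symmetric])
       (rule eq_matI; simp)
  next
    case 4
    then show ?thesis by (simp add: Fmat_step prod neg0) (rule eq_matI; simp)
  qed
qed

lemma clifford_Fmat:
  fixes idx :: "'d::finite \<Rightarrow> nat"
  assumes "bij_betw idx UNIV {1..CARD('d)}"
  shows "clifford (2 ^ (CARD('d) - 1)) (\<lambda>j p k. if p < 2 ^ (CARD('d) - 1) \<and> k < 2 ^ (CARD('d) - 1)
    then Fmat CARD('d) (idx j) $$ (p, k) else 0)"
proof -
  obtain m where m: "CARD('d) = Suc m" by (cases "CARD('d)") simp_all
  have idx: "1 \<le> idx j" "idx j \<le> Suc m" for j
    using bij_betwE[OF assms] m by auto
  have inj: "idx i = idx j \<longleftrightarrow> i = j" for i j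
    using bij_betw_imp_inj_on[OF assms] by (simp add: inj_eq)
  show ?thesis
    unfolding m
  proof (unfold_locales, goal_cases)
    case (1 j p k)
    then show ?case by (simp add: Fmat_real del: Fmat.simps)
  next
    case (2 p k j)
    then show ?case by (simp add: Fmat_symmetric[of p m k] del: Fmat.simps)
  next
    case (3 p k i j)
    let ?A = "Fmat (Suc m) (idx i)" and ?B = "Fmat (Suc m) (idx j)"
    have c: "?A \<in> carrier_mat (2 ^ m) (2 ^ m)" "?B \<in> carrier_mat (2 ^ m) (2 ^ m)"
      by (rule Fmat_carrier)+
    have pk: "p < 2 ^ m" "k < 2 ^ m" using 3 by simp_all
    have "(?A * ?B + ?B * ?A) $$ (p, k) = (\<Sum>q<2 ^ m. ?A $$ (p, q) * ?B $$ (q, k)) + (\<Sum>q<2 ^ m. ?B $$ (p, q) * ?A $$ (q, k))"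
      using c pk by (auto simp: scalar_prod_def atLeast0LessThan simp del: Fmat.simps)
    moreover have eq: "?A * ?B + ?B * ?A = (if idx i = idx j then 2 else 0) \<cdot>\<^sub>m 1\<^sub>m (2 ^ m)"
      by (rule Fmat_anticommute[OF idx(1,2)[of i] idx(1,2)[of j]])
    have "(?A * ?B + ?B * ?A) $$ (p, k) = (if i = j \<and> p = k then 2 else 0)"
      unfolding eq using pk inj[of i j] by simp
    ultimately show ?case using pk by (simp del: Fmat.simps)
  qed
qed

section \<open>Dilations of Clifford tuples\<close>

lemma cspace_car: "u \<in> car (cspace n) \<longleftrightarrow> (\<forall>i\<ge>n. u i = 0)"
  by (simp add: cspace_def)

lemma cspace_ip: "ip (cspace n) u v = (\<Sum>i<n. u i * cnj (v i))"
  by (simp add: cspace_def)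

lemma cspace_ip_self: "ip (cspace n) u u = complex_of_real (\<Sum>i<n. (cmod (u i))\<^sup>2)"
  by (simp add: cspace_ip complex_norm_square del: of_real_power)

lemma inner_product_space_cspace: "inner_product_space (cspace n)"
  unfolding inner_product_space_def
proof (intro conjI ballI allI impI)
  fix u assume u: "u \<in> car (cspace n)" and "ip (cspace n) u u = 0"
  then have "(\<Sum>i<n. (cmod (u i))\<^sup>2) = 0" by (simp only: cspace_ip_self of_real_eq_0_iff)
  then have "u i = 0" if "i < n" for i using that by (simp add: sum_nonneg_eq_0_iff)
  then have "u i = 0" for i using u by (cases "i < n") (simp_all add: cspace_car)
  then show "u = 0" by (simp add: fun_eq_iff)
next
  fix u assume "u \<in> car (cspace n)"
  show "0 \<le> Re (ip (cspace n) u u)" by (simp add: cspace_ip_self sum_nonneg)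
qed (simp_all add: cspace_car cspace_ip scaleC_def distrib_right sum.distrib sum_distrib_left mult.assoc,
     simp add: mult.commute)

interpretation cspace: ips "cspace n" for n
  by unfold_locales (rule inner_product_space_cspace)

lemma hnorm_cspace: "hnorm (cspace n) u = sqrt (\<Sum>i<n. (cmod (u i))\<^sup>2)"
  by (simp add: hnorm_def cspace_ip_self)

text \<open>Makes operators of the index functions used in \<open>clifford\<close>. The rules below
  let identities in the generated algebra be checked entry by entry.\<close>

definition ent :: "nat \<Rightarrow> (nat \<Rightarrow> nat \<Rightarrow> complex) \<Rightarrow> nat hop" where
  "ent n B = mat_op (Matrix.mat n n (\<lambda>(p, k). B p k))"

lemma ent_apply:
  "ent n B u = (if u \<in> car (cspace n) then (\<lambda>i. if i < n then \<Sum>k<n. B i k * u k else 0) else 0)"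
  by (auto simp: ent_def mat_op_def fun_eq_iff cong: if_cong)

lemma mat_op_ent:
  assumes "A \<in> carrier_mat n n"
  shows "mat_op A = ent n (\<lambda>p k. A $$ (p, k))"
  unfolding ent_def by (rule arg_cong[of _ _ mat_op]) (use assms in \<open>auto intro!: eq_matI\<close>)

lemma ent_cong: "(\<And>p k. p < n \<Longrightarrow> k < n \<Longrightarrow> B p k = B' p k) \<Longrightarrow> ent n B = ent n B'"
  by (auto simp: ent_apply fun_eq_iff intro!: sum.cong)

lemma ent_bop: "ent n B \<in> bounded_ops (cspace n) (cspace n)"
proof (rule cspace.bopI)
  let ?b = "\<Sum>i<n. \<Sum>k<n. cmod (B i k)"
  fix u assume u: "u \<in> car (cspace n)"
  have le: "cmod (u k) \<le> hnorm (cspace n) u" if "k < n" for k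
    unfolding hnorm_cspace using that
    by (intro real_le_rsqrt) (simp add: member_le_sum[of k _ "\<lambda>i. (cmod (u i))\<^sup>2"])
  have "hnorm (cspace n) (ent n B u) \<le> (\<Sum>i<n. cmod (ent n B u i))"
    using L2_set_le_sum[of "{..<n}" "\<lambda>i. cmod (ent n B u i)"] by (simp add: hnorm_cspace L2_set_def)
  also have "\<dots> \<le> (\<Sum>i<n. \<Sum>k<n. cmod (B i k) * hnorm (cspace n) u)"
  proof (rule sum_mono)
    fix i assume i: "i \<in> {..<n}"
    have "cmod (\<Sum>k<n. B i k * u k) \<le> (\<Sum>k<n. cmod (B i k * u k))" by (rule norm_sum)
    also have "\<dots> \<le> (\<Sum>k<n. cmod (B i k) * hnorm (cspace n) u)"
      unfolding norm_mult using le by (intro sum_mono mult_left_mono) simp_all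
    finally show "cmod (ent n B u i) \<le> (\<Sum>k<n. cmod (B i k) * hnorm (cspace n) u)"
      using i u by (simp add: ent_apply)
  qed
  also have "\<dots> = ?b * hnorm (cspace n) u" by (simp add: sum_distrib_right)
  finally show "hnorm (cspace n) (ent n B u) \<le> ?b * hnorm (cspace n) u" .
qed (auto simp: ent_apply cspace_car scaleC_def fun_eq_iff distrib_left sum.distrib sum_distrib_left
    mult.left_commute)

lemma ent_add: "ent n (\<lambda>p k. A p k + B p k) = ent n A + ent n B"
  by (rule ext) (auto simp: ent_apply fun_eq_iff distrib_right sum.distrib)

lemma ent_scale: "ent n (\<lambda>p k. c * B p k) = scale_op c (ent n B)"
  by (rule ext) (auto simp: ent_apply fun_eq_iff scale_op_def scaleC_def sum_distrib_left mult.assoc)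

lemma ent_sum: "ent n (\<lambda>p k. \<Sum>i\<in>I. B i p k) = (\<Sum>i\<in>I. ent n (B i))"
proof (intro ext)
  fix u a
  have "(\<Sum>k<n. (\<Sum>i\<in>I. B i a k) * u k) = (\<Sum>i\<in>I. \<Sum>k<n. B i a k * u k)"
    unfolding sum_distrib_right by (rule sum.swap)
  then show "ent n (\<lambda>p k. \<Sum>i\<in>I. B i p k) u a = (\<Sum>i\<in>I. ent n (B i)) u a"
    by (simp add: sum_apply ent_apply)
qed

lemma ent_comp: "ent n A \<circ> ent n B = ent n (\<lambda>p k. \<Sum>q<n. A p q * B q k)"
proof (rule cspace.op_eqI[of _ n])
  show "ent n A \<circ> ent n B \<in> bounded_ops (cspace n) (cspace n)"
    by (intro cspace.bop_comp ent_bop)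
  fix u assume u: "u \<in> car (cspace n)"
  have c: "(\<lambda>i. if i < n then \<Sum>k<n. B i k * u k else 0) \<in> car (cspace n)" by (simp add: cspace_car)
  show "(ent n A \<circ> ent n B) u = ent n (\<lambda>p k. \<Sum>q<n. A p q * B q k) u"
  proof
    fix i
    have "(\<Sum>q<n. A i q * (\<Sum>k<n. B q k * u k)) = (\<Sum>k<n. (\<Sum>q<n. A i q * B q k) * u k)"
      unfolding sum_distrib_left sum_distrib_right by (subst sum.swap) (simp add: mult.assoc)
    then show "(ent n A \<circ> ent n B) u i = ent n (\<lambda>p k. \<Sum>q<n. A p q * B q k) u i"
      using u c by (simp add: ent_apply)
  qed
qed (rule ent_bop)

lemma ent_id: "ent n (\<lambda>p k. if p = k then 1 else 0) = id_op (cspace n)"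
proof (rule cspace.op_eqI[of _ n])
  fix u assume u: "u \<in> car (cspace n)"
  show "ent n (\<lambda>p k. if p = k then 1 else 0) u = id_op (cspace n) u"
  proof
    fix i
    have "(\<Sum>k<n. (if i = k then 1 else 0) * u k) = (\<Sum>k<n. if i = k then u k else 0)"
      by (intro sum.cong refl) (simp add: if_distrib)
    then show "ent n (\<lambda>p k. if p = k then 1 else 0) u i = id_op (cspace n) u i"
      using u by (simp add: ent_apply id_op_def cspace_car)
  qed
qed (simp_all add: ent_bop)

lemma ent_selfadjoint:
  assumes "\<And>p k. p < n \<Longrightarrow> k < n \<Longrightarrow> cnj (B p k) = B k p"
  shows "is_adjoint (cspace n) (cspace n) (ent n B) (ent n B)"
  unfolding is_adjoint_def
proof (intro conjI ballI ent_bop)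
  fix u v assume uv: "u \<in> car (cspace n)" "v \<in> car (cspace n)"
  have "ip (cspace n) (ent n B u) v = (\<Sum>p<n. (\<Sum>k<n. B p k * u k) * cnj (v p))"
    unfolding cspace_ip by (intro sum.cong refl) (simp add: ent_apply uv)
  also have "\<dots> = (\<Sum>k<n. \<Sum>p<n. B p k * u k * cnj (v p))"
    unfolding sum_distrib_right by (rule sum.swap)
  also have "\<dots> = (\<Sum>k<n. u k * cnj (\<Sum>p<n. B k p * v p))"
    unfolding cnj_sum sum_distrib_left
    by (intro sum.cong refl) (simp add: assms mult_ac)
  also have "\<dots> = ip (cspace n) u (ent n B v)"
    unfolding cspace_ip by (intro sum.cong refl) (simp add: ent_apply uv)
  finally show "ip (cspace n) (ent n B u) v = ip (cspace n) u (ent n B v)" .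
qed

section \<open>Generated algebras, functionals and self-adjoint tuples\<close>

lemma cstar_subalgebraD:
  assumes "cstar_subalgebra H B"
  shows "id_op H \<in> B" "S \<in> B \<Longrightarrow> T \<in> B \<Longrightarrow> S + T \<in> B" "T \<in> B \<Longrightarrow> scale_op c T \<in> B"
    "S \<in> B \<Longrightarrow> T \<in> B \<Longrightarrow> S \<circ> T \<in> B"
proof -
  note * = assms[unfolded cstar_subalgebra_def]
  show "id_op H \<in> B" by (rule *[THEN conjunct2, THEN conjunct1])
  show "S + T \<in> B" if "S \<in> B" "T \<in> B"
    by (rule *[THEN conjunct2, THEN conjunct2, THEN conjunct1, rule_format, OF that])
  show "scale_op c T \<in> B" if "T \<in> B"
    by (rule *[THEN conjunct2, THEN conjunct2, THEN conjunct2, THEN conjunct1, rule_format, OF that])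
  show "S \<circ> T \<in> B" if "S \<in> B" "T \<in> B"
    by (rule *[THEN conjunct2, THEN conjunct2, THEN conjunct2, THEN conjunct2, THEN conjunct1,
        rule_format, OF that])
qed

lemma cstar_genI:
  "(\<And>B. cstar_subalgebra H B \<Longrightarrow> range A \<subseteq> B \<Longrightarrow> T \<in> B) \<Longrightarrow> T \<in> cstar_gen H A"
  by (simp add: cstar_gen_def)

lemma cstar_genD:
  "T \<in> cstar_gen H A \<Longrightarrow> cstar_subalgebra H B \<Longrightarrow> range A \<subseteq> B \<Longrightarrow> T \<in> B"
  by (simp add: cstar_gen_def)

lemma cstar_gen_id: "id_op H \<in> cstar_gen H A"
  by (rule cstar_genI) (rule cstar_subalgebraD(1))

lemma cstar_gen_generator: "A j \<in> cstar_gen H A"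
  by (rule cstar_genI) (erule range_subsetD)

lemma cstar_gen_add: "S \<in> cstar_gen H A \<Longrightarrow> T \<in> cstar_gen H A \<Longrightarrow> S + T \<in> cstar_gen H A"
  by (rule cstar_genI) (rule cstar_subalgebraD(2), assumption, (erule (2) cstar_genD)+)

lemma cstar_gen_scale: "T \<in> cstar_gen H A \<Longrightarrow> scale_op c T \<in> cstar_gen H A"
  by (rule cstar_genI) (rule cstar_subalgebraD(3), assumption, erule (2) cstar_genD)

lemma cstar_gen_comp: "S \<in> cstar_gen H A \<Longrightarrow> T \<in> cstar_gen H A \<Longrightarrow> S \<circ> T \<in> cstar_gen H A"
  by (rule cstar_genI) (rule cstar_subalgebraD(4), assumption, (erule (2) cstar_genD)+)

lemma linear_functional_onD:
  assumes "linear_functional_on B \<phi>"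
  shows "S \<in> B \<Longrightarrow> T \<in> B \<Longrightarrow> \<phi> (S + T) = \<phi> S + \<phi> T" "T \<in> B \<Longrightarrow> \<phi> (scale_op c T) = c * \<phi> T"
  using assms by (simp_all add: linear_functional_on_def)

lemma functional_sum:
  assumes "linear_functional_on (cstar_gen H A) \<phi>" "finite I" "\<And>i. i \<in> I \<Longrightarrow> T i \<in> cstar_gen H A"
  shows "(\<Sum>i\<in>I. scale_op (c i) (T i)) \<in> cstar_gen H A \<and>
    \<phi> (\<Sum>i\<in>I. scale_op (c i) (T i)) = (\<Sum>i\<in>I. c i * \<phi> (T i))"
  using assms(2,3)
proof (induction I rule: finite_induct)
  case empty
  have eq: "0 = scale_op 0 (id_op H)" by (simp add: scale_op_def fun_eq_iff)
  have "(0 :: 'a hop) \<in> cstar_gen H A" "\<phi> 0 = 0"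
    unfolding eq using linear_functional_onD(2)[OF assms(1) cstar_gen_id, of 0]
    by (simp_all add: cstar_gen_scale cstar_gen_id)
  then show ?case by (simp only: sum.empty simp_thms)
next
  case (insert i I)
  have i: "scale_op (c i) (T i) \<in> cstar_gen H A" using insert(4) by (intro cstar_gen_scale) simp
  have I: "(\<Sum>i\<in>I. scale_op (c i) (T i)) \<in> cstar_gen H A"
    "\<phi> (\<Sum>i\<in>I. scale_op (c i) (T i)) = (\<Sum>i\<in>I. c i * \<phi> (T i))" using insert by simp_all
  have "\<phi> (scale_op (c i) (T i) + (\<Sum>i\<in>I. scale_op (c i) (T i)))
      = c i * \<phi> (T i) + (\<Sum>i\<in>I. c i * \<phi> (T i))"
    using linear_functional_onD(1)[OF assms(1) i I(1)] I(2) insert(4)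
      linear_functional_onD(2)[OF assms(1), of "T i" "c i"] by simp
  then show ?case using cstar_gen_add[OF i I(1)] by (simp only: sum.insert[OF insert(1,2)])
qed

lemma sa_tuplesI:
  assumes "\<And>j. X j \<in> carrier_mat n n"
    and "\<And>j p k. p < n \<Longrightarrow> k < n \<Longrightarrow> cnj (X j $$ (k, p)) = X j $$ (p, k)"
  shows "X \<in> sa_tuples n"
  unfolding sa_tuples_def
proof (intro CollectI allI conjI assms(1))
  fix j
  show "mat_adjoint (X j) = X j"
    using assms(1)[of j] assms(2)[of _ _ j]
    by (intro eq_matI) (auto simp: mat_adjoint_def mat_of_rows_def)
qed

lemma sa_tuplesD:
  assumes "X \<in> sa_tuples n"
  shows "X j \<in> carrier_mat n n" "p < n \<Longrightarrow> k < n \<Longrightarrow> cnj (X j $$ (k, p)) = X j $$ (p, k)"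
proof -
  have X: "X j \<in> carrier_mat n n" "mat_adjoint (X j) = X j" using assms by (simp_all add: sa_tuples_def)
  then show "X j \<in> carrier_mat n n" by simp
  assume "p < n" "k < n"
  then have "mat_adjoint (X j) $$ (p, k) = cnj (X j $$ (k, p))"
    using X(1) by (simp add: mat_adjoint_def mat_of_rows_def)
  then show "cnj (X j $$ (k, p)) = X j $$ (p, k)" using X(2) by simp
qed

lemma shifted_tuple_index:
  assumes "\<And>j. A j \<in> carrier_mat n n" "p < n" "k < n"
  shows "shifted_tuple n x C A j $$ (p, k)
    = complex_of_real (vec_nth x j) * (if p = k then 1 else 0) + complex_of_real C * A j $$ (p, k)"
  using assms(1)[of j] assms(2,3) by (simp add: shifted_tuple_def)

lemma shifted_tuple_carrier:
  "(\<And>j. A j \<in> carrier_mat n n) \<Longrightarrow> shifted_tuple n x C A j \<in> carrier_mat n n"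
  by (simp add: shifted_tuple_def)

text \<open>With \<open>comb a\<close> squaring to a scalar, the square of
  \<open>C * comb a - s\<close> is again affine in the generators. Positivity of a state on it is
  therefore an inequality that involves only the values of the state on the tuple.\<close>

lemma clifford_tuple_in_Wmax:
  fixes A :: "'d::finite \<Rightarrow> complex mat" and x :: "real^'d"
  assumes C: "C > 0" and A: "\<And>j. A j \<in> carrier_mat n n"
    and cl: "clifford n (\<lambda>j p k. if p < n \<and> k < n then A j $$ (p, k) else 0)"
  shows "shifted_tuple n x C A \<in> Wmax_level n (shifted_ball x C)"
proof -
  define f where "f = (\<lambda>j p k. if p < n \<and> k < n then A j $$ (p, k) else 0)"
  interpret clifford n f unfolding f_def by (rule cl)
  let ?X = "shifted_tuple n x C A"
  have fA: "A j $$ (p, k) = f j p k" if "p < n" "k < n" for j p k using that by (simp add: f_def)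
  have X: "?X j $$ (p, k) = complex_of_real (vec_nth x j) * e p k + complex_of_real C * f j p k"
    if "p < n" "k < n" for j p k
    using shifted_tuple_index[where A = A, OF A that] fA[OF that] by (simp add: e_def)
  have sa: "?X \<in> sa_tuples n"
  proof (rule sa_tuplesI)
    show "?X j \<in> carrier_mat n n" for j by (rule shifted_tuple_carrier[where A = A, OF A])
    fix j p k assume pk: "p < n" "k < n"
    show "cnj (?X j $$ (k, p)) = ?X j $$ (p, k)"
      using pk by (simp add: X real sym[of p k] e_def)
  qed
  have "W1 (cspace n) (\<lambda>j. mat_op (?X j)) \<subseteq> complexify (shifted_ball x C)"
  proof
    fix z' assume "z' \<in> W1 (cspace n) (\<lambda>j. mat_op (?X j))"
    then obtain \<phi> where z': "z' = (\<chi> j. \<phi> (mat_op (?X j)))"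
      and \<phi>: "state_on (cspace n) (cstar_gen (cspace n) (\<lambda>j. mat_op (?X j))) \<phi>"
      unfolding W1_def by (elim CollectE exE conjE)
    let ?B = "cstar_gen (cspace n) (\<lambda>j. mat_op (?X j))"
    have lin: "linear_functional_on ?B \<phi>" and id: "\<phi> (id_op (cspace n)) = 1"
      and pos: "\<And>T S. T \<in> ?B \<Longrightarrow> is_adjoint (cspace n) (cspace n) T S \<Longrightarrow> 0 \<le> \<phi> (S \<circ> T)"
      using \<phi> by (simp_all add: state_on_def)
    define Y where "Y j = ent n (\<lambda>p k. complex_of_real C * f j p k)" for j
    have Xop: "mat_op (?X j) = ent n (\<lambda>p k. complex_of_real (vec_nth x j) * e p k + complex_of_real C * f j p k)" for j
      unfolding mat_op_ent[OF shifted_tuple_carrier[where A = A, OF A]]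
      by (rule ent_cong) (rule X)
    have ide: "ent n e = id_op (cspace n)"
      using ent_id[of n] by (simp add: e_def[abs_def])
    have Yop: "Y j = mat_op (?X j) + scale_op (- complex_of_real (vec_nth x j)) (id_op (cspace n))" for j
      unfolding Xop Y_def ide[symmetric] ent_scale[symmetric] ent_add[symmetric] by (rule ent_cong) simp
    have YB: "Y j \<in> ?B" for j
      unfolding Yop by (intro cstar_gen_add cstar_gen_scale cstar_gen_id cstar_gen_generator)
    define w where "w j = \<phi> (Y j)" for j
    have ww: "w j = \<phi> (mat_op (?X j)) - complex_of_real (vec_nth x j)" for j
      unfolding w_def Yop
      by (simp only: linear_functional_onD(1)[OF lin cstar_gen_generator cstar_gen_scale[OF cstar_gen_id]]
          linear_functional_onD(2)[OF lin cstar_gen_id] id) simp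
    \<comment> \<open>Both parameters stay free: a unit vector with \<open>s = 1\<close> gives
      reality of the values, and a second choice gives the norm bound.\<close>
    have main: "0 \<le> complex_of_real (C\<^sup>2 * (norm a)\<^sup>2 + s\<^sup>2) - 2 * complex_of_real s * (\<Sum>j\<in>UNIV. complex_of_real (vec_nth a j) * w j)"
      for a :: "real^'d" and s :: real
    proof -
      define \<tau> where "\<tau> p k = complex_of_real C * comb a p k - complex_of_real s * e p k" for p k
      have cy: "(\<Sum>j\<in>UNIV. scale_op (complex_of_real (vec_nth a j)) (Y j)) = ent n (\<lambda>p k. complex_of_real C * comb a p k)"
        unfolding Y_def ent_scale[symmetric] ent_sum[symmetric] comb_def sum_distrib_left
        by (rule ent_cong) (simp add: mult.left_commute)
      have fs: "(\<Sum>j\<in>UNIV. scale_op (complex_of_real (vec_nth a j)) (Y j)) \<in> ?B"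
        "\<phi> (\<Sum>j\<in>UNIV. scale_op (complex_of_real (vec_nth a j)) (Y j)) = (\<Sum>j\<in>UNIV. complex_of_real (vec_nth a j) * w j)"
        using functional_sum[OF lin finite[of UNIV], of Y "\<lambda>j. complex_of_real (vec_nth a j)"] YB
        by (simp_all add: w_def)
      note fs = fs[unfolded cy]
      have \<tau>op: "ent n \<tau> = ent n (\<lambda>p k. complex_of_real C * comb a p k) + scale_op (- complex_of_real s) (id_op (cspace n))"
        unfolding ide[symmetric] ent_scale[symmetric, where c = "- complex_of_real s"] ent_add[symmetric]
        by (rule ent_cong) (simp add: \<tau>_def)
      have \<tau>B: "ent n \<tau> \<in> ?B"
        unfolding \<tau>op by (intro cstar_gen_add fs(1) cstar_gen_scale cstar_gen_id)
      have adj: "is_adjoint (cspace n) (cspace n) (ent n \<tau>) (ent n \<tau>)"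
      proof (rule ent_selfadjoint)
        fix p k assume "p < n" "k < n"
        then show "cnj (\<tau> p k) = \<tau> k p"
          by (simp add: \<tau>_def comb_def real e_def sym[of p k])
      qed
      have "ent n \<tau> \<circ> ent n \<tau> = ent n (\<lambda>p k. complex_of_real (C\<^sup>2 * (norm a)\<^sup>2 + s\<^sup>2) * e p k
          + (- 2 * complex_of_real s) * (complex_of_real C * comb a p k))"
        unfolding ent_comp
      proof (rule ent_cong)
        fix p k assume pk: "p < n" "k < n"
        have t: "\<tau> = (\<lambda>p k. complex_of_real C * comb a p k + (- complex_of_real s) * e p k)"
          by (simp add: \<tau>_def fun_eq_iff)
        have "(\<Sum>q<n. \<tau> p q * \<tau> q k) = mm \<tau> \<tau> p k" by (simp add: mm_def)
        also have "\<dots> = of_real (C * C) * mm (comb a) (comb a) p k - 2 * of_real s * of_real C * comb a p k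
            + of_real (s * s) * e p k"
          unfolding t mm_add_left mm_add_right mm_scale_left mm_scale_right
          using pk by (simp add: mm_e_left mm_e_right algebra_simps)
        finally show "(\<Sum>q<n. \<tau> p q * \<tau> q k) = complex_of_real (C\<^sup>2 * (norm a)\<^sup>2 + s\<^sup>2) * e p k
          + (- 2 * complex_of_real s) * (complex_of_real C * comb a p k)"
          using pk by (simp add: comb_square power2_eq_square algebra_simps)
      qed
      also have "\<dots> = scale_op (complex_of_real (C\<^sup>2 * (norm a)\<^sup>2 + s\<^sup>2)) (id_op (cspace n))
          + scale_op (- 2 * complex_of_real s) (ent n (\<lambda>p k. complex_of_real C * comb a p k))"
        unfolding ent_add ent_scale[where B = e] ide ent_scale[where c = "- 2 * complex_of_real s"] ..
      finally have "\<phi> (ent n \<tau> \<circ> ent n \<tau>) = complex_of_real (C\<^sup>2 * (norm a)\<^sup>2 + s\<^sup>2) * 1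
          + (- 2 * complex_of_real s) * (\<Sum>j\<in>UNIV. complex_of_real (vec_nth a j) * w j)"
        by (simp only: linear_functional_onD(1)[OF lin cstar_gen_scale[OF cstar_gen_id] cstar_gen_scale[OF fs(1)]]
          linear_functional_onD(2)[OF lin cstar_gen_id] linear_functional_onD(2)[OF lin fs(1)] fs(2) id)
      then show ?thesis using pos[OF \<tau>B adj] by simp
    qed
    \<comment> \<open>The order on complex numbers includes reality, so a nonnegative value with a
      single \<open>w j\<close> in it forces \<open>w j\<close> to be real.\<close>
    have Im: "Im (w j) = 0" for j
    proof -
      have "(\<Sum>i\<in>UNIV. complex_of_real (vec_nth (axis j 1) i) * w i) = (\<Sum>i\<in>UNIV. if i = j then w i else 0)"
        by (intro sum.cong refl) (simp add: axis_def)
      then show ?thesis using main[of "axis j 1" 1] by (simp add: less_eq_complex_def)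
    qed
    define r where "r = (\<chi> j. Re (w j))"
    have wr: "w j = complex_of_real (vec_nth r j)" for j using Im[of j] by (simp add: r_def complex_eq_iff)
    have "(\<Sum>j\<in>UNIV. complex_of_real (vec_nth r j) * w j) = complex_of_real ((norm r)\<^sup>2)"
      unfolding wr norm_sq_vec by (simp add: power2_eq_square)
    \<comment> \<open>The choice \<open>a = r\<close>, \<open>s = (norm r)\<^sup>2\<close> makes the
      inequality say that the fourth power of \<open>norm r\<close> is at most
      \<open>C\<^sup>2 * (norm r)\<^sup>2\<close>.\<close>
    then have "0 \<le> complex_of_real (C\<^sup>2 * (norm r)\<^sup>2 + ((norm r)\<^sup>2)\<^sup>2 - 2 * (norm r)\<^sup>2 * (norm r)\<^sup>2)"
      using main[of r "(norm r)\<^sup>2"] by simp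
    then have "0 \<le> C\<^sup>2 * (norm r)\<^sup>2 + ((norm r)\<^sup>2)\<^sup>2 - 2 * (norm r)\<^sup>2 * (norm r)\<^sup>2"
      by (simp add: less_eq_complex_def)
    then have "(norm r)\<^sup>2 * (norm r)\<^sup>2 \<le> C\<^sup>2 * (norm r)\<^sup>2" by (simp add: power2_eq_square)
    then have "(norm r)\<^sup>2 \<le> C\<^sup>2"
      using mult_right_le_imp_le[of "(norm r)\<^sup>2" "(norm r)\<^sup>2" "C\<^sup>2"] by (cases "r = 0") simp_all
    then have rC: "norm r \<le> C" using C by (simp add: power2_le_iff_abs_le)
    have "x + r \<in> shifted_ball x C"
      unfolding shifted_ball_def using rC C
      by (intro image_eqI[of _ _ "(1 / C) *\<^sub>R r"]) simp_all
    moreover have "z' = (\<chi> j. complex_of_real (vec_nth (x + r) j))"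
    proof -
      have "\<phi> (mat_op (?X j)) = complex_of_real (vec_nth (x + r) j)" for j
        using ww[of j] wr[of j] by (simp add: eq_diff_eq add.commute)
      then show ?thesis unfolding z' by simp
    qed
    ultimately show "z' \<in> complexify (shifted_ball x C)" unfolding complexify_def by (rule rev_image_eqI)
  qed
  then show ?thesis using sa by (simp add: Wmax_level_def)
qed

section \<open>From a normal dilation to the radius bound\<close>

text \<open>Polarisation: norms of sums determine the real part, and replacing \<open>v\<close> by
  \<open>\<i> v\<close> gives the imaginary part.\<close>

lemma isometry_op_ip:
  assumes H1: "inner_product_space H1" and H2: "inner_product_space H2"
    and V: "isometry_op H1 H2 V" and u: "u \<in> car H1" and v: "v \<in> car H1"
  shows "ip H2 (V u) (V v) = ip H1 u v"
proof -
  interpret h1: ips H1 by unfold_locales (rule H1)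
  interpret h2: ips H2 by unfold_locales (rule H2)
  have Vb: "V \<in> bounded_ops H1 H2" and Vn: "\<And>u. u \<in> car H1 \<Longrightarrow> hnorm H2 (V u) = hnorm H1 u"
    using V by (simp_all add: isometry_op_def)
  have Vc: "V u \<in> car H2" if "u \<in> car H1" for u
    using Vb that unfolding bounded_ops_def by simp
  have Va: "V (u + v) = V u + V v" if "u \<in> car H1" "v \<in> car H1" for u v
    using Vb that unfolding bounded_ops_def by simp
  have Vs: "V (scaleC c u) = scaleC c (V u)" if "u \<in> car H1" for c u
    using Vb that unfolding bounded_ops_def by simp
  have re1: "2 * Re (ip H1 u v) = (hnorm H1 (u + v))\<^sup>2 - (hnorm H1 u)\<^sup>2 - (hnorm H1 v)\<^sup>2"
    if "u \<in> car H1" "v \<in> car H1" for u v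
    using that h1.ip_cnj[OF that] by (simp add: h1.hnorm_sq h1.ip_add_left h1.ip_add_right)
  have re2: "2 * Re (ip H2 u v) = (hnorm H2 (u + v))\<^sup>2 - (hnorm H2 u)\<^sup>2 - (hnorm H2 v)\<^sup>2"
    if "u \<in> car H2" "v \<in> car H2" for u v
    using that h2.ip_cnj[OF that] by (simp add: h2.hnorm_sq h2.ip_add_left h2.ip_add_right)
  have re: "Re (ip H2 (V u) (V v)) = Re (ip H1 u v)" if "u \<in> car H1" "v \<in> car H1" for u v
    using re1[OF that] re2[OF Vc[OF that(1)] Vc[OF that(2)]] that
    by (simp add: Vn Va[OF that, symmetric])
  have iv: "scaleC \<i> v \<in> car H1" using v by simp
  have "Im (ip H2 (V u) (V v)) = Re (ip H2 (V u) (V (scaleC \<i> v)))"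
    using Vc[OF u] Vc[OF v] by (simp add: Vs[OF v] h2.ip_scaleC_right)
  also have "\<dots> = Re (ip H1 u (scaleC \<i> v))" by (rule re[OF u iv])
  also have "\<dots> = Im (ip H1 u v)" using u v by (simp add: h1.ip_scaleC_right)
  finally show ?thesis using re[OF u v] by (simp add: complex_eq_iff)
qed

lemma normal_tupleD:
  assumes "normal_tuple H N"
  obtains S where "\<And>j. N j \<in> bounded_ops H H" "\<And>j. is_adjoint H H (N j) (S j)"
    "\<And>j. S j \<circ> N j = N j \<circ> S j" "\<And>j k. N j \<circ> N k = N k \<circ> N j"
proof -
  have n: "\<forall>j. N j \<in> bounded_ops H H \<and> (\<exists>S. is_adjoint H H (N j) S \<and> S \<circ> N j = N j \<circ> S)"
    and c: "\<forall>j k. N j \<circ> N k = N k \<circ> N j"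
    using assms unfolding normal_tuple_def normal_op_def by simp_all
  have "\<forall>j. \<exists>S. is_adjoint H H (N j) S \<and> S \<circ> N j = N j \<circ> S" using n by simp
  then obtain S where "\<forall>j. is_adjoint H H (N j) (S j) \<and> S j \<circ> N j = N j \<circ> S j"
    by (rule choice[THEN exE])
  then show thesis using n c that[of S] by simp
qed

text \<open>The isometry carries the columns of \<open>M\<close> to vectors \<open>w k\<close> of
  the dilation space. As \<open>X j - y j\<close> is the compression of
  \<open>A j = N j - y j\<close>, the left side is the quadratic form estimated in
  \<open>clifford_bound\<close>.\<close>

lemma Wmin_level_clifford_bound:
  fixes X :: "'d::finite \<Rightarrow> complex mat" and y :: "real^'d"
  assumes X: "X \<in> Wmin_level TYPE('i::infinite) n (shifted_ball y C)" and C: "C > 0"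
    and cl: "clifford n f"
  shows "Re (\<Sum>k<n. \<Sum>j\<in>UNIV. \<Sum>l<n. f j k l * (\<Sum>p<n. (\<Sum>q<n. (X j $$ (p, q)
      - complex_of_real (vec_nth y j) * (if p = q then 1 else 0)) * M q l) * cnj (M p k)))
    \<le> C * (\<Sum>k<n. \<Sum>p<n. (cmod (M p k))\<^sup>2)"
proof -
  have "\<exists>(H :: 'i hspace) N. hilbert_space H \<and> normal_tuple H N \<and>
        dilates (cspace n) (\<lambda>j. mat_op (X j)) H N \<and> joint_spectrum H N \<subseteq> complexify (shifted_ball y C)"
    and Xsa: "X \<in> sa_tuples n"
    using X unfolding Wmin_level_def by simp_all
  then obtain H :: "'i hspace" and N where H: "hilbert_space H" "normal_tuple H N"
    "dilates (cspace n) (\<lambda>j. mat_op (X j)) H N"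
    and spec: "joint_spectrum H N \<subseteq> complexify (shifted_ball y C)" by (elim exE conjE)
  have Hi: "inner_product_space H" using H(1) by (simp add: hilbert_space_def)
  interpret ips H by unfold_locales (rule Hi)
  obtain S where N: "\<And>j. N j \<in> bounded_ops H H" "\<And>j. is_adjoint H H (N j) (S j)"
    "\<And>j. S j \<circ> N j = N j \<circ> S j" "\<And>j k. N j \<circ> N k = N k \<circ> N j"
    using normal_tupleD[OF H(2)] by metis
  obtain V W where V: "isometry_op (cspace n) H V" and W: "is_adjoint (cspace n) H V W"
    and VW: "\<forall>j. mat_op (X j) = W \<circ> N j \<circ> V"
    using H(3) unfolding dilates_def by (elim exE conjE)
  have Vc: "V u \<in> car H" if "u \<in> car (cspace n)" for u
    using V that unfolding isometry_op_def bounded_ops_def by simp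
  define A where "A j = N j + scale_op (- complex_of_real (vec_nth y j)) (id_op H)" for j
  have Ab: "A j \<in> bounded_ops H H" for j unfolding A_def using N(1) by simp
  have A: "A j u = N j u - scaleC (complex_of_real (vec_nth y j)) u" if "u \<in> car H" for j u
    using that by (simp add: A_def scale_op_def id_op_def fun_eq_iff scaleC_def)
  note m = op_car[OF N(1)] op_car[OF Ab]
  note sa = real_spectrum_selfadjoint[where N = N and S = S, OF N less_imp_le[OF C] spec]
  have Asa: "ip H (A j u) v = ip H u (A j v)" if "u \<in> car H" "v \<in> car H" for j u v
    using that m adjoint_ip[OF sa that]
    by (simp add: A ip_diff_left ip_diff_right ip_scaleC_left ip_scaleC_right)
  have Ac: "A i (A j u) = A j (A i u)" if u: "u \<in> car H" for i j u
    using u m by (simp add: A op_diff[OF N(1)] op_scaleC[OF N(1)] scaleC_diff op_commuteD[OF N(4)[of i j]])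
      (simp add: fun_eq_iff scaleC_def algebra_simps)
  have AC: "(\<Sum>j\<in>UNIV. (hnorm H (A j u))\<^sup>2) \<le> C\<^sup>2 * (hnorm H u)\<^sup>2" if u: "u \<in> car H" for u
    using sum_hnorm_sq_le[where N = N and S = S, OF N less_imp_le[OF C] spec u] by (simp add: A[OF u])
  define c where "c k = (\<lambda>p. if p < n then M p k else 0)" for k
  have c: "c k \<in> car (cspace n)" for k by (simp add: c_def cspace_car)
  define w where "w k = V (c k)" for k
  have w: "w k \<in> car H" for k unfolding w_def by (rule Vc[OF c])
  have hw: "(hnorm H (w k))\<^sup>2 = (\<Sum>p<n. (cmod (M p k))\<^sup>2)" for k
  proof -
    have "hnorm H (w k) = hnorm (cspace n) (c k)"
      using V c unfolding w_def isometry_op_def by simp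
    then show ?thesis by (simp add: hnorm_cspace c_def sum_nonneg)
  qed
  have ipA: "ip H (A j (w l)) (w k) = (\<Sum>p<n. (\<Sum>q<n. (X j $$ (p, q)
      - complex_of_real (vec_nth y j) * (if p = q then 1 else 0)) * M q l) * cnj (M p k))" for j k l
  proof -
    have "ip H (w k) (N j (w l)) = ip (cspace n) (c k) (W (N j (w l)))"
      using W c m(1)[OF w] unfolding is_adjoint_def w_def by simp
    also have "W (N j (w l)) = mat_op (X j) (c l)" using VW by (simp add: w_def)
    finally have "ip H (N j (w l)) (w k) = ip (cspace n) (mat_op (X j) (c l)) (c k)"
      using ip_cnj[OF w m(1)[OF w]] cspace.ip_cnj[of "c k" n "mat_op (X j) (c l)"] c
        cspace.op_car[OF ent_bop c] mat_op_ent[OF sa_tuplesD(1)[OF Xsa]] by simp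
    also have "\<dots> = (\<Sum>p<n. (\<Sum>q<n. X j $$ (p, q) * M q l) * cnj (M p k))"
      using c unfolding mat_op_ent[OF sa_tuplesD(1)[OF Xsa]] cspace_ip ent_apply
      by (intro sum.cong refl) (simp add: c_def)
    finally have 1: "ip H (N j (w l)) (w k) = (\<Sum>p<n. (\<Sum>q<n. X j $$ (p, q) * M q l) * cnj (M p k))" .
    have 2: "ip H (w l) (w k) = (\<Sum>p<n. M p l * cnj (M p k))"
      unfolding w_def isometry_op_ip[OF inner_product_space_cspace Hi V c c] cspace_ip
      by (intro sum.cong refl) (simp add: c_def)
    have in1: "(\<Sum>q<n. (X j $$ (p, q) - complex_of_real (vec_nth y j) * (if p = q then 1 else 0)) * M q l)
      = (\<Sum>q<n. X j $$ (p, q) * M q l) - complex_of_real (vec_nth y j) * M p l" if "p < n" for p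
    proof -
      have "(\<Sum>q<n. (X j $$ (p, q) - complex_of_real (vec_nth y j) * (if p = q then 1 else 0)) * M q l)
        = (\<Sum>q<n. X j $$ (p, q) * M q l - (if p = q then complex_of_real (vec_nth y j) * M q l else 0))"
        by (rule sum.cong[OF refl]) (simp add: algebra_simps)
      then show ?thesis using that by (simp add: sum_subtractf)
    qed
    have "(\<Sum>p<n. (\<Sum>q<n. (X j $$ (p, q)
      - complex_of_real (vec_nth y j) * (if p = q then 1 else 0)) * M q l) * cnj (M p k))
      = (\<Sum>p<n. (\<Sum>q<n. X j $$ (p, q) * M q l) * cnj (M p k) - complex_of_real (vec_nth y j) * (M p l * cnj (M p k)))"
      by (rule sum.cong[OF refl], subst in1, simp, simp only: left_diff_distrib mult.assoc)
    also have "\<dots> = (\<Sum>p<n. (\<Sum>q<n. X j $$ (p, q) * M q l) * cnj (M p k)) - complex_of_real (vec_nth y j) * (\<Sum>p<n. M p l * cnj (M p k))"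
      by (simp only: sum_subtractf sum_distrib_left)
    also have "\<dots> = ip H (A j (w l)) (w k)"
      unfolding A[OF w] using w m(1)[OF w]
      by (simp only: ip_diff_left car_scaleC ip_scaleC_left 1 2)
    finally show ?thesis ..
  qed
  show ?thesis
    using clifford_bound[where A = A and w = w, OF cl Ab Asa Ac C AC w] by (simp add: ipA hw)
qed

text \<open>The test matrix is the one from \<open>eigenvector\<close>. Symmetry of the generators
  turns the sum over \<open>l\<close> into multiplication from the right, after which the form is
  \<open>s + C1\<close> times the squared Frobenius norm of \<open>M\<close>.\<close>

lemma Wmin_level_clifford_radius:
  fixes A :: "'d::finite \<Rightarrow> complex mat" and x y :: "real^'d"
  assumes A: "\<And>j. A j \<in> carrier_mat n n" and n: "n > 0" and d: "CARD('d) \<ge> 2"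
    and cl: "clifford n (\<lambda>j p k. if p < n \<and> k < n then A j $$ (p, k) else 0)"
    and C: "C1 > 0" "C2 > 0"
    and X: "shifted_tuple n x C1 A \<in> Wmin_level TYPE('i::infinite) n (shifted_ball y C2)"
  shows "C2 \<ge> sqrt ((norm (y - x))\<^sup>2 + C1\<^sup>2 * (real CARD('d) - 1)\<^sup>2) + C1"
proof -
  define f where "f = (\<lambda>j p k. if p < n \<and> k < n then A j $$ (p, k) else 0)"
  interpret clifford n f unfolding f_def by (rule cl)
  define v where "v = x - y"
  define s where "s = sqrt ((norm v)\<^sup>2 + C1\<^sup>2 * (real CARD('d) - 1)\<^sup>2)"
  define a where "a = s + C1 * (real CARD('d) - 1)"
  define M where "M = (\<lambda>p k. complex_of_real a * e p k + comb v p k)"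
  have fA: "A j $$ (p, k) = f j p k" if "p < n" "k < n" for j p k using that by (simp add: f_def)
  have Xe: "shifted_tuple n x C1 A j $$ (p, q) - complex_of_real (vec_nth y j) * (if p = q then 1 else 0)
      = complex_of_real (vec_nth v j) * e p q + complex_of_real C1 * f j p q" if "p < n" "q < n" for j p q
    using shifted_tuple_index[where A = A, OF A that, of x C1 j] fA[OF that, of j]
    by (simp add: e_def v_def algebra_simps)
  have ev: "(\<Sum>j\<in>UNIV. complex_of_real (vec_nth v j) * mm M (f j) p k + complex_of_real C1 * mm (f j) (mm M (f j)) p k)
    = complex_of_real (s + C1) * M p k" if "p < n" "k < n" for p k
    using eigenvector[OF that, of v C1] unfolding M_def a_def s_def by simp
  have "(\<Sum>k<n. \<Sum>j\<in>UNIV. \<Sum>l<n. f j k l * (\<Sum>p<n. (\<Sum>q<n. (shifted_tuple n x C1 A j $$ (p, q)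
      - complex_of_real (vec_nth y j) * (if p = q then 1 else 0)) * M q l) * cnj (M p k)))
    = (\<Sum>k<n. \<Sum>p<n. (\<Sum>j\<in>UNIV. complex_of_real (vec_nth v j) * mm M (f j) p k + complex_of_real C1 * mm (f j) (mm M (f j)) p k) * cnj (M p k))"
  proof (rule sum.cong[OF refl])
    fix k assume "k \<in> {..<n}"
    then have k: "k < n" by simp
    have in1: "(\<Sum>q<n. (shifted_tuple n x C1 A j $$ (p, q) - complex_of_real (vec_nth y j) * (if p = q then 1 else 0)) * M q l)
        = complex_of_real (vec_nth v j) * M p l + complex_of_real C1 * mm (f j) M p l" if p: "p < n" for j p l
    proof -
      have "(\<Sum>q<n. (shifted_tuple n x C1 A j $$ (p, q) - complex_of_real (vec_nth y j) * (if p = q then 1 else 0)) * M q l)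
        = mm (\<lambda>p q. complex_of_real (vec_nth v j) * e p q + complex_of_real C1 * f j p q) M p l"
        unfolding mm_def by (rule sum.cong[OF refl]) (simp only: Xe[OF p] lessThan_iff)
      then show ?thesis unfolding mm_add_left mm_scale_left mm_e_left[OF p] .
    qed
    have "(\<Sum>l<n. f j k l * (\<Sum>p<n. (complex_of_real (vec_nth v j) * M p l + complex_of_real C1 * mm (f j) M p l) * cnj (M p k)))
      = (\<Sum>p<n. (complex_of_real (vec_nth v j) * mm M (f j) p k + complex_of_real C1 * mm (f j) (mm M (f j)) p k) * cnj (M p k))" for j
    proof -
      have "(\<Sum>l<n. f j k l * (\<Sum>p<n. (complex_of_real (vec_nth v j) * M p l + complex_of_real C1 * mm (f j) M p l) * cnj (M p k)))
        = (\<Sum>p<n. \<Sum>l<n. f j k l * ((complex_of_real (vec_nth v j) * M p l + complex_of_real C1 * mm (f j) M p l) * cnj (M p k)))"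
        unfolding sum_distrib_left by (rule sum.swap)
      also have "\<dots> = (\<Sum>p<n. mm (\<lambda>p l. complex_of_real (vec_nth v j) * M p l + complex_of_real C1 * mm (f j) M p l) (f j) p k * cnj (M p k))"
        unfolding mm_def[of "\<lambda>p l. complex_of_real (vec_nth v j) * M p l + complex_of_real C1 * mm (f j) M p l"] sum_distrib_right
        by (rule sum.cong[OF refl], rule sum.cong[OF refl]) (simp add: sym[OF k] mult_ac)
      finally show ?thesis unfolding mm_add_left mm_scale_left mm_assoc .
    qed
    moreover have "(\<Sum>j\<in>UNIV. \<Sum>l<n. f j k l * (\<Sum>p<n. (\<Sum>q<n. (shifted_tuple n x C1 A j $$ (p, q)
      - complex_of_real (vec_nth y j) * (if p = q then 1 else 0)) * M q l) * cnj (M p k)))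
      = (\<Sum>j\<in>UNIV. \<Sum>l<n. f j k l * (\<Sum>p<n. (complex_of_real (vec_nth v j) * M p l + complex_of_real C1 * mm (f j) M p l) * cnj (M p k)))"
      by (rule sum.cong[OF refl], rule sum.cong[OF refl], rule arg_cong[where f = "\<lambda>z. _ * z"],
          rule sum.cong[OF refl]) (simp only: in1 lessThan_iff)
    ultimately show "(\<Sum>j\<in>UNIV. \<Sum>l<n. f j k l * (\<Sum>p<n. (\<Sum>q<n. (shifted_tuple n x C1 A j $$ (p, q)
      - complex_of_real (vec_nth y j) * (if p = q then 1 else 0)) * M q l) * cnj (M p k)))
      = (\<Sum>p<n. (\<Sum>j\<in>UNIV. complex_of_real (vec_nth v j) * mm M (f j) p k + complex_of_real C1 * mm (f j) (mm M (f j)) p k) * cnj (M p k))"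
      unfolding sum_distrib_right by (simp only: sum.swap[of _ "{..<n}" UNIV])
  qed
  also have "\<dots> = (\<Sum>k<n. \<Sum>p<n. complex_of_real ((s + C1) * (cmod (M p k))\<^sup>2))"
    by (rule sum.cong[OF refl], rule sum.cong[OF refl])
       (simp only: ev lessThan_iff of_real_mult complex_norm_square mult.assoc)
  also have "\<dots> = complex_of_real ((s + C1) * (\<Sum>k<n. \<Sum>p<n. (cmod (M p k))\<^sup>2))"
    by (simp add: sum_distrib_left)
  finally have "(s + C1) * (\<Sum>k<n. \<Sum>p<n. (cmod (M p k))\<^sup>2) \<le> C2 * (\<Sum>k<n. \<Sum>p<n. (cmod (M p k))\<^sup>2)"
    using Wmin_level_clifford_bound[OF X C(2) clifford_axioms, of M] by (simp only: Re_complex_of_real)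
  moreover have "0 < (\<Sum>k<n. \<Sum>p<n. (cmod (M p k))\<^sup>2)"
    unfolding M_def
  proof (rule eigenvector_nonzero[OF n])
    \<comment> \<open>Dimension at least two enters here: it makes \<open>a\<close> strictly larger
      than \<open>s\<close>, so that \<open>M\<close> cannot vanish.\<close>
    have "norm v \<le> s" unfolding s_def by (intro real_le_rsqrt) simp
    moreover have "0 < C1 * (real CARD('d) - 1)" using C(1) d by simp
    ultimately show "norm v < a" by (simp add: a_def)
  qed
  ultimately have "s + C1 \<le> C2" by simp
  then show ?thesis by (simp add: s_def v_def norm_minus_commute)
qed

section \<open>Simplices between balls\<close>

text \<open>A hull containing a ball has full dimension, and at most \<open>DIM('a) + 1\<close>
  points can span that only if they are distinct and affinely independent. The construction below
  thus only has to count its vertices.\<close>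

lemma simplex_if_ball_subset:
  fixes S :: "'a::euclidean_space set"
  assumes S: "finite S" "card S \<le> DIM('a) + 1" and r: "r > 0" and sub: "cball x r \<subseteq> convex hull S"
  shows "int DIM('a) simplex convex hull S"
proof -
  have "int DIM('a) = aff_dim (cball x r)" using r by (simp add: aff_dim_cball)
  also have "\<dots> \<le> aff_dim (convex hull S)" by (rule aff_dim_subset[OF sub])
  also have "\<dots> = aff_dim S" by (rule aff_dim_convex_hull)
  finally have ge: "int DIM('a) \<le> aff_dim S" .
  have "aff_dim S \<le> int (card S) - 1" by (rule aff_dim_le_card[OF S(1)])
  then have "int (card S) = int DIM('a) + 1" "aff_dim S = int (card S) - 1" using ge S(2) by linarith+
  then show ?thesis
    using S(1) unfolding simplex_def by (intro exI[of _ S]) (simp add: affine_independent_iff_card)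
qed

text \<open>The base of the simplex is regular and tangent to the inner ball, with outer normal \<open>-e\<close>. The apex
  \<open>h e\<close> with \<open>h = t + R\<close> lies on the outer sphere, on the side of its centre. The value of \<open>\<sigma>\<close> makes the
  other facets tangent to the inner ball.\<close>

lemma simplex_between_balls_unit:
  fixes p :: "'d::finite \<Rightarrow> 'a::euclidean_space"
  assumes p: "\<And>i j. inner (p i) (p j) = (if i = j then 1 else 0)" and card: "CARD('d) = DIM('a)" "DIM('a) \<ge> 2"
    and expand: "\<And>z. z = (\<Sum>i\<in>UNIV. (inner z (p i)) *\<^sub>R p i)"
    and t: "t \<ge> 0" and R: "R \<ge> sqrt (t\<^sup>2 + (real DIM('a) - 1)\<^sup>2) + 1"
  defines "e \<equiv> (1 / sqrt DIM('a)) *\<^sub>R (\<Sum>i\<in>UNIV. p i)"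
  shows "\<exists>S. finite S \<and> card S \<le> DIM('a) + 1 \<and> cball 0 1 \<subseteq> convex hull S \<and> convex hull S \<subseteq> cball (t *\<^sub>R e) R"
proof -
  define d where "d = real DIM('a)"
  have d: "d \<ge> 2" using card(2) by (simp add: d_def)
  define h where "h = t + R"
  have "d - 1 \<le> sqrt (t\<^sup>2 + (d - 1)\<^sup>2)" by (rule real_le_rsqrt) simp
  then have R2: "R \<ge> d" using R unfolding d_def[symmetric] by linarith
  have h: "h > 1" using R2 d t by (simp add: h_def)
  \<comment> \<open>The cone from height \<open>h\<close> tangent to the unit ball has slope
    \<open>1 / sqrt (h\<^sup>2 - 1)\<close>; at depth \<open>h + 1\<close>, in the plane of the
    base, its radius is \<open>\<sigma>\<close>.\<close>
  define \<sigma> where "\<sigma> = sqrt ((h + 1) / (h - 1))"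
  have \<sigma>: "\<sigma> > 0" "\<sigma>\<^sup>2 = (h + 1) / (h - 1)" using h by (simp_all add: \<sigma>_def)
  have e_p: "inner e (p i) = 1 / sqrt d" for i
    by (simp add: e_def inner_sum_left p d_def)
  have p_e: "inner (p i) e = 1 / sqrt d" for i
    using e_p[of i] by (simp add: inner_commute)
  have sd: "sqrt d * sqrt d = d" "sqrt d > 0" "d * (1 / sqrt d) = sqrt d"
    using d by (simp_all add: real_div_sqrt)
  have ee: "inner e e = 1"
  proof -
    have "inner e e = (1 / sqrt d) * (\<Sum>i\<in>UNIV. inner e (p i))"
      by (subst (2) e_def) (simp add: inner_sum_right d_def)
    also have "\<dots> = (1 / sqrt d) * (d * (1 / sqrt d))" by (simp add: e_p card(1) d_def)
    finally show ?thesis unfolding sd(3) using sd(2) by simp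
  qed
  have ne: "norm e = 1" using ee by (simp add: norm_eq_sqrt_inner)
  \<comment> \<open>All \<open>p i\<close> make the same angle with \<open>e\<close>, so their
    projections to the orthogonal complement of \<open>e\<close> are the vertices of a regular
    simplex centred at the origin.\<close>
  define u where "u i = p i - (1 / sqrt d) *\<^sub>R e" for i
  have ue: "inner (u i) e = 0" for i
    using p_e[of i] ee by (simp add: u_def inner_diff_left)
  have eu: "inner e (u i) = 0" for i using ue[of i] by (simp add: inner_commute)
  have uu: "inner (u i) (u i) = 1 - 1 / d" for i
    using sd d by (simp add: u_def inner_diff_left inner_diff_right e_p p_e ee p field_simps)
  have su: "(\<Sum>i\<in>UNIV. u i) = 0"
  proof -
    have "(\<Sum>i\<in>UNIV. p i) = sqrt d *\<^sub>R e" using sd by (simp add: e_def d_def)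
    moreover have "(\<Sum>i\<in>(UNIV :: 'd set). (1 / sqrt d) *\<^sub>R e) = (d * (1 / sqrt d)) *\<^sub>R e"
      by (simp add: sum_constant_scaleR card(1) d_def)
    ultimately show ?thesis unfolding sd(3) by (simp add: u_def sum_subtractf)
  qed
  \<comment> \<open>The length of \<open>u i\<close> is \<open>sqrt ((d - 1) / d)\<close>, so
    \<open>\<kappa> u i\<close> has length \<open>d - 1\<close>. This is the circumradius of a
    regular simplex of dimension \<open>d - 1\<close> and inradius \<open>1\<close>; hence the base
    has inradius \<open>\<sigma>\<close>.\<close>
  define \<kappa> where "\<kappa> = sqrt (d * (d - 1))"
  have \<kappa>: "\<kappa> > 0" "\<kappa> * \<kappa> = d * (d - 1)" using d by (simp_all add: \<kappa>_def)
  define b where "b i = - e + (\<sigma> * \<kappa>) *\<^sub>R u i" for i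
  define a where "a = h *\<^sub>R e"
  define S where "S = insert a (range b)"
  have fin: "finite S" by (simp add: S_def)
  have "card S \<le> Suc (card (range b))" unfolding S_def by (rule card_insert_le_m1) simp_all
  also have "card (range b) \<le> DIM('a)" using card_image_le[of UNIV b] card(1) by simp
  finally have cS: "card S \<le> DIM('a) + 1" by simp
  have sk: "(\<sigma> * \<kappa>)\<^sup>2 = (h + 1) / (h - 1) * (d * (d - 1))"
    unfolding power_mult_distrib \<sigma>(2) by (simp add: power2_eq_square \<kappa>(2))
  have hull: "cball 0 1 \<subseteq> convex hull S"
  proof
    fix z :: 'a assume "z \<in> cball 0 1"
    then have z: "norm z \<le> 1" by simp
    define \<alpha> where "\<alpha> = inner z e"
    \<comment> \<open>The barycentric coordinate of the apex: the height of \<open>z\<close> above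
      the base divided by the height of the simplex. The \<open>l i\<close> below are the
      coordinates of the base vertices.\<close>
    define \<mu> where "\<mu> = (\<alpha> + 1) / (h + 1)"
    define l where "l i = (1 - \<mu>) / d + (inner z (u i)) / (\<sigma> * \<kappa>)" for i
    have \<alpha>: "\<bar>\<alpha>\<bar> \<le> 1"
      using Cauchy_Schwarz_ineq2[of z e] z ne by (simp add: \<alpha>_def)
    have \<mu>: "0 \<le> \<mu>" using \<alpha> h by (simp add: \<mu>_def)
    have zu: "(\<Sum>i\<in>UNIV. inner z (u i)) = 0" by (simp add: inner_sum_right[symmetric] su)
    have sl: "(\<Sum>i\<in>UNIV. l i) = 1 - \<mu>"
      using d by (simp add: l_def sum.distrib sum_divide_distrib[symmetric] zu card(1)) (simp add: d_def)
    have l0: "0 \<le> l i" for i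
    proof -
      \<comment> \<open>Up to sign this is the gradient of \<open>l i\<close>: \<open>l i\<close>
        equals \<open>h / (d (h + 1))\<close> minus the inner product of \<open>z\<close> and
        \<open>w\<close>. The constant turns out to be the norm of \<open>w\<close>, which is
        tangency of the facet and gives nonnegativity on the ball.\<close>
      define w where "w = (1 / (d * (h + 1))) *\<^sub>R e - (1 / (\<sigma> * \<kappa>)) *\<^sub>R u i"
      have "(norm w)\<^sup>2 = (1 / (d * (h + 1)))\<^sup>2 + (1 / (\<sigma> * \<kappa>))\<^sup>2 * (1 - 1 / d)"
        unfolding power2_norm_eq_inner w_def
        by (simp only: inner_diff_left inner_diff_right inner_scaleR_left inner_scaleR_right ue eu uu ee)
           (simp only: power2_eq_square mult_zero_right diff_zero diff_0 minus_minus mult_1_right mult.assoc)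
      also have "(1 / (\<sigma> * \<kappa>))\<^sup>2 = (h - 1) / ((h + 1) * (d * (d - 1)))"
        unfolding power_one_over sk by simp
      also have "(1 / (d * (h + 1)))\<^sup>2 + (h - 1) / ((h + 1) * (d * (d - 1))) * (1 - 1 / d) = (h / (d * (h + 1)))\<^sup>2"
      proof -
        have "(h - 1) / ((h + 1) * (d * (d - 1))) * (1 - 1 / d) = (h - 1) / ((h + 1) * (d * d))"
          using d h by (simp add: divide_simps)
        moreover have "1 / (d * (h + 1))\<^sup>2 + (h - 1) / ((h + 1) * (d * d)) = (1 + (h - 1) * (h + 1)) / (d * (h + 1))\<^sup>2"
          using d h by (simp add: divide_simps power2_eq_square)
        moreover have "1 + (h - 1) * (h + 1) = h\<^sup>2" by (simp add: algebra_simps power2_eq_square)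
        ultimately show ?thesis by (simp add: power_divide)
      qed
      finally have nw: "norm w = h / (d * (h + 1))"
        using h d by (simp add: power2_eq_iff_nonneg)
      have "inner z w \<le> norm w" using Cauchy_Schwarz_ineq2[of z w] mult_right_mono[OF z norm_ge_zero[of w]] by simp
      moreover have "inner z w = \<alpha> / (d * (h + 1)) - (inner z (u i)) / (\<sigma> * \<kappa>)"
        by (simp add: w_def inner_diff_right \<alpha>_def)
      moreover have "l i = h / (d * (h + 1)) - \<alpha> / (d * (h + 1)) + (inner z (u i)) / (\<sigma> * \<kappa>)"
      proof -
        have "1 - \<mu> = (h - \<alpha>) / (h + 1)" using h by (simp add: \<mu>_def field_simps)
        then have "(1 - \<mu>) / d = (h - \<alpha>) / (d * (h + 1))" by (simp add: mult.commute)
        then show ?thesis by (simp add: l_def diff_divide_distrib)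
      qed
      ultimately show ?thesis using nw by simp
    qed
    have "\<mu> *\<^sub>R a + (\<Sum>i\<in>UNIV. l i *\<^sub>R b i) = z"
    proof -
      have "(\<Sum>i\<in>UNIV. l i *\<^sub>R b i) = - (1 - \<mu>) *\<^sub>R e + (\<sigma> * \<kappa>) *\<^sub>R (\<Sum>i\<in>UNIV. l i *\<^sub>R u i)"
      proof -
        have "l i *\<^sub>R b i = l i *\<^sub>R (- e) + (\<sigma> * \<kappa>) *\<^sub>R (l i *\<^sub>R u i)" for i
          unfolding b_def scaleR_add_right scaleR_scaleR by (simp only: mult.commute)
        then have "(\<Sum>i\<in>UNIV. l i *\<^sub>R b i) = (\<Sum>i\<in>UNIV. l i) *\<^sub>R (- e) + (\<sigma> * \<kappa>) *\<^sub>R (\<Sum>i\<in>UNIV. l i *\<^sub>R u i)"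
          by (simp only: sum.distrib scaleR_sum_left scaleR_sum_right)
        then show ?thesis unfolding sl by (simp only: scaleR_minus_right scaleR_minus_left)
      qed
      also have "(\<Sum>i\<in>UNIV. l i *\<^sub>R u i) = (1 / (\<sigma> * \<kappa>)) *\<^sub>R (\<Sum>i\<in>UNIV. (inner z (u i)) *\<^sub>R u i)"
      proof -
        have "l i *\<^sub>R u i = ((1 - \<mu>) / d) *\<^sub>R u i + (1 / (\<sigma> * \<kappa>)) *\<^sub>R (inner z (u i) *\<^sub>R u i)" for i
          unfolding l_def scaleR_add_left scaleR_scaleR by simp
        then have "(\<Sum>i\<in>UNIV. l i *\<^sub>R u i) = ((1 - \<mu>) / d) *\<^sub>R (\<Sum>i\<in>UNIV. u i)
            + (1 / (\<sigma> * \<kappa>)) *\<^sub>R (\<Sum>i\<in>UNIV. inner z (u i) *\<^sub>R u i)"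
          by (simp only: sum.distrib scaleR_sum_right)
        then show ?thesis unfolding su by simp
      qed
      \<comment> \<open>Projecting an orthonormal basis yields a Parseval frame, here of the
        orthogonal complement of \<open>e\<close>.\<close>
      also have "(\<Sum>i\<in>UNIV. (inner z (u i)) *\<^sub>R u i) = z - \<alpha> *\<^sub>R e"
      proof -
        have "inner z (u i) *\<^sub>R u i = inner z (u i) *\<^sub>R p i - inner z (u i) *\<^sub>R ((1 / sqrt d) *\<^sub>R e)" for i
          by (simp add: u_def[of i] scaleR_diff_right)
        then have "(\<Sum>i\<in>UNIV. inner z (u i) *\<^sub>R u i) = (\<Sum>i\<in>UNIV. inner z (u i) *\<^sub>R p i)
            - (\<Sum>i\<in>UNIV. inner z (u i)) *\<^sub>R ((1 / sqrt d) *\<^sub>R e)"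
          by (simp only: sum_subtractf scaleR_sum_left)
        also have "\<dots> = (\<Sum>i\<in>UNIV. inner z (u i) *\<^sub>R p i)" unfolding zu by simp
        also have "\<dots> = (\<Sum>i\<in>UNIV. inner z (p i) *\<^sub>R p i - (\<alpha> / sqrt d) *\<^sub>R p i)"
        proof (rule sum.cong[OF refl])
          fix i
          have "inner z (u i) = inner z (p i) - \<alpha> / sqrt d" by (simp add: u_def inner_diff_right \<alpha>_def)
          then show "inner z (u i) *\<^sub>R p i = inner z (p i) *\<^sub>R p i - (\<alpha> / sqrt d) *\<^sub>R p i"
            by (simp only: scaleR_diff_left)
        qed
        also have "\<dots> = (\<Sum>i\<in>UNIV. inner z (p i) *\<^sub>R p i) - (\<alpha> / sqrt d) *\<^sub>R (\<Sum>i\<in>UNIV. p i)"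
          by (simp only: sum_subtractf scaleR_sum_right)
        also have "(\<alpha> / sqrt d) *\<^sub>R (\<Sum>i\<in>UNIV. p i) = \<alpha> *\<^sub>R e" by (simp add: e_def d_def)
        finally show ?thesis using expand[of z] by simp
      qed
      finally have "(\<Sum>i\<in>UNIV. l i *\<^sub>R b i) = - (1 - \<mu>) *\<^sub>R e + (z - \<alpha> *\<^sub>R e)" using \<sigma>(1) \<kappa>(1) by simp
      moreover have "\<mu> * h - (1 - \<mu>) - \<alpha> = 0"
      proof -
        have "\<mu> * (h + 1) = \<alpha> + 1" using h by (simp add: \<mu>_def)
        then show ?thesis by (simp add: algebra_simps)
      qed
      moreover have "\<mu> *\<^sub>R a + (- (1 - \<mu>) *\<^sub>R e + (z - \<alpha> *\<^sub>R e)) = z + (\<mu> * h - (1 - \<mu>) - \<alpha>) *\<^sub>R e"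
        by (simp add: a_def algebra_simps)
      ultimately show ?thesis by simp
    qed
    moreover have "\<mu> *\<^sub>R a + (\<Sum>i\<in>UNIV. l i *\<^sub>R b i) \<in> convex hull S"
    proof (cases "\<mu> = 1")
      \<comment> \<open>All remaining weights vanish, and the convex combination of the base
        vertices would require division by \<open>1 - \<mu>\<close>.\<close>
      case True
      then have "\<forall>i\<in>UNIV. l i = 0" using sl l0 by (simp add: sum_nonneg_eq_0_iff)
      then show ?thesis using True by (simp add: S_def hull_inc)
    next
      case False
      have "\<mu> \<le> 1" using sum_nonneg[of UNIV l] l0 sl by simp
      then have m: "1 - \<mu> > 0" using False by simp
      have "(\<Sum>i\<in>UNIV. (l i / (1 - \<mu>)) *\<^sub>R b i) \<in> convex hull S"
        using l0 m sl by (intro convex_sum convex_convex_hull)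
          (simp_all add: S_def hull_inc sum_divide_distrib[symmetric])
      moreover have "a \<in> convex hull S" by (simp add: S_def hull_inc)
      ultimately have "\<mu> *\<^sub>R a + (1 - \<mu>) *\<^sub>R (\<Sum>i\<in>UNIV. (l i / (1 - \<mu>)) *\<^sub>R b i) \<in> convex hull S"
        using \<mu> m by (intro convexD[OF convex_convex_hull]) simp_all
      then show ?thesis using m by (simp add: scaleR_sum_right)
    qed
    ultimately show "z \<in> convex hull S" by simp
  qed
  have "S \<subseteq> cball (t *\<^sub>R e) R"
  proof -

    have "norm (t *\<^sub>R e - a) = \<bar>t - h\<bar>" unfolding a_def scaleR_left_diff_distrib[symmetric] by (simp add: ne)
    then have "a \<in> cball (t *\<^sub>R e) R" using R2 d by (simp add: h_def dist_norm)
    moreover have "b i \<in> cball (t *\<^sub>R e) R" for i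
    proof -
      have eq: "t *\<^sub>R e - b i = (t + 1) *\<^sub>R e - (\<sigma> * \<kappa>) *\<^sub>R u i"
        by (simp add: b_def algebra_simps)
      have nb: "(norm (t *\<^sub>R e - b i))\<^sup>2 = (t + 1)\<^sup>2 + (\<sigma> * \<kappa>)\<^sup>2 * (1 - 1 / d)"
        unfolding eq power2_norm_eq_inner
        by (simp add: inner_diff_left inner_diff_right ue eu uu ee power2_eq_square)
      have "(\<sigma> * \<kappa>)\<^sup>2 * (1 - 1 / d) = (d - 1)\<^sup>2 * ((h + 1) / (h - 1))"
      proof -
        have "d * (d - 1) * (1 - 1 / d) = (d - 1)\<^sup>2" using d by (simp add: field_simps power2_eq_square)
        then show ?thesis unfolding sk mult.assoc[of "(h + 1) / (h - 1)"] by (simp only: mult.commute)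
      qed
      \<comment> \<open>The only inequality for the base vertices, and the place where the lower
        bound on \<open>R\<close> is spent; everything around it is an identity. If that bound is
        attained, the base vertices lie on the outer sphere too.\<close>
      also have "\<dots> \<le> ((R - 1)\<^sup>2 - t\<^sup>2) * ((h + 1) / (h - 1))"
      proof (rule mult_right_mono)
        have "sqrt (t\<^sup>2 + (d - 1)\<^sup>2) \<le> R - 1" using R by (simp add: d_def)
        then have "t\<^sup>2 + (d - 1)\<^sup>2 \<le> (R - 1)\<^sup>2" by (rule sqrt_le_D)
        then show "(d - 1)\<^sup>2 \<le> (R - 1)\<^sup>2 - t\<^sup>2" by simp
      qed (use h in simp)
      also have "\<dots> = R\<^sup>2 - (t + 1)\<^sup>2"
      proof -
        have "(R - 1)\<^sup>2 - t\<^sup>2 = (R - 1 - t) * (h - 1)" by (simp add: h_def power2_eq_square algebra_simps)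
        then have "((R - 1)\<^sup>2 - t\<^sup>2) * ((h + 1) / (h - 1)) = (R - 1 - t) * (h + 1)" using h by simp
        then show ?thesis by (simp add: h_def power2_eq_square algebra_simps)
      qed
      finally have "(norm (t *\<^sub>R e - b i))\<^sup>2 \<le> R\<^sup>2" using nb by linarith
      then have "norm (t *\<^sub>R e - b i) \<le> R" by (rule power2_le_imp_le) (use R2 d in simp)
      then show ?thesis by (simp add: dist_norm)
    qed
    ultimately show ?thesis by (auto simp: S_def)
  qed
  then have "convex hull S \<subseteq> cball (t *\<^sub>R e) R" by (intro hull_minimal convex_cball)
  then show ?thesis using fin cS hull by (intro exI[of _ S] conjI)
qed

section \<open>Scaling to arbitrary balls\<close>

lemma shifted_ball_cball:
  assumes "C > 0"
  shows "shifted_ball x C = cball x C"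
proof
  show "shifted_ball x C \<subseteq> cball x C"
    using assms by (auto simp: shifted_ball_def dist_norm mult_left_le)
  show "cball x C \<subseteq> shifted_ball x C"
  proof
    fix z assume "z \<in> cball x C"
    then have "norm (z - x) \<le> C" by (simp add: dist_norm norm_minus_commute)
    then have "(1 / C) *\<^sub>R (z - x) \<in> cball 0 1"
      unfolding mem_cball_0 norm_scaleR using assms by (simp add: divide_le_eq)
    moreover have "z = x + C *\<^sub>R ((1 / C) *\<^sub>R (z - x))" using assms by simp
    ultimately show "z \<in> shifted_ball x C" unfolding shifted_ball_def by (rule rev_image_eqI)
  qed
qed

text \<open>Translation by \<open>x\<close> and division by \<open>C1\<close> make the inner ball
  the unit ball. An orthogonal map then turns the normalised diagonal of the standard basis into the
  direction of \<open>y - x\<close>, which becomes the axis of the simplex.\<close>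

lemma simplex_between_shifted_balls:
  fixes x y :: "real^'d::finite"
  assumes d: "CARD('d) \<ge> 2" and C: "C1 > 0" "C2 > 0"
    and le: "C2 \<ge> sqrt ((norm (y - x))\<^sup>2 + C1\<^sup>2 * (real CARD('d) - 1)\<^sup>2) + C1"
  shows "\<exists>n S. n simplex S \<and> shifted_ball x C1 \<subseteq> S \<and> S \<subseteq> shifted_ball y C2"
proof -
  define t where "t = norm (y - x) / C1"
  define R where "R = C2 / C1"
  \<comment> \<open>For concentric balls \<open>t\<close> is zero and any unit vector will do as the
    axis.\<close>
  obtain g where g: "norm g = 1" "y - x = (C1 * t) *\<^sub>R g"
  proof (cases "y = x")
    case True
    then show ?thesis using that[of "axis undefined 1"] by (simp add: t_def)
  next
    case False
    then show ?thesis using that[of "(1 / norm (y - x)) *\<^sub>R (y - x)"] C by (simp add: t_def)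
  qed
  define e0 where "e0 = (1 / sqrt (real CARD('d))) *\<^sub>R (\<Sum>i\<in>UNIV. axis i (1 :: real) :: real^'d)"
  have s1: "(\<Sum>i\<in>UNIV. axis i (1 :: real) :: real^'d) = (\<chi> i. 1)"
    by (simp add: Finite_Cartesian_Product.vec_eq_iff sum_component axis_def)
  have "norm e0 = 1"
    unfolding e0_def s1 by (simp add: norm_vec_def L2_set_def power_divide)
  from orthogonal_transformation_exists_1[OF this g(1)]
  obtain f where f: "orthogonal_transformation f" "f e0 = g" by auto
  have lin: "linear f" and fi: "inner (f v) (f w) = inner v w" for v w
    using f(1) by (simp_all add: orthogonal_transformation_def)
  define p where "p i = f (axis i 1)" for i
  have pp: "inner (p i) (p j) = (if i = j then 1 else 0)" for i j
    by (simp add: p_def fi inner_axis_axis)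
  have expand: "z = (\<Sum>i\<in>UNIV. inner z (p i) *\<^sub>R p i)" for z
  proof -
    have "\<exists>w. z = f w" using orthogonal_transformation_surj[OF f(1)] by (simp add: surj_def)
    then obtain w where w: "z = f w" by (rule exE)
    have "w = (\<Sum>i\<in>UNIV. vec_nth w i *\<^sub>R axis i 1)"
      by (simp add: Finite_Cartesian_Product.vec_eq_iff sum_component axis_def if_distrib cong: if_cong)
    then have "f w = f (\<Sum>i\<in>UNIV. vec_nth w i *\<^sub>R axis i 1)" by (rule arg_cong)
    also have "\<dots> = (\<Sum>i\<in>UNIV. vec_nth w i *\<^sub>R p i)"
      by (simp add: linear_sum[OF lin] linear_cmul[OF lin] p_def)
    also have "\<dots> = (\<Sum>i\<in>UNIV. inner z (p i) *\<^sub>R p i)"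
      by (simp add: w p_def fi inner_axis)
    finally show ?thesis using w by simp
  qed
  have ge: "g = (1 / sqrt (real CARD('d))) *\<^sub>R (\<Sum>i\<in>UNIV. p i)"
    unfolding f(2)[symmetric] e0_def p_def by (simp add: linear_sum[OF lin] linear_cmul[OF lin])
  have tR: "sqrt (t\<^sup>2 + (real CARD('d) - 1)\<^sup>2) + 1 \<le> R"
  proof -
    have "(norm (y - x))\<^sup>2 + C1\<^sup>2 * (real CARD('d) - 1)\<^sup>2 = C1\<^sup>2 * (t\<^sup>2 + (real CARD('d) - 1)\<^sup>2)"
      using C by (simp add: t_def power_divide distrib_left)
    then have "sqrt ((norm (y - x))\<^sup>2 + C1\<^sup>2 * (real CARD('d) - 1)\<^sup>2) = C1 * sqrt (t\<^sup>2 + (real CARD('d) - 1)\<^sup>2)"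
      using C by (simp add: real_sqrt_mult)
    then have "C1 * (sqrt (t\<^sup>2 + (real CARD('d) - 1)\<^sup>2) + 1) \<le> C2" using le by (simp add: distrib_left)
    then show ?thesis using C by (simp add: R_def le_divide_eq mult.commute)
  qed
  have "\<exists>S. finite S \<and> card S \<le> DIM(real^'d) + 1 \<and> cball 0 1 \<subseteq> convex hull S \<and>
      convex hull S \<subseteq> cball (t *\<^sub>R ((1 / sqrt (real DIM(real^'d))) *\<^sub>R (\<Sum>i\<in>UNIV. p i))) R"
  proof (rule simplex_between_balls_unit[OF pp])
    show "z = (\<Sum>i\<in>UNIV. inner z (p i) *\<^sub>R p i)" for z by (rule expand)
  qed (use d C tR in \<open>simp_all add: t_def\<close>)
  then obtain S where S: "finite S" "card S \<le> CARD('d) + 1" "cball 0 1 \<subseteq> convex hull S"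
    "convex hull S \<subseteq> cball (t *\<^sub>R g) R"
    unfolding DIM_cart DIM_real mult_1_right ge[symmetric] by (elim exE conjE)
  define \<phi> where "\<phi> = (\<lambda>z. x + C1 *\<^sub>R z)"
  have hull: "convex hull (\<phi> ` S) = \<phi> ` (convex hull S)"
    unfolding \<phi>_def by (rule convex_hull_affinity)
  have in1: "shifted_ball x C1 \<subseteq> convex hull (\<phi> ` S)"
    unfolding hull unfolding shifted_ball_def \<phi>_def by (rule image_mono[OF S(3)])
  have in2: "convex hull (\<phi> ` S) \<subseteq> shifted_ball y C2"
    unfolding hull shifted_ball_cball[OF C(2)]
  proof (rule image_subsetI)
    fix z assume "z \<in> convex hull S"
    then have "norm (t *\<^sub>R g - z) \<le> R" using S(4) by (auto simp: dist_norm)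
    moreover have "y - \<phi> z = C1 *\<^sub>R (t *\<^sub>R g - z)" using g(2) by (simp add: \<phi>_def algebra_simps)
    ultimately have "norm (y - \<phi> z) \<le> C1 * R" using C(1) by simp
    then show "\<phi> z \<in> cball y C2" using C(1) by (simp add: dist_norm R_def)
  qed
  have "int DIM(real^'d) simplex convex hull (\<phi> ` S)"
  proof (rule simplex_if_ball_subset)
    show "cball x C1 \<subseteq> convex hull (\<phi> ` S)" using in1 unfolding shifted_ball_cball[OF C(1)] .
    show "card (\<phi> ` S) \<le> DIM(real^'d) + 1"
      using card_image_le[OF S(1), of \<phi>] S(2) by simp
  qed (use S(1) C(1) in simp_all)
  then show ?thesis using in1 in2 by (intro exI conjI)
qed

section \<open>Barycentric coordinates as affine functions\<close>

text \<open>The differences of the other points from \<open>c\<close> are linearly independent, so a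
  linear form with value \<open>- 1\<close> on all of them exists. Its representing vector is
  \<open>b\<close>, and \<open>1 - inner b c\<close> normalises the value at
  \<open>c\<close>.\<close>

lemma affine_coordinate:
  fixes C :: "'a::euclidean_space set"
  assumes "\<not> affine_dependent C" "c \<in> C"
  shows "\<exists>b0 b. \<forall>c'\<in>C. b0 + inner b c' = (if c' = c then 1 else 0)"
proof -
  have "independent ((\<lambda>x. - c + x) ` (C - {c}))"
    using assms affine_dependent_iff_dependent2 by auto
  from linear_independent_extend[OF this, of "\<lambda>_. - 1 :: real"]
  obtain g :: "'a \<Rightarrow> real" where "linear g \<and> (\<forall>v\<in>(\<lambda>x. - c + x) ` (C - {c}). g v = - 1)"
    by (rule exE)
  then have g: "linear g" "\<forall>v\<in>(\<lambda>x. - c + x) ` (C - {c}). g v = - 1" by (rule conjunct1, rule conjunct2)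
  define b where "b = adjoint g 1"
  have gb: "inner b v = g v" for v
    using adjoint_works[OF g(1), of v 1] by (simp add: b_def inner_commute)
  have "(1 - inner b c) + inner b c' = (if c' = c then 1 else 0)" if c': "c' \<in> C" for c'
  proof (cases "c' = c")
    case False
    then have "- c + c' \<in> (\<lambda>x. - c + x) ` (C - {c})" by (intro imageI) (use c' False in simp)
    then have "g (- c + c') = - 1" by (rule g(2)[rule_format])
    then show ?thesis using False gb[of "- c + c'"] by (simp add: inner_diff_right)
  qed simp
  then show ?thesis by (intro exI[of _ "1 - inner b c"] exI[of _ b] ballI)
qed

lemma simplex_coordinates:
  fixes C :: "'a::euclidean_space set"
  assumes "\<not> affine_dependent C"
  shows "\<exists>b0 b. \<forall>z\<in>convex hull C. (\<forall>c\<in>C. 0 \<le> b0 c + inner (b c) z) \<and>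
    (\<Sum>c\<in>C. b0 c + inner (b c) z) = 1 \<and> (\<Sum>c\<in>C. (b0 c + inner (b c) z) *\<^sub>R c) = z"
proof -
  have fin: "finite C" using assms by (rule aff_independent_finite)
  have "\<forall>c\<in>C. \<exists>b0 b. \<forall>c'\<in>C. b0 + inner b c' = (if c' = c then 1 else 0)"
    by (rule ballI) (rule affine_coordinate[OF assms])
  then obtain b0 b where b: "\<forall>c\<in>C. \<forall>c'\<in>C. b0 c + inner (b c) c' = (if c' = c then 1 else 0)"
    by (metis (no_types))
  have "(\<forall>c\<in>C. 0 \<le> b0 c + inner (b c) z) \<and>
    (\<Sum>c\<in>C. b0 c + inner (b c) z) = 1 \<and> (\<Sum>c\<in>C. (b0 c + inner (b c) z) *\<^sub>R c) = z"
    if z: "z \<in> convex hull C" for z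
  proof -
    obtain u where u: "\<forall>c\<in>C. 0 \<le> u c" "sum u C = 1" "(\<Sum>c\<in>C. u c *\<^sub>R c) = z"
      using z unfolding convex_hull_finite[OF fin] mem_Collect_eq by (elim exE conjE)
    have eq: "b0 c + inner (b c) z = u c" if c: "c \<in> C" for c
    proof -
      have "b0 c + inner (b c) z = (\<Sum>c'\<in>C. u c' * (b0 c + inner (b c) c'))"
        unfolding u(3)[symmetric] inner_sum_right distrib_left sum.distrib
        by (simp add: u(2) flip: sum_distrib_right)
      also have "\<dots> = (\<Sum>c'\<in>C. if c' = c then u c' else 0)"
        by (rule sum.cong[OF refl]) (simp add: b[rule_format, OF c])
      finally show ?thesis using c fin by simp
    qed
    then show ?thesis using u by simp
  qed
  then show ?thesis by (intro exI[of _ b0] exI[of _ b] ballI)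
qed

text \<open>Identities known at the points of a ball become identities of coefficients; only in that
  form can matrices be put in place of the variables.\<close>

lemma affine_zero_on_ball:
  fixes x :: "real^'d::finite"
  assumes C: "C > 0" and 0: "\<And>z. z \<in> shifted_ball x C \<Longrightarrow> a0 + (\<Sum>i\<in>UNIV. a i * vec_nth z i) = 0"
  shows "a0 = 0" "a i = 0"
proof -
  have x: "a0 + (\<Sum>i\<in>UNIV. a i * vec_nth x i) = 0"
    by (rule 0) (auto simp: shifted_ball_def intro!: image_eqI[of _ _ 0])
  have a: "a i = 0" for i
  proof -
    have "x + C *\<^sub>R axis i 1 \<in> shifted_ball x C" unfolding shifted_ball_def by (rule imageI) simp
    from 0[OF this] have "a0 + (\<Sum>j\<in>UNIV. a j * vec_nth x j) + (\<Sum>j\<in>UNIV. a j * (C * vec_nth (axis i 1) j)) = 0"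
      by (simp add: distrib_left sum.distrib)
    moreover have "(\<Sum>j\<in>UNIV. a j * (C * vec_nth (axis i 1) j)) = (\<Sum>j\<in>UNIV. if j = i then a j * C else 0)"
      by (rule sum.cong[OF refl]) (simp add: axis_def)
    ultimately show ?thesis using x C by simp
  qed
  then show "a i = 0" .
  show "a0 = 0" using x by (simp add: a)
qed

section \<open>Factoring positive semidefinite forms\<close>

text \<open>Cholesky elimination of the last index. The vanishing of \<open>B\<close> beyond
  \<open>k\<close> passes to the Schur complement, so the induction needs no change of index set and
  the identity holds for all indices.\<close>

lemma psd_factor:
  fixes B :: "nat \<Rightarrow> nat \<Rightarrow> complex"
  assumes "\<And>p q. B q p = cnj (B p q)"
    and "\<And>u. 0 \<le> Re (\<Sum>p<k. \<Sum>q<k. B p q * u q * cnj (u p))"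
    and "\<And>p q. k \<le> p \<Longrightarrow> B p q = 0"
  shows "\<exists>F. \<forall>p q. B p q = (\<Sum>l<k. cnj (F l p) * F l q)"
  using assms
proof (induction k arbitrary: B)
  case 0
  then show ?case by simp
next
  case (Suc k)
  note herm = Suc.prems(1) and pos = Suc.prems(2) and zero = Suc.prems(3)
  define s where "s u = (\<Sum>q<k. B k q * u q)" for u :: "nat \<Rightarrow> complex"
  have Bkk: "B k k = complex_of_real (Re (B k k))"
    using arg_cong[OF herm[of k k], of Im] by (simp add: complex_eq_iff)
  have form: "Re (\<Sum>p<Suc k. \<Sum>q<Suc k. B p q * u q * cnj (u p))
      = Re (\<Sum>p<k. \<Sum>q<k. B p q * u q * cnj (u p)) + 2 * Re (s u * cnj (u k)) + Re (B k k) * (cmod (u k))\<^sup>2" for u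
  proof -
    have "(\<Sum>p<k. B p k * u k * cnj (u p)) = cnj (s u * cnj (u k))"
      unfolding s_def by (simp add: sum_distrib_right) (rule sum.cong[OF refl], simp add: herm[of k] mult_ac)
    moreover have "(\<Sum>q<k. B k q * u q * cnj (u k)) = s u * cnj (u k)"
      by (simp add: s_def sum_distrib_right)
    moreover have "Re (B k k * u k * cnj (u k)) = Re (B k k) * (cmod (u k))\<^sup>2"
      by (subst Bkk) (simp add: mult.assoc complex_norm_square[symmetric] del: of_real_power)
    ultimately show ?thesis by (simp add: sum.distrib)
  qed
  have form': "0 \<le> Re (\<Sum>p<k. \<Sum>q<k. B p q * u q * cnj (u p)) + 2 * Re (s u * cnj t) + Re (B k k) * (cmod t)\<^sup>2" for u t
  proof -
    have "s (u(k := t)) = s u" unfolding s_def by (rule sum.cong[OF refl]) simp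
    moreover have "(\<Sum>p<k. \<Sum>q<k. B p q * (u(k := t)) q * cnj ((u(k := t)) p)) = (\<Sum>p<k. \<Sum>q<k. B p q * u q * cnj (u p))"
      by (rule sum.cong[OF refl], rule sum.cong[OF refl]) simp
    ultimately show ?thesis using pos[of "u(k := t)"] form[of "u(k := t)"] by simp
  qed
  have B0: "0 \<le> Re (B k k)" using form'[of "\<lambda>_. 0" 1] by (simp add: s_def)
  define b where "b = Re (B k k)"
  show ?case
  proof (cases "b = 0")
    case True
    have s0: "s u = 0" for u
    proof (rule ccontr)
      assume "s u \<noteq> 0"
      then have n: "(cmod (s u))\<^sup>2 > 0" by simp
      define Q where "Q = Re (\<Sum>p<k. \<Sum>q<k. B p q * u q * cnj (u p))"
      \<comment> \<open>Large enough for \<open>2 * r * (cmod (s u))\<^sup>2\<close> to exceed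
        \<open>\<bar>Q\<bar>\<close>. With a zero pivot, a nonzero row would thus make the form
        negative.\<close>
      define r where "r = (\<bar>Q\<bar> + 1) / (cmod (s u))\<^sup>2"
      have "0 \<le> Q + 2 * Re (s u * cnj (- of_real r * s u))"
        using form'[of u "- of_real r * s u"] True by (simp add: Q_def b_def)
      also have "s u * cnj (- of_real r * s u) = complex_of_real (- (r * (cmod (s u))\<^sup>2))"
        using complex_norm_square[of "s u"] by (simp add: mult_ac)
      also have "r * (cmod (s u))\<^sup>2 = \<bar>Q\<bar> + 1" using n by (simp add: r_def)
      finally show False by simp
    qed
    have Bk: "B k q = 0" for q
    proof (cases "q < k")
      case True
      have "s (\<lambda>i. if i = q then 1 else 0) = (\<Sum>i<k. if i = q then B k i else 0)"
        unfolding s_def by (rule sum.cong[OF refl]) simp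
      then show ?thesis using s0[of "\<lambda>i. if i = q then 1 else 0"] True by simp
    next
      case False
      then consider "q = k" | "Suc k \<le> q" by linarith
      then show ?thesis
      proof cases
        case 1 then show ?thesis using Bkk True by (simp add: b_def)
      next
        case 2 then show ?thesis using zero[of q k] herm[of q k] by simp
      qed
    qed
    have "\<exists>F. \<forall>p q. B p q = (\<Sum>l<k. cnj (F l p) * F l q)"
    proof (rule Suc.IH[OF herm])
      fix u show "0 \<le> Re (\<Sum>p<k. \<Sum>q<k. B p q * u q * cnj (u p))"
        using form'[of u 0] by simp
    next
      fix p q assume "k \<le> p"
      then show "B p q = 0" using Bk zero[of p q] by (cases "p = k") simp_all
    qed
    then obtain F where F: "\<forall>p q. B p q = (\<Sum>l<k. cnj (F l p) * F l q)" by (rule exE)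
    have "B p q = (\<Sum>l<Suc k. cnj ((F(k := (\<lambda>_. 0))) l p) * (F(k := (\<lambda>_. 0))) l q)" for p q
    proof -
      have "(\<Sum>l<k. cnj ((F(k := (\<lambda>_. 0))) l p) * (F(k := (\<lambda>_. 0))) l q) = B p q"
        unfolding F[rule_format] by (rule sum.cong[OF refl]) simp
      then show ?thesis by simp
    qed
    then show ?thesis by (intro exI[of _ "F(k := (\<lambda>_. 0))"] allI)
  next
    case False
    then have b: "b > 0" using B0 by (simp add: b_def)
    have Bkkb: "B k k = of_real b" using Bkk by (simp add: b_def)
    \<comment> \<open>The Schur complement of the pivot \<open>b\<close>.\<close>
    define B' where "B' p q = B p q - B p k * B k q / of_real b" for p q
    have "\<exists>F. \<forall>p q. B' p q = (\<Sum>l<k. cnj (F l p) * F l q)"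
    proof (rule Suc.IH)
      fix p q show "B' q p = cnj (B' p q)"
        using herm[of q p] herm[of p k] herm[of k q] by (simp add: B'_def mult.commute)
    next
      fix u
      have cs: "(\<Sum>p<k. B p k * cnj (u p)) = cnj (s u)"
        unfolding s_def by (simp, rule sum.cong[OF refl], simp add: herm[of k])
      have "(\<Sum>p<k. \<Sum>q<k. B' p q * u q * cnj (u p))
          = (\<Sum>p<k. \<Sum>q<k. B p q * u q * cnj (u p) - (B p k * cnj (u p)) * (B k q * u q) / of_real b)"
        by (rule sum.cong[OF refl], rule sum.cong[OF refl]) (simp add: B'_def algebra_simps)
      also have "\<dots> = (\<Sum>p<k. \<Sum>q<k. B p q * u q * cnj (u p)) - cnj (s u) * s u / of_real b"
        unfolding sum_subtractf sum_divide_distrib[symmetric] sum_product[symmetric] cs s_def[symmetric] ..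
      also have "cnj (s u) * s u / of_real b = of_real ((cmod (s u))\<^sup>2 / b)"
        using complex_norm_square[of "s u"] by (simp add: mult.commute)
      finally have eq: "Re (\<Sum>p<k. \<Sum>q<k. B' p q * u q * cnj (u p))
          = Re (\<Sum>p<k. \<Sum>q<k. B p q * u q * cnj (u p)) - (cmod (s u))\<^sup>2 / b" by simp
      \<comment> \<open>The last coordinate \<open>- s u / b\<close> minimises the full form for
        given \<open>u\<close>, and the minimum is the form of \<open>B'\<close>.\<close>
      have "s u * cnj (- s u / of_real b) = complex_of_real (- ((cmod (s u))\<^sup>2 / b))"
        using complex_norm_square[of "s u"] by simp
      then have "Re (s u * cnj (- s u / of_real b)) = - ((cmod (s u))\<^sup>2 / b)"
        by (simp only: Re_complex_of_real)
      moreover have "b * (cmod (- s u / of_real b))\<^sup>2 = (cmod (s u))\<^sup>2 / b"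
        using b by (simp add: norm_divide power_divide power2_eq_square)
      ultimately show "0 \<le> Re (\<Sum>p<k. \<Sum>q<k. B' p q * u q * cnj (u p))"
        unfolding eq using form'[of u "- s u / of_real b"] unfolding b_def[symmetric] by linarith
    next
      fix p q assume "k \<le> p"
      then consider "p = k" | "Suc k \<le> p" by linarith
      then show "B' p q = 0"
      proof cases
        case 1 then show ?thesis using b by (simp add: B'_def Bkkb)
      next
        case 2 then show ?thesis using zero[of p] by (simp add: B'_def)
      qed
    qed
    then obtain F where F: "\<forall>p q. B' p q = (\<Sum>l<k. cnj (F l p) * F l q)" by (rule exE)
    \<comment> \<open>The new row restores the rank-one term that was subtracted in
      \<open>B'\<close>.\<close>
    define G where "G = F(k := (\<lambda>q. B k q / of_real (sqrt b)))"
    have "B p q = (\<Sum>l<Suc k. cnj (G l p) * G l q)" for p q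
    proof -
      have "(\<Sum>l<k. cnj (G l p) * G l q) = B' p q"
        unfolding F[rule_format] G_def by (rule sum.cong[OF refl]) simp
      moreover have "cnj (G k p) * G k q = B p k * B k q / of_real b"
      proof -
        have sb: "complex_of_real (sqrt b) * of_real (sqrt b) = of_real b"
          using b by (simp only: of_real_mult[symmetric]) simp
        have "cnj (G k p) * G k q = cnj (B k p) * B k q / (complex_of_real (sqrt b) * of_real (sqrt b))"
          by (simp add: G_def)
        moreover have "cnj (B k p) = B p k" by (rule herm[symmetric])
        ultimately show ?thesis unfolding sb by simp
      qed
      ultimately show ?thesis by (simp add: B'_def)
    qed
    then show ?thesis by (intro exI[of _ G] allI)
  qed
qed

section \<open>Dilations from simplices\<close>

text \<open>The dilations in \<open>Wmin_level\<close> live on functions on the fixed type \<open>'i\<close>, so the finite index set is moved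
  into \<open>'i\<close> by an injection.\<close>

definition coord_space :: "('a \<Rightarrow> 'i) \<Rightarrow> 'a set \<Rightarrow> 'i hspace" where
  "coord_space \<iota> I = \<lparr>car = {u. \<forall>i. i \<notin> \<iota> ` I \<longrightarrow> u i = 0}, ip = (\<lambda>u v. \<Sum>r\<in>I. u (\<iota> r) * cnj (v (\<iota> r)))\<rparr>"

locale coords =
  fixes \<iota> :: "'a \<Rightarrow> 'i" and I :: "'a set"
  assumes inj: "inj \<iota>" and fin: "finite I"
begin

abbreviation "E \<equiv> coord_space \<iota> I"

lemma car_E: "u \<in> car E \<longleftrightarrow> (\<forall>i. i \<notin> \<iota> ` I \<longrightarrow> u i = 0)"
  by (simp add: coord_space_def)

lemma ip_E: "ip E u v = (\<Sum>r\<in>I. u (\<iota> r) * cnj (v (\<iota> r)))"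
  by (simp add: coord_space_def)

lemma ip_E_self: "ip E u u = complex_of_real (\<Sum>r\<in>I. (cmod (u (\<iota> r)))\<^sup>2)"
  by (simp add: ip_E complex_norm_square del: of_real_power)

lemma hnorm_E: "hnorm E u = sqrt (\<Sum>r\<in>I. (cmod (u (\<iota> r)))\<^sup>2)"
  by (simp add: hnorm_def ip_E_self)

lemma E_eqI: "u \<in> car E \<Longrightarrow> v \<in> car E \<Longrightarrow> (\<And>r. r \<in> I \<Longrightarrow> u (\<iota> r) = v (\<iota> r)) \<Longrightarrow> u = v"
proof
  fix i assume uv: "u \<in> car E" "v \<in> car E" "\<And>r. r \<in> I \<Longrightarrow> u (\<iota> r) = v (\<iota> r)"
  show "u i = v i"
  proof (cases "i \<in> \<iota> ` I")
    case True
    then obtain r where "i = \<iota> r" "r \<in> I" by (rule imageE)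
    then show ?thesis using uv(3) by simp
  qed (use uv(1,2) in \<open>simp add: car_E\<close>)
qed

lemma inner_product_space_E: "inner_product_space E"
  unfolding inner_product_space_def
proof (intro conjI ballI allI impI)
  fix u assume u: "u \<in> car E" and "ip E u u = 0"
  then have "(\<Sum>r\<in>I. (cmod (u (\<iota> r)))\<^sup>2) = 0" by (simp only: ip_E_self of_real_eq_0_iff)
  then have "u (\<iota> r) = 0" if "r \<in> I" for r using that fin by (simp add: sum_nonneg_eq_0_iff)
  then show "u = 0" by (intro E_eqI[OF u]) (simp_all add: car_E)
next
  fix u assume "u \<in> car E"
  show "0 \<le> Re (ip E u u)" by (simp add: ip_E_self sum_nonneg)
qed (simp_all add: car_E ip_E scaleC_def distrib_right sum.distrib sum_distrib_left mult.assoc,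
     simp add: mult.commute)

sublocale ips E
  by unfold_locales (rule inner_product_space_E)

lemma coord_le_hnorm: "r \<in> I \<Longrightarrow> cmod (u (\<iota> r)) \<le> hnorm E u"
  unfolding hnorm_E
  by (intro real_le_rsqrt) (simp add: member_le_sum[of r I "\<lambda>r. (cmod (u (\<iota> r)))\<^sup>2"] fin)

lemma hilbert_space_E: "hilbert_space E"
  unfolding hilbert_space_def
proof (intro conjI allI impI inner_product_space_E)
  fix X :: "nat \<Rightarrow> 'i \<Rightarrow> complex"
  assume X: "(\<forall>n. X n \<in> car E) \<and> (\<forall>e>0. \<exists>M. \<forall>m\<ge>M. \<forall>n\<ge>M. hnorm E (X m - X n) < e)"
  have Cauchy: "Cauchy (\<lambda>n. X n (\<iota> r))" if r: "r \<in> I" for r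
  proof (rule CauchyI)
    fix e :: real assume "e > 0"
    then obtain M where M: "\<forall>m\<ge>M. \<forall>n\<ge>M. hnorm E (X m - X n) < e" using X by auto
    have "norm (X m (\<iota> r) - X n (\<iota> r)) < e" if "m \<ge> M" "n \<ge> M" for m n
      using coord_le_hnorm[OF r, of "X m - X n"] M[rule_format, OF that] by simp
    then show "\<exists>M. \<forall>m\<ge>M. \<forall>n\<ge>M. norm (X m (\<iota> r) - X n (\<iota> r)) < e" by (intro exI allI impI)
  qed
  have "\<forall>r\<in>I. \<exists>c. (\<lambda>n. X n (\<iota> r)) \<longlonglongrightarrow> c"
  proof
    fix r assume "r \<in> I"
    from Cauchy_convergent[OF Cauchy[OF this]] show "\<exists>c. (\<lambda>n. X n (\<iota> r)) \<longlonglongrightarrow> c"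
      unfolding convergent_def .
  qed
  then obtain c where c: "\<forall>r\<in>I. (\<lambda>n. X n (\<iota> r)) \<longlonglongrightarrow> c r" by (rule bchoice[THEN exE])
  define l where "l = (\<lambda>i. if i \<in> \<iota> ` I then c (inv_into UNIV \<iota> i) else 0)"
  have l: "l \<in> car E" "\<And>r. r \<in> I \<Longrightarrow> l (\<iota> r) = c r"
    using inj by (simp_all add: l_def car_E)
  have "(\<lambda>n. sqrt (\<Sum>r\<in>I. (cmod (X n (\<iota> r) - c r))\<^sup>2)) \<longlonglongrightarrow> sqrt (\<Sum>r\<in>I. (cmod (c r - c r))\<^sup>2)"
    by (intro tendsto_intros) (use c in simp)
  moreover have "hnorm E (X n - l) = sqrt (\<Sum>r\<in>I. (cmod (X n (\<iota> r) - c r))\<^sup>2)" for n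
    unfolding hnorm_E using l(2) by (intro arg_cong[of _ _ sqrt] sum.cong) simp_all
  ultimately have "(\<lambda>n. hnorm E (X n - l)) \<longlonglongrightarrow> 0" by simp
  then show "\<exists>l\<in>car E. (\<lambda>n. hnorm E (X n - l)) \<longlonglongrightarrow> 0" using l(1) by (rule bexI)
qed

definition mul :: "('a \<Rightarrow> complex) \<Rightarrow> 'i hop" where
  "mul f u = (if u \<in> car E then (\<lambda>i. f (inv_into UNIV \<iota> i) * u i) else 0)"

lemma mul_coord: "u \<in> car E \<Longrightarrow> mul f u (\<iota> r) = f r * u (\<iota> r)"
  using inj by (simp add: mul_def)

lemma mul_car: "mul f u \<in> car E"
  by (simp add: mul_def car_E)

lemma mul_bop: "mul f \<in> bounded_ops E E"
proof (rule bopI)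
  fix u assume u: "u \<in> car E"
  let ?b = "\<Sum>r\<in>I. cmod (f r)"
  have b: "cmod (f r) \<le> ?b" if "r \<in> I" for r using that fin by (intro member_le_sum) simp_all
  have "(\<Sum>r\<in>I. (cmod (mul f u (\<iota> r)))\<^sup>2) \<le> (\<Sum>r\<in>I. ?b\<^sup>2 * (cmod (u (\<iota> r)))\<^sup>2)"
    unfolding mul_coord[OF u] norm_mult power_mult_distrib
    using b by (intro sum_mono mult_right_mono power_mono) simp_all
  also have "\<dots> = ?b\<^sup>2 * (\<Sum>r\<in>I. (cmod (u (\<iota> r)))\<^sup>2)" by (simp add: sum_distrib_left)
  finally have "hnorm E (mul f u) \<le> sqrt (?b\<^sup>2 * (\<Sum>r\<in>I. (cmod (u (\<iota> r)))\<^sup>2))"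
    unfolding hnorm_E by (rule real_sqrt_le_mono)
  also have "\<dots> = ?b * hnorm E u" by (simp add: hnorm_E real_sqrt_mult sum_nonneg)
  finally show "hnorm E (mul f u) \<le> ?b * hnorm E u" .
qed (auto simp: mul_def car_E scaleC_def fun_eq_iff distrib_left mult.left_commute)

lemma mul_cong: "(\<And>r. r \<in> I \<Longrightarrow> f r = g r) \<Longrightarrow> mul f = mul g"
proof (rule op_eqI[OF mul_bop mul_bop])
  fix u assume fg: "\<And>r. r \<in> I \<Longrightarrow> f r = g r" and u: "u \<in> car E"
  show "mul f u = mul g u"
    by (rule E_eqI[OF mul_car mul_car]) (simp add: mul_coord[OF u] fg)
qed

lemma mul_comp: "mul f \<circ> mul g = mul (\<lambda>r. f r * g r)"
proof (rule op_eqI[OF bop_comp[OF mul_bop mul_bop] mul_bop])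
  fix u assume u: "u \<in> car E"
  show "(mul f \<circ> mul g) u = mul (\<lambda>r. f r * g r) u"
    unfolding comp_apply
    by (rule E_eqI[OF mul_car mul_car]) (simp add: mul_coord[OF u] mul_coord[OF mul_car])
qed

lemma mul_one: "mul (\<lambda>r. 1) = id_op E"
  by (simp add: fun_eq_iff mul_def id_op_def)

lemma mul_zero: "mul (\<lambda>r. 0) = scale_op 0 (id_op E)"
  by (simp add: fun_eq_iff mul_def scale_op_def scaleC_def)

lemma mul_diff_const: "mul (\<lambda>r. f r - c) = mul f + scale_op (- c) (id_op E)"
  by (rule ext) (auto simp: fun_eq_iff mul_def scale_op_def scaleC_def id_op_def algebra_simps)

lemma mul_adjoint: "is_adjoint E E (mul f) (mul (\<lambda>r. cnj (f r)))"
  unfolding is_adjoint_def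
  by (intro conjI ballI mul_bop) (simp add: ip_E mul_coord mult_ac)

lemma normal_tuple_mul: "normal_tuple E (\<lambda>j. mul (f j))"
  unfolding normal_tuple_def normal_op_def
proof (intro conjI allI mul_bop)
  fix j k
  show "\<exists>S. is_adjoint E E (mul (f j)) S \<and> S \<circ> mul (f j) = mul (f j) \<circ> S"
    by (rule exI[of _ "mul (\<lambda>r. cnj (f j r))"]) (simp add: mul_adjoint mul_comp mult.commute)
  show "mul (f j) \<circ> mul (f k) = mul (f k) \<circ> mul (f j)" by (simp add: mul_comp mult.commute)
qed

text \<open>Otherwise every \<open>r\<close> has a coordinate \<open>j r\<close> with \<open>h (N (j r)) \<noteq> f (j r) r\<close>, and the product over
  \<open>r\<close> of the operators \<open>N (j r) - f (j r) r\<close> vanishes, although \<open>h\<close> does not vanish on it.\<close>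

lemma joint_spectrum_mul:
  fixes f :: "'d::finite \<Rightarrow> 'a \<Rightarrow> complex"
  assumes "z \<in> joint_spectrum E (\<lambda>j. mul (f j))"
  shows "\<exists>r\<in>I. z = (\<chi> j. f j r)"
proof (rule ccontr)
  let ?B = "cstar_gen E (\<lambda>j. mul (f j))"
  assume no: "\<not> ?thesis"
  obtain h where z: "z = (\<chi> j. h (mul (f j)))" and h: "character_on E ?B h"
    using assms unfolding joint_spectrum_def by (elim CollectE exE conjE)
  have lin: "linear_functional_on ?B h" and hm: "\<And>S T. S \<in> ?B \<Longrightarrow> T \<in> ?B \<Longrightarrow> h (S \<circ> T) = h S * h T"
    and h1: "h (id_op E) = 1"
    using h by (simp_all add: character_on_def)
  have "\<forall>r\<in>I. \<exists>j. h (mul (f j)) \<noteq> f j r"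
  proof (rule ballI, rule ccontr)
    fix r assume r: "r \<in> I" and "\<not> (\<exists>j. h (mul (f j)) \<noteq> f j r)"
    then have "z = (\<chi> j. f j r)" using z by simp
    then show False using no r by blast
  qed
  then obtain j where j: "\<forall>r\<in>I. h (mul (f (j r))) \<noteq> f (j r) r" by (rule bchoice[THEN exE])
  have prod: "mul (\<lambda>s. \<Prod>r\<in>J. f (j r) s - f (j r) r) \<in> ?B \<and> h (mul (\<lambda>s. \<Prod>r\<in>J. f (j r) s - f (j r) r)) \<noteq> 0"
    if "J \<subseteq> I" for J
    using finite_subset[OF that fin] that
  proof (induction J rule: finite_induct)
    case empty
    then show ?case using cstar_gen_id[of E "\<lambda>j. mul (f j)"] h1 by (simp add: mul_one)
  next
    case (insert r J)
    let ?T = "mul (\<lambda>s. \<Prod>r\<in>J. f (j r) s - f (j r) r)" and ?N = "mul (f (j r))"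
    let ?S = "?N + scale_op (- f (j r) r) (id_op E)"
    have T: "?T \<in> ?B" "h ?T \<noteq> 0" using insert by simp_all
    have N: "?N \<in> ?B" by (rule cstar_gen_generator)
    have c: "scale_op (- f (j r) r) (id_op E) \<in> ?B" by (rule cstar_gen_scale[OF cstar_gen_id])
    have S: "?S \<in> ?B" by (rule cstar_gen_add[OF N c])
    have "h ?S = h ?N - f (j r) r"
      using linear_functional_onD(1)[OF lin N c] linear_functional_onD(2)[OF lin cstar_gen_id] h1 by simp
    then have "h ?S \<noteq> 0" using j insert(4) by simp
    then have "h (?S \<circ> ?T) \<noteq> 0" unfolding hm[OF S T(1)] using T(2) by simp
    moreover have eq: "mul (\<lambda>s. \<Prod>r\<in>insert r J. f (j r) s - f (j r) r) = ?S \<circ> ?T"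
      unfolding mul_diff_const[symmetric] mul_comp using insert(1,2) by simp
    ultimately show ?case unfolding eq using cstar_gen_comp[OF S T(1)] by (intro conjI)
  qed
  \<comment> \<open>At each index \<open>s\<close> the factor with \<open>r = s\<close> is
    zero.\<close>
  have "mul (\<lambda>s. \<Prod>r\<in>I. f (j r) s - f (j r) r) = mul (\<lambda>s. 0)"
    by (rule mul_cong) (use fin in \<open>auto intro!: prod_zero\<close>)
  moreover have "h (scale_op 0 (id_op E)) = 0"
    using linear_functional_onD(2)[OF lin cstar_gen_id, of 0] by simp
  ultimately show False using prod[OF order_refl] unfolding mul_zero by simp
qed

end

section \<open>Vector states and the numerical range\<close>

lemma vector_state:
  assumes u: "u \<in> car (cspace n)" "hnorm (cspace n) u = 1"
  shows "(\<chi> j. ip (cspace n) (A j u) u) \<in> W1 (cspace n) A"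
proof -
  let ?B = "cstar_gen (cspace n) A" and ?\<phi> = "\<lambda>T. ip (cspace n) (T u) u"
  have "state_on (cspace n) ?B ?\<phi>"
    unfolding state_on_def linear_functional_on_def
  proof (intro conjI ballI allI impI)
    show "ip (cspace n) ((S + T) u) u = ip (cspace n) (S u) u + ip (cspace n) (T u) u" for S T
      by (simp add: cspace_ip distrib_right sum.distrib)
    show "ip (cspace n) (scale_op c T u) u = c * ip (cspace n) (T u) u" for c T
      by (simp add: cspace_ip scale_op_def scaleC_def sum_distrib_left mult.assoc)
    show "ip (cspace n) (id_op (cspace n) u) u = 1"
      using u by (simp add: id_op_def cspace.ip_self)
    fix T S assume adj: "is_adjoint (cspace n) (cspace n) T S"
    note Sb = cspace.adjoint_bop[OF adj]
    show "0 \<le> ip (cspace n) ((S \<circ> T) u) u"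
    \<comment> \<open>Only \<open>S\<close> is known to be bounded from the adjoint relation; if
      \<open>T u\<close> leaves the carrier, \<open>S\<close> sends it to zero.\<close>
    proof (cases "T u \<in> car (cspace n)")
      case True
      have "ip (cspace n) (T u) (T u) = ip (cspace n) u (S (T u))" by (rule cspace.adjoint_ip[OF adj u(1) True])
      then have "ip (cspace n) (S (T u)) u = cnj (ip (cspace n) (T u) (T u))"
        using cspace.ip_cnj[OF u(1) cspace.op_car[OF Sb True]] by simp
      then show ?thesis using True by (simp add: cspace.ip_self less_eq_complex_def)
    next
      case False
      then have "S (T u) = 0" by (rule cspace.op_outside[OF Sb])
      then show ?thesis by (simp add: cspace_ip)
    qed
  qed
  then show ?thesis unfolding W1_def by (intro CollectI exI[of _ ?\<phi>] conjI refl)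
qed

text \<open>Vector states are the only states needed for positivity of matrices. The factor
  \<open>hnorm\<close> squared admits vectors of any length, and nonemptiness of \<open>K\<close>
  supplies a point for the zero vector.\<close>

lemma Wmax_numerical_range:
  fixes K :: "(real^'d::finite) set"
  assumes X: "X \<in> Wmax_level n K" and K: "K \<noteq> {}" and u: "u \<in> car (cspace n)"
  shows "\<exists>z\<in>K. \<forall>j. ip (cspace n) (mat_op (X j) u) u = complex_of_real ((hnorm (cspace n) u)\<^sup>2 * vec_nth z j)"
proof (cases "u = 0")
  case True
  then show ?thesis using K by (auto simp: cspace_ip)
next
  case False
  have sa: "X \<in> sa_tuples n" and W: "W1 (cspace n) (\<lambda>j. mat_op (X j)) \<subseteq> complexify K"
    using X by (simp_all add: Wmax_level_def)
  from cspace.ex_unit_multiple[OF u False] obtain k where k: "hnorm (cspace n) (scaleC k u) = 1"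
    "cmod k = 1 / hnorm (cspace n) u" "hnorm (cspace n) u > 0" by (elim exE conjE)
  from vector_state[OF cspace.car_scaleC[OF u] k(1), of "\<lambda>j. mat_op (X j)"]
  have "(\<chi> j. ip (cspace n) (mat_op (X j) (scaleC k u)) (scaleC k u)) \<in> complexify K"
    using W by (rule subsetD[rotated])
  then obtain z where z: "z \<in> K"
    "(\<chi> j. ip (cspace n) (mat_op (X j) (scaleC k u)) (scaleC k u)) = (\<chi> j. complex_of_real (vec_nth z j))"
    unfolding complexify_def by (elim imageE)
  have "ip (cspace n) (mat_op (X j) u) u = complex_of_real ((hnorm (cspace n) u)\<^sup>2 * vec_nth z j)" for j
  proof -
    have b: "mat_op (X j) \<in> bounded_ops (cspace n) (cspace n)"
      unfolding mat_op_ent[OF sa_tuplesD(1)[OF sa]] by (rule ent_bop)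
    have "ip (cspace n) (mat_op (X j) (scaleC k u)) (scaleC k u)
        = (k * cnj k) * ip (cspace n) (mat_op (X j) u) u"
      using u cspace.op_car[OF b u]
      by (simp add: cspace.op_scaleC[OF b u] cspace.ip_scaleC_left cspace.ip_scaleC_right)
    also have "k * cnj k = complex_of_real (1 / (hnorm (cspace n) u)\<^sup>2)"
      using complex_norm_square[of k] k(2) by (simp add: power_divide)
    finally have "complex_of_real (vec_nth z j) = complex_of_real (1 / (hnorm (cspace n) u)\<^sup>2) * ip (cspace n) (mat_op (X j) u) u"
      using arg_cong[OF z(2), of "\<lambda>w. vec_nth w j"] by simp
    then show ?thesis using k(3) by (simp add: field_simps)
  qed
  then show ?thesis using z(1) by (intro bexI[of _ z] allI)
qed

section \<open>A diagonal dilation from the vertices of a simplex\<close>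

text \<open>Affine functions contain no products, so they can be evaluated at matrices that do not
  commute. Their nonnegativity on the ball becomes positive semidefiniteness by pairing with vector
  states; this is the step that fails for general convex sets, which have no affine
  coordinates.\<close>

lemma Wmax_level_simplex_subset_Wmin_level:
  fixes X :: "'d::finite \<Rightarrow> complex mat" and x :: "real^'d" and S L :: "(real^'d) set"
  assumes X: "X \<in> Wmax_level n (shifted_ball x C1)" and C1: "C1 > 0"
    and C: "\<not> affine_dependent C" and K: "shifted_ball x C1 \<subseteq> convex hull C" and L: "convex hull C \<subseteq> L"
  shows "X \<in> Wmin_level TYPE('i::infinite) n L"
proof -
  have fin: "finite C" using C by (rule aff_independent_finite)
  have sa: "X \<in> sa_tuples n" using X by (simp add: Wmax_level_def)
  have xK: "x \<in> shifted_ball x C1"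
    unfolding shifted_ball_def by (rule image_eqI[of _ _ 0]) simp_all
  obtain h where h: "bij_betw h {..<card C} C"
    using ex_bij_betw_nat_finite[OF fin] unfolding atLeast0LessThan by (elim exE)
  define N where "N = card C"
  have hC: "h k \<in> C" if "k < N" for k using bij_betwE[OF h] that by (simp add: N_def)
  have sumC: "(\<Sum>c\<in>C. G c) = (\<Sum>k<N. G (h k))" for G :: "_ \<Rightarrow> 'z::comm_monoid_add"
    unfolding N_def by (rule sum.reindex_bij_betw[OF h, symmetric])
  obtain b0 b where b: "\<forall>z\<in>convex hull C. (\<forall>c\<in>C. 0 \<le> b0 c + inner (b c) z) \<and>
    (\<Sum>c\<in>C. b0 c + inner (b c) z) = 1 \<and> (\<Sum>c\<in>C. (b0 c + inner (b c) z) *\<^sub>R c) = z"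
    using simplex_coordinates[OF C] by (elim exE)
  have inn: "inner v z = (\<Sum>i\<in>UNIV. vec_nth v i * vec_nth z i)" for v z :: "real^'d"
    by (simp add: inner_vec_def)
  \<comment> \<open>Comparing coefficients: the constants sum to \<open>1\<close> and the gradients
    to \<open>0\<close>. The next identity does the same for the reconstruction of \<open>z\<close>
    from the vertices.\<close>
  have "(\<Sum>k<N. b0 (h k)) - 1 + (\<Sum>i\<in>UNIV. (\<Sum>k<N. vec_nth (b (h k)) i) * vec_nth z i) = 0"
    if z: "z \<in> shifted_ball x C1" for z
  proof -
    have "(\<Sum>k<N. b0 (h k) + inner (b (h k)) z) = 1"
      using b[rule_format, OF subsetD[OF K z]] unfolding sumC by (elim conjE)
    moreover have "(\<Sum>k<N. inner (b (h k)) z) = (\<Sum>i\<in>UNIV. (\<Sum>k<N. vec_nth (b (h k)) i) * vec_nth z i)"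
      unfolding inn sum_distrib_right by (rule sum.swap)
    ultimately show ?thesis by (simp add: sum.distrib)
  qed
  note one = affine_zero_on_ball[OF C1 this]
  have "(\<Sum>k<N. b0 (h k) * vec_nth (h k) j)
      + (\<Sum>i\<in>UNIV. ((\<Sum>k<N. vec_nth (b (h k)) i * vec_nth (h k) j) - (if i = j then 1 else 0)) * vec_nth z i) = 0"
    if z: "z \<in> shifted_ball x C1" for z j
  proof -
    have "(\<Sum>k<N. (b0 (h k) + inner (b (h k)) z) *\<^sub>R h k) = z"
      using b[rule_format, OF subsetD[OF K z]] unfolding sumC by (elim conjE)
    from arg_cong[OF this, of "\<lambda>v. vec_nth v j"]
    have "(\<Sum>k<N. (b0 (h k) + inner (b (h k)) z) * vec_nth (h k) j) = vec_nth z j"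
      by (simp add: sum_component)
    moreover have "(\<Sum>k<N. inner (b (h k)) z * vec_nth (h k) j)
        = (\<Sum>i\<in>UNIV. (\<Sum>k<N. vec_nth (b (h k)) i * vec_nth (h k) j) * vec_nth z i)"
      unfolding inn sum_distrib_right by (subst sum.swap) (simp add: mult_ac)
    moreover have "(\<Sum>i\<in>UNIV. (if i = j then 1 else 0) * vec_nth z i) = (\<Sum>i\<in>UNIV. if i = j then vec_nth z i else 0)"
      by (rule sum.cong[OF refl]) simp
    ultimately show ?thesis by (simp add: left_diff_distrib sum_subtractf distrib_right sum.distrib)
  qed
  note coord = affine_zero_on_ball[OF C1 this]
  \<comment> \<open>The \<open>k\<close>-th coordinate evaluated at \<open>X\<close>. It is cut off
    outside the \<open>n\<close> by \<open>n\<close> block because \<open>psd_factor\<close> wants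
    Hermitian symmetry and vanishing at all indices.\<close>
  define P where "P k p q = (if p < n \<and> q < n then complex_of_real (b0 (h k)) * (if p = q then 1 else 0)
    + (\<Sum>i\<in>UNIV. complex_of_real (vec_nth (b (h k)) i) * X i $$ (p, q)) else 0)" for k p q
  have "\<exists>F. \<forall>p q. P k p q = (\<Sum>l<n. cnj (F l p) * F l q)" if k: "k < N" for k
  proof (rule psd_factor)
    show "P k q p = cnj (P k p q)" for p q
      using sa_tuplesD(2)[OF sa, of q p] by (simp add: P_def)
    show "P k p q = 0" if "n \<le> p" for p q using that by (simp add: P_def)
    fix u :: "nat \<Rightarrow> complex"
    define u' where "u' = (\<lambda>i. if i < n then u i else 0)"
    have u': "u' \<in> car (cspace n)" by (simp add: u'_def cspace_car)
    have "shifted_ball x C1 \<noteq> {}"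
    proof
      assume "shifted_ball x C1 = {}"
      then show False using xK by simp
    qed
    from Wmax_numerical_range[OF X this u'] obtain z where z: "z \<in> shifted_ball x C1"
      "\<forall>j. ip (cspace n) (mat_op (X j) u') u' = complex_of_real ((hnorm (cspace n) u')\<^sup>2 * vec_nth z j)"
      by (elim bexE)
    have Xu: "ip (cspace n) (mat_op (X j) u') u' = (\<Sum>p<n. \<Sum>q<n. X j $$ (p, q) * u q * cnj (u p))" for j
      unfolding mat_op_ent[OF sa_tuplesD(1)[OF sa]] cspace_ip
      by (rule sum.cong[OF refl]) (simp add: ent_apply u', simp add: u'_def sum_distrib_right)
    have uu: "(\<Sum>p<n. u p * cnj (u p)) = complex_of_real ((hnorm (cspace n) u')\<^sup>2)"
      unfolding cspace.ip_self[OF u', symmetric] cspace_ip by (rule sum.cong[OF refl]) (simp add: u'_def)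
    have "(\<Sum>p<n. \<Sum>q<n. P k p q * u q * cnj (u p))
        = (\<Sum>p<n. \<Sum>q<n. (if p = q then complex_of_real (b0 (h k)) * (u p * cnj (u p)) else 0)
          + (\<Sum>i\<in>UNIV. complex_of_real (vec_nth (b (h k)) i) * (X i $$ (p, q) * u q * cnj (u p))))"
      by (rule sum.cong[OF refl], rule sum.cong[OF refl])
         (simp add: P_def distrib_right sum_distrib_right mult.assoc)
    also have "\<dots> = complex_of_real (b0 (h k)) * (\<Sum>p<n. u p * cnj (u p))
        + (\<Sum>p<n. \<Sum>q<n. \<Sum>i\<in>UNIV. complex_of_real (vec_nth (b (h k)) i) * (X i $$ (p, q) * u q * cnj (u p)))"
      by (simp add: sum.distrib sum_distrib_left)
    also have "(\<Sum>p<n. \<Sum>q<n. \<Sum>i\<in>UNIV. complex_of_real (vec_nth (b (h k)) i) * (X i $$ (p, q) * u q * cnj (u p)))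
        = (\<Sum>p<n. \<Sum>i\<in>UNIV. \<Sum>q<n. complex_of_real (vec_nth (b (h k)) i) * (X i $$ (p, q) * u q * cnj (u p)))"
      by (rule sum.cong[OF refl], rule sum.swap)
    also have "\<dots> = (\<Sum>i\<in>UNIV. \<Sum>p<n. \<Sum>q<n. complex_of_real (vec_nth (b (h k)) i) * (X i $$ (p, q) * u q * cnj (u p)))"
      by (rule sum.swap)
    also have "\<dots> = (\<Sum>i\<in>UNIV. complex_of_real (vec_nth (b (h k)) i) * complex_of_real ((hnorm (cspace n) u')\<^sup>2 * vec_nth z i))"
      by (rule sum.cong[OF refl]) (simp only: sum_distrib_left[symmetric] Xu[symmetric] z(2)[rule_format])
    finally have "(\<Sum>p<n. \<Sum>q<n. P k p q * u q * cnj (u p))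
        = complex_of_real ((hnorm (cspace n) u')\<^sup>2 * (b0 (h k) + inner (b (h k)) z))"
      unfolding uu inn by (simp add: distrib_left sum_distrib_left mult_ac)
    moreover have "0 \<le> (hnorm (cspace n) u')\<^sup>2 * (b0 (h k) + inner (b (h k)) z)"
      using b[rule_format, OF subsetD[OF K z(1)]] hC[OF k] by (intro mult_nonneg_nonneg) simp_all
    ultimately show "0 \<le> Re (\<Sum>p<n. \<Sum>q<n. P k p q * u q * cnj (u p))" by (simp only: Re_complex_of_real)
  qed
  then have "\<forall>k. \<exists>F. k < N \<longrightarrow> (\<forall>p q. P k p q = (\<Sum>l<n. cnj (F l p) * F l q))" by simp
  then obtain F where F: "\<forall>k. k < N \<longrightarrow> (\<forall>p q. P k p q = (\<Sum>l<n. cnj (F k l p) * F k l q))"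
    by (rule choice[THEN exE])
  \<comment> \<open>An index consists of a vertex and a row of the factor of the corresponding
    matrix. Diagonal operators that depend only on the vertex have the vertex values as joint
    eigenvalues.\<close>
  define I where "I = {..<N} \<times> {..<n}"
  define f where "f r q = F (fst r) (snd r) q" for r q
  have weight: "(\<Sum>r\<in>I. c (fst r) * (cnj (f r p) * f r q)) = (\<Sum>k<N. c k * P k p q)" for c p q
  proof -
    have "(\<Sum>r\<in>I. c (fst r) * (cnj (f r p) * f r q)) = (\<Sum>k<N. \<Sum>l<n. c k * (cnj (F k l p) * F k l q))"
      unfolding I_def f_def by (subst sum.cartesian_product) (simp add: case_prod_beta)
    also have "\<dots> = (\<Sum>k<N. c k * P k p q)"
      by (rule sum.cong[OF refl]) (simp add: F[rule_format] sum_distrib_left)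
    finally show ?thesis .
  qed
  have P1: "(\<Sum>k<N. 1 * P k p q) = (if p = q then 1 else 0)" if pq: "p < n" "q < n" for p q
  proof -
    have "(\<Sum>k<N. \<Sum>i\<in>UNIV. complex_of_real (vec_nth (b (h k)) i) * X i $$ (p, q))
        = (\<Sum>i\<in>UNIV. complex_of_real (\<Sum>k<N. vec_nth (b (h k)) i) * X i $$ (p, q))"
      unfolding of_real_sum sum_distrib_right by (rule sum.swap)
    also have "\<dots> = 0" by (simp only: one(2)) simp
    finally have "(\<Sum>k<N. 1 * P k p q) = complex_of_real (\<Sum>k<N. b0 (h k)) * (if p = q then 1 else 0)"
      using pq by (simp only: P_def simp_thms if_True mult_1_left sum.distrib of_real_sum sum_distrib_right) simp
    moreover have "(\<Sum>k<N. b0 (h k)) = 1" using one(1) by simp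
    ultimately show ?thesis by simp
  qed
  have PX: "(\<Sum>k<N. complex_of_real (vec_nth (h k) j) * P k p q) = X j $$ (p, q)" if pq: "p < n" "q < n" for j p q
  proof -
    have "(\<Sum>k<N. complex_of_real (vec_nth (h k) j) * P k p q)
      = (\<Sum>k<N. complex_of_real (b0 (h k) * vec_nth (h k) j) * (if p = q then 1 else 0)
        + (\<Sum>i\<in>UNIV. complex_of_real (vec_nth (b (h k)) i * vec_nth (h k) j) * X i $$ (p, q)))"
      by (rule sum.cong[OF refl]) (simp add: P_def pq distrib_left sum_distrib_left mult_ac)
    also have "\<dots> = complex_of_real (\<Sum>k<N. b0 (h k) * vec_nth (h k) j) * (if p = q then 1 else 0)
        + (\<Sum>k<N. \<Sum>i\<in>UNIV. complex_of_real (vec_nth (b (h k)) i * vec_nth (h k) j) * X i $$ (p, q))"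
      by (simp only: sum.distrib of_real_sum sum_distrib_right)
    also have "(\<Sum>k<N. \<Sum>i\<in>UNIV. complex_of_real (vec_nth (b (h k)) i * vec_nth (h k) j) * X i $$ (p, q))
        = (\<Sum>i\<in>UNIV. complex_of_real (\<Sum>k<N. vec_nth (b (h k)) i * vec_nth (h k) j) * X i $$ (p, q))"
      unfolding of_real_sum sum_distrib_right by (rule sum.swap)
    also have "(\<Sum>k<N. b0 (h k) * vec_nth (h k) j) = 0" by (rule coord(1))
    also have "(\<Sum>i\<in>UNIV. complex_of_real (\<Sum>k<N. vec_nth (b (h k)) i * vec_nth (h k) j) * X i $$ (p, q))
        = (\<Sum>i\<in>UNIV. if i = j then X i $$ (p, q) else 0)"
    proof (rule sum.cong[OF refl])
      fix i
      have "(\<Sum>k<N. vec_nth (b (h k)) i * vec_nth (h k) j) = (if i = j then 1 else 0)"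
        using coord(2) by simp
      then show "complex_of_real (\<Sum>k<N. vec_nth (b (h k)) i * vec_nth (h k) j) * X i $$ (p, q)
          = (if i = j then X i $$ (p, q) else 0)" by simp
    qed
    finally show ?thesis by simp
  qed
  obtain g :: "nat \<Rightarrow> 'i" where g: "inj g"
    using infinite_countable_subset[OF infinite_UNIV] by (elim exE conjE)
  define \<iota> where "\<iota> = g \<circ> prod_encode"
  have inj: "inj \<iota>" unfolding \<iota>_def using g inj_prod_encode by (rule inj_compose)
  interpret coords \<iota> I by unfold_locales (use inj in \<open>simp_all add: I_def\<close>)
  define V where "V u = (if u \<in> car (cspace n)
    then (\<lambda>i. if i \<in> \<iota> ` I then \<Sum>q<n. f (inv_into UNIV \<iota> i) q * u q else 0) else 0)" for u
  define W where "W v = (if v \<in> car E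
    then (\<lambda>q. if q < n then \<Sum>r\<in>I. cnj (f r q) * v (\<iota> r) else 0) else 0)" for v
  have Vc: "V u \<in> car E" for u by (simp add: V_def car_E)
  have Vr: "V u (\<iota> r) = (\<Sum>q<n. f r q * u q)" if "u \<in> car (cspace n)" "r \<in> I" for u r
    using that inj by (simp add: V_def)
  have Wc: "W v \<in> car (cspace n)" for v by (simp add: W_def cspace_car)
  have adj: "ip E (V u) v = ip (cspace n) u (W v)" if u: "u \<in> car (cspace n)" and v: "v \<in> car E" for u v
  proof -
    have "ip E (V u) v = (\<Sum>r\<in>I. \<Sum>q<n. f r q * u q * cnj (v (\<iota> r)))"
      unfolding ip_E by (rule sum.cong[OF refl]) (simp add: Vr[OF u] sum_distrib_right)
    also have "\<dots> = (\<Sum>q<n. \<Sum>r\<in>I. f r q * u q * cnj (v (\<iota> r)))" by (rule sum.swap)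
    also have "\<dots> = ip (cspace n) u (W v)"
      unfolding cspace_ip
      by (rule sum.cong[OF refl]) (simp add: W_def v sum_distrib_left mult_ac)
    finally show ?thesis .
  qed
  \<comment> \<open>The Naimark dilation of the \<open>P k\<close>. Constant weight \<open>1\<close>
    gives the isometry property, and the vertex coordinates as weights give the
    \<open>X j\<close>.\<close>
  have WmV: "W (mul (\<lambda>r. c (fst r)) (V u)) = (\<lambda>p. if p < n then \<Sum>q<n. (\<Sum>k<N. c k * P k p q) * u q else 0)"
    if u: "u \<in> car (cspace n)" for c u
  proof
    fix p
    have "(\<Sum>r\<in>I. cnj (f r p) * mul (\<lambda>r. c (fst r)) (V u) (\<iota> r))
        = (\<Sum>r\<in>I. \<Sum>q<n. c (fst r) * (cnj (f r p) * f r q) * u q)"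
      by (rule sum.cong[OF refl]) (simp add: mul_coord[OF Vc] Vr[OF u] sum_distrib_left mult_ac)
    also have "\<dots> = (\<Sum>q<n. (\<Sum>r\<in>I. c (fst r) * (cnj (f r p) * f r q)) * u q)"
      unfolding sum_distrib_right by (rule sum.swap)
    finally show "W (mul (\<lambda>r. c (fst r)) (V u)) p = (if p < n then \<Sum>q<n. (\<Sum>k<N. c k * P k p q) * u q else 0)"
      by (simp add: W_def mul_car weight)
  qed
  have WV: "W (V u) = u" if u: "u \<in> car (cspace n)" for u
  proof -
    have "W (V u) = W (mul (\<lambda>r. 1) (V u))" using Vc[of u] by (simp add: mul_one id_op_def)
    also have "\<dots> = (\<lambda>p. if p < n then \<Sum>q<n. (\<Sum>k<N. 1 * P k p q) * u q else 0)" by (rule WmV[OF u])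
    also have "\<dots> = u"
    proof
      fix p
      have "(\<Sum>q<n. (\<Sum>k<N. 1 * P k p q) * u q) = (\<Sum>q<n. if p = q then u q else 0)" if p: "p < n"
        by (rule sum.cong[OF refl]) (simp only: P1[OF p] lessThan_iff, simp)
      then show "(if p < n then \<Sum>q<n. (\<Sum>k<N. 1 * P k p q) * u q else 0) = u p"
        using u by (cases "p < n") (simp_all add: cspace_car)
    qed
    finally show ?thesis .
  qed
  have iso: "hnorm E (V u) = hnorm (cspace n) u" if u: "u \<in> car (cspace n)" for u
    unfolding hnorm_def adj[OF u Vc] WV[OF u] ..
  have Vb: "V \<in> bounded_ops (cspace n) E"
    unfolding bounded_ops_def
  proof (intro CollectI conjI allI ballI impI)
    fix u v :: "nat \<Rightarrow> complex" assume uv: "u \<in> car (cspace n)" "v \<in> car (cspace n)"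
    show "V (u + v) = V u + V v"
      by (rule E_eqI[OF Vc car_add[OF Vc Vc]])
         (simp add: Vr uv distrib_left sum.distrib)
  next
    fix c and u :: "nat \<Rightarrow> complex" assume u: "u \<in> car (cspace n)"
    show "V (scaleC c u) = scaleC c (V u)"
      by (rule E_eqI[OF Vc car_scaleC[OF Vc]])
         (simp add: Vr u scaleC_def[of c "V u"], simp add: scaleC_def sum_distrib_left mult_ac)
  next
    show "\<exists>b. \<forall>u\<in>car (cspace n). hnorm E (V u) \<le> b * hnorm (cspace n) u"
      by (rule exI[of _ 1]) (simp add: iso)
  qed (simp_all add: Vc, simp add: V_def)
  \<comment> \<open>The squared norm of \<open>W v\<close> is the inner product of
    \<open>V (W v)\<close> with \<open>v\<close>, and \<open>V\<close> preserves the norm of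
    \<open>W v\<close>; cancelling one factor shows that \<open>W\<close> is a contraction.\<close>
  have Wn: "hnorm (cspace n) (W v) \<le> hnorm E v" if v: "v \<in> car E" for v
  proof (cases "hnorm (cspace n) (W v) = 0")
    case False
    have "(hnorm (cspace n) (W v))\<^sup>2 = cmod (ip E (V (W v)) v)"
      unfolding adj[OF Wc v] cspace.ip_self[OF Wc] norm_of_real by simp
    also have "\<dots> \<le> hnorm (cspace n) (W v) * hnorm E v"
      using cauchy_schwarz[OF Vc v, of "W v"] by (simp only: iso[OF Wc])
    finally have "hnorm (cspace n) (W v) * hnorm (cspace n) (W v) \<le> hnorm (cspace n) (W v) * hnorm E v"
      by (simp only: power2_eq_square)
    moreover have "hnorm (cspace n) (W v) > 0" using False cspace.hnorm_nonneg[OF Wc[of v]] by linarith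
    ultimately show ?thesis by (simp only: mult_le_cancel_left_pos)
  qed (use v in simp)
  have Wb: "W \<in> bounded_ops E (cspace n)"
    unfolding bounded_ops_def
  proof (intro CollectI conjI allI ballI impI)
    fix u v :: "'i \<Rightarrow> complex" assume uv: "u \<in> car E" "v \<in> car E"
    show "W (u + v) = W u + W v"
      using uv car_add[OF uv] by (simp add: W_def fun_eq_iff distrib_left sum.distrib)
  next
    fix c and u :: "'i \<Rightarrow> complex" assume u: "u \<in> car E"
    show "W (scaleC c u) = scaleC c (W u)"
      using u car_scaleC[OF u, of c]
      by (simp add: W_def fun_eq_iff scaleC_def sum_distrib_left mult.left_commute)
  next
    show "\<exists>b. \<forall>u\<in>car E. hnorm (cspace n) (W u) \<le> b * hnorm E u"
      by (rule exI[of _ 1]) (simp add: Wn)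
  qed (simp_all add: Wc, simp add: W_def)
  define M where "M j = mul (\<lambda>r. complex_of_real (vec_nth (h (fst r)) j))" for j
  have "mat_op (X j) = W \<circ> M j \<circ> V" for j
  proof
    fix u
    show "mat_op (X j) u = (W \<circ> M j \<circ> V) u"
    proof (cases "u \<in> car (cspace n)")
      case True
      have "(W \<circ> M j \<circ> V) u = (\<lambda>p. if p < n then \<Sum>q<n. (\<Sum>k<N. complex_of_real (vec_nth (h k) j) * P k p q) * u q else 0)"
        unfolding comp_apply M_def by (rule WmV[OF True])
      also have "\<dots> = ent n (\<lambda>p q. X j $$ (p, q)) u"
        using True by (simp add: ent_apply PX fun_eq_iff)
      finally show ?thesis by (simp add: mat_op_ent[OF sa_tuplesD(1)[OF sa]])
    next
      case False
      then have "V u = 0" by (simp add: V_def)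
      moreover have "M j 0 = 0" unfolding M_def by (rule op_zero[OF mul_bop])
      moreover have "W 0 = 0" by (simp add: W_def fun_eq_iff)
      ultimately show ?thesis
        using False by (simp add: mat_op_ent[OF sa_tuplesD(1)[OF sa]] ent_apply)
    qed
  qed
  then have "dilates (cspace n) (\<lambda>j. mat_op (X j)) E M"
    unfolding dilates_def isometry_op_def is_adjoint_def
    using Vb Wb iso adj by (intro exI[of _ V] exI[of _ W] conjI ballI allI)
  moreover have "joint_spectrum E M \<subseteq> complexify L"
  proof
    fix z assume "z \<in> joint_spectrum E M"
    then obtain r where r: "r \<in> I" "z = (\<chi> j. complex_of_real (vec_nth (h (fst r)) j))"
      using joint_spectrum_mul[of z "\<lambda>j r. complex_of_real (vec_nth (h (fst r)) j)"]
      unfolding M_def by auto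
    have "fst r < N" using r(1) by (auto simp: I_def)
    then have "h (fst r) \<in> L" using hC hull_subset[of C convex] L by blast
    then show "z \<in> complexify L" unfolding complexify_def r(2) by (rule imageI)
  qed
  moreover have "normal_tuple E M" unfolding M_def by (rule normal_tuple_mul)
  ultimately show ?thesis
    unfolding Wmin_level_def using sa hilbert_space_E by (intro CollectI conjI exI)
qed

section \<open>The cycle of implications\<close>

text \<open>Recovers the level from the dimensions of the matrices, as needed to pass from the
  inclusion of unions in (1) to the single level in (2).\<close>

lemma Wmax_level_dim_eq:
  assumes "X \<in> Wmax_level m K" "X \<in> sa_tuples n"
  shows "m = n"
proof -
  have "X \<in> sa_tuples m" using assms(1) by (simp add: Wmax_level_def)
  from sa_tuplesD(1)[OF this] sa_tuplesD(1)[OF assms(2)] show ?thesis by (metis carrier_matD(1))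
qed

theorem theorem5p6:
  fixes x y :: "real^'d::finite" and C1 C2 :: real and idx :: "'d \<Rightarrow> nat"
  assumes "CARD('d) \<ge> 2"
    and "bij_betw idx UNIV {1..CARD('d)}"
    and "C1 > 0" and "C2 > 0"
  shows
    "let d = CARD('d);
         K = shifted_ball x C1;
         L = shifted_ball y C2;
         P1 = (Wmax K \<subseteq> Wmin TYPE('i::infinite) L);
         P2 = (Wmax_level (2 ^ (d - 1)) K \<subseteq> Wmin_level TYPE('i) (2 ^ (d - 1)) L);
         P3 = (shifted_tuple (2 ^ (d - 1)) x C1 (\<lambda>j. Fmat d (idx j))
                 \<in> Wmin_level TYPE('i) (2 ^ (d - 1)) L);
         P4 = (C2 \<ge> sqrt ((norm (y - x))\<^sup>2 + C1\<^sup>2 * (real d - 1)\<^sup>2) + C1);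
         P5 = (\<exists>n S. n simplex S \<and> K \<subseteq> S \<and> S \<subseteq> L)
     in (P1 \<longleftrightarrow> P2) \<and> (P2 \<longleftrightarrow> P3) \<and> (P3 \<longleftrightarrow> P4) \<and> (P4 \<longleftrightarrow> P5)"
proof -
  let ?N = "2 ^ (CARD('d) - 1) :: nat"
  let ?K = "shifted_ball x C1" and ?L = "shifted_ball y C2"
  let ?F = "\<lambda>j. Fmat CARD('d) (idx j)"
  have F: "?F j \<in> carrier_mat ?N ?N" for j
    using Fmat_carrier[of "CARD('d) - 1" "idx j"] assms(1) by simp
  have cliff: "clifford ?N (\<lambda>j p k. if p < ?N \<and> k < ?N then ?F j $$ (p, k) else 0)"
    by (rule clifford_Fmat[OF assms(2)])
  have 12: "Wmax_level ?N ?K \<subseteq> Wmin_level TYPE('i) ?N ?L" if P1: "Wmax ?K \<subseteq> Wmin TYPE('i) ?L"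
  proof
    fix X assume X: "X \<in> Wmax_level ?N ?K"
    then have "X \<in> Wmax ?K" unfolding Wmax_def by auto
    then obtain m where m: "X \<in> Wmin_level TYPE('i) m ?L" using subsetD[OF P1] unfolding Wmin_def by auto
    then have "X \<in> sa_tuples m" by (simp add: Wmin_level_def)
    from Wmax_level_dim_eq[OF X this] m show "X \<in> Wmin_level TYPE('i) ?N ?L" by simp
  qed
  have 23: "shifted_tuple ?N x C1 ?F \<in> Wmin_level TYPE('i) ?N ?L"
    if "Wmax_level ?N ?K \<subseteq> Wmin_level TYPE('i) ?N ?L"
    by (rule subsetD[OF that clifford_tuple_in_Wmax]) (use assms(3) F cliff in simp_all)
  have 34: "C2 \<ge> sqrt ((norm (y - x))\<^sup>2 + C1\<^sup>2 * (real CARD('d) - 1)\<^sup>2) + C1"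
    if "shifted_tuple ?N x C1 ?F \<in> Wmin_level TYPE('i) ?N ?L"
    by (rule Wmin_level_clifford_radius[OF F _ assms(1) cliff assms(3,4) that]) simp
  have 45: "\<exists>n S. n simplex S \<and> ?K \<subseteq> S \<and> S \<subseteq> ?L"
    if "C2 \<ge> sqrt ((norm (y - x))\<^sup>2 + C1\<^sup>2 * (real CARD('d) - 1)\<^sup>2) + C1"
    by (rule simplex_between_shifted_balls) (use assms that in simp_all)
  have 51: "Wmax ?K \<subseteq> Wmin TYPE('i) ?L" if "\<exists>n S. n simplex S \<and> ?K \<subseteq> S \<and> S \<subseteq> ?L"
  proof -
    from that obtain C where "\<not> affine_dependent C" "?K \<subseteq> convex hull C" "convex hull C \<subseteq> ?L"
      unfolding simplex_def by blast
    from Wmax_level_simplex_subset_Wmin_level[OF _ assms(3) this] show ?thesis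
      unfolding Wmax_def Wmin_def by blast
  qed
  show ?thesis unfolding Let_def using 12 23 34 45 51 by blast
qed

end
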